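(* Let $f:\mathbb S^1\times\mathbb R\to\mathbb R$ be a smooth tame function, and let $F:B^1\to B^0$ be given by $F(u)(t)=u'(t)+f(t,u(t))$. Write $F(\tilde u+\overline u)=\tilde v+\overline v$, where $u=\tilde u+\overline u$ and $v=F(u)=\tilde v+\overline v$ are the decompositions into average-zero part and average. Then the map $\Psi:B^1\to B^0$, $\Psi(u)=\tilde v+\overline u$ (that is, $\Psi(u)=F(u)-\int F(u)+\int u$), is a (global) diffeomorphism.
   Context: $\mathbb S^1=\mathbb R/\mathbb Z$. The pair $(B^1,B^0)$ is either $(H^1(\mathbb S^1;\mathbb R),L^2(\mathbb S^1;\mathbb R))$ ("$H$ case") or $(C^1(\mathbb S^1;\mathbb R),C^0(\mathbb S^1;\mathbb R))$ ("$C$ case"); the result is asserted in both cases. For $u\in B^i$, $\overline u=\int_{\mathbb S^1}u(t)\,dt\in\mathbb R$ (identified with a constant function) and $\tilde u=u-\overline u$. A function $f:\mathbb S^1\times\mathbb R\to\mathbb R$ is *wild at $+\infty$* (resp. *wild at $-\infty$* ) if both $$\int_I\frac{ds}{\max(1,\sup_{t\in\mathbb S^1}f(t,s))}<+\infty\quad\text{and}\quad\int_I\frac{ds}{\max(1,\sup_{t\in\mathbb S^1}(-f(t,s)))}<+\infty$$ for $I=[0,+\infty)$ (resp. $I=(-\infty,0]$). $f$ is *tame* if it is wild neither at $+\infty$ nor at $-\infty$. *)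

theory Defs
  imports "HOL-Analysis.Analysis"
begin

section \<open>Smooth maps and diffeomorphisms of normed spaces\<close>

text \<open>
  Lists of length \<open>k\<close> serve as \<open>k\<close>-tuples of vectors; the values of \<open>L\<close> on lists of other lengths
  are irrelevant.
\<close>

definition bounded_multilinear ::
    "nat \<Rightarrow> ('a::real_normed_vector list \<Rightarrow> 'b::real_normed_vector) \<Rightarrow> bool" where
  "bounded_multilinear k L \<longleftrightarrow>
     (\<forall>vs i. length vs = k \<longrightarrow> i < k \<longrightarrow> linear (\<lambda>x. L (vs[i := x]))) \<and>
     (\<exists>K. \<forall>vs. length vs = k \<longrightarrow> norm (L vs) \<le> K * prod_list (map norm vs))"

text \<open>
  \<open>f\<close> is of class \<open>C\<^sup>\<infinity>\<close> in the sense of Frechet: there are iterated Frechet derivatives of all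
  orders. The iterated spaces \<open>L(E, L(E, \<dots>))\<close> are different types for different orders, so the
  \<open>k\<close>-th derivative at \<open>x\<close> is represented by the bounded \<open>k\<close>-linear map \<open>D k x\<close>, and the last
  conjunct says that \<open>D (k + 1) x\<close> is the Frechet derivative at \<open>x\<close> of \<open>D k\<close> with respect to the
  operator norm on \<open>k\<close>-linear maps.
\<close>

definition smooth :: "('a::real_normed_vector \<Rightarrow> 'b::real_normed_vector) \<Rightarrow> bool" where
  "smooth f \<longleftrightarrow> (\<exists>D :: nat \<Rightarrow> 'a \<Rightarrow> 'a list \<Rightarrow> 'b.
     (\<forall>x. D 0 x [] = f x) \<and>
     (\<forall>k x. bounded_multilinear k (D k x)) \<and>
     (\<forall>k x. \<forall>e>0. \<exists>d>0. \<forall>h. norm h < d \<longrightarrow>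
        (\<forall>vs. length vs = k \<longrightarrow>
           norm (D k (x + h) vs - D k x vs - D (Suc k) x (h # vs))
             \<le> e * norm h * prod_list (map norm vs))))"

definition diffeomorphism :: "('a::real_normed_vector \<Rightarrow> 'b::real_normed_vector) \<Rightarrow> bool" where
  "diffeomorphism \<Phi> \<longleftrightarrow> bij \<Phi> \<and> smooth \<Phi> \<and> smooth (inv \<Phi>)"

lemma smooth_imp_differentiable:
  assumes "smooth f"
  shows "f differentiable (at x)"
proof -
  obtain D where D0: "\<And>x. D 0 x [] = f x"
    and ml: "\<And>k x. bounded_multilinear k (D k x)"
    and fr: "\<And>k x e. e > 0 \<Longrightarrow> \<exists>d>0. \<forall>h. norm h < d \<longrightarrow> (\<forall>vs. length vs = k \<longrightarrow>
           norm (D k (x + h) vs - D k x vs - D (Suc k) x (h # vs))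
             \<le> e * norm h * prod_list (map norm vs))"
    using assms unfolding smooth_def by blast
  have lin: "linear (\<lambda>h. D 1 x [h])"
    using ml[of 1 x] unfolding bounded_multilinear_def by (auto dest!: spec[of _ "[0]"])
  obtain K where K': "\<And>vs. length vs = 1 \<Longrightarrow> norm (D 1 x vs) \<le> K * prod_list (map norm vs)"
    using ml[of 1 x] unfolding bounded_multilinear_def by blast
  have K: "norm (D 1 x [h]) \<le> K * norm h" for h
    using K'[of "[h]"] by simp
  have bl: "bounded_linear (\<lambda>h. D 1 x [h])"
    by (rule bounded_linear_intro[where K = K])
       (use linear_add[OF lin] linear_cmul[OF lin] K in \<open>auto simp: mult.commute\<close>)
  have "(f has_derivative (\<lambda>h. D 1 x [h])) (at x)"
    unfolding has_derivative_at_alt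
  proof (intro conjI bl allI impI)
    fix e :: real assume "e > 0"
    then obtain d where d: "d > 0" and *: "\<And>h vs. norm h < d \<Longrightarrow> length vs = 0 \<Longrightarrow>
           norm (D 0 (x + h) vs - D 0 x vs - D (Suc 0) x (h # vs))
             \<le> e * norm h * prod_list (map norm vs)"
      using fr[of e 0 x] by auto
    have "norm (f y - f x - D 1 x [y - x]) \<le> e * norm (y - x)" if "norm (y - x) < d" for y
      using *[OF that, of "[]"] by (simp add: D0)
    with d show "\<exists>d>0. \<forall>y. norm (y - x) < d \<longrightarrow> norm (f y - f x - D 1 x [y - x]) \<le> e * norm (y - x)"
      by blast
  qed
  then show ?thesis unfolding differentiable_def by blast
qed

lemma smooth_imp_continuous_on: "smooth f \<Longrightarrow> continuous_on S f"
  by (meson continuous_at_imp_continuous_on differentiable_imp_continuous_within smooth_imp_differentiable)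

section \<open>Wild and tame functions\<close>

text \<open>
  Functions on \<open>S\<^sup>1 = \<real> / \<int>\<close> are rendered throughout as 1-periodic functions on \<open>\<real>\<close> or, when
  only values almost everywhere matter, as functions on the fundamental domain \<open>[0, 1)\<close>.
  For continuous \<open>f\<close>, 1-periodic in its first argument, the suprema below are finite.
\<close>

definition wild_on :: "real set \<Rightarrow> (real \<Rightarrow> real \<Rightarrow> real) \<Rightarrow> bool" where
  "wild_on I f \<longleftrightarrow>
     (\<integral>\<^sup>+s\<in>I. ennreal (1 / max 1 (SUP t. f t s)) \<partial>lborel) < \<infinity> \<and>
     (\<integral>\<^sup>+s\<in>I. ennreal (1 / max 1 (SUP t. - f t s)) \<partial>lborel) < \<infinity>"

definition wild_at_pos_infinity :: "(real \<Rightarrow> real \<Rightarrow> real) \<Rightarrow> bool" where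
  "wild_at_pos_infinity f \<longleftrightarrow> wild_on {0..} f"

definition wild_at_neg_infinity :: "(real \<Rightarrow> real \<Rightarrow> real) \<Rightarrow> bool" where
  "wild_at_neg_infinity f \<longleftrightarrow> wild_on {..0} f"

definition tame :: "(real \<Rightarrow> real \<Rightarrow> real) \<Rightarrow> bool" where
  "tame f \<longleftrightarrow> \<not> wild_at_pos_infinity f \<and> \<not> wild_at_neg_infinity f"

section \<open>The spaces \<open>C\<^sup>0(S\<^sup>1)\<close> and \<open>C\<^sup>1(S\<^sup>1)\<close>\<close>

definition periodic :: "(real \<Rightarrow> 'a) \<Rightarrow> bool" where
  "periodic u \<longleftrightarrow> (\<forall>t. u (t + 1) = u t)"

typedef circle_C0 = "{u :: real \<Rightarrow>\<^sub>C real. periodic (apply_bcontfun u)}"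
  by (rule exI[of _ 0]) (simp add: periodic_def)

setup_lifting type_definition_circle_C0

text \<open>The vector space structure and the supremum norm are inherited from \<open>\<real> \<Rightarrow>\<^sub>C \<real>\<close>.\<close>

instantiation circle_C0 :: real_normed_vector
begin

lift_definition zero_circle_C0 :: circle_C0 is 0 by (simp add: periodic_def)
lift_definition plus_circle_C0 :: "circle_C0 \<Rightarrow> circle_C0 \<Rightarrow> circle_C0" is "(+)"
  by (simp add: periodic_def)
lift_definition minus_circle_C0 :: "circle_C0 \<Rightarrow> circle_C0 \<Rightarrow> circle_C0" is "(-)"
  by (simp add: periodic_def)
lift_definition uminus_circle_C0 :: "circle_C0 \<Rightarrow> circle_C0" is uminus
  by (simp add: periodic_def)
lift_definition scaleR_circle_C0 :: "real \<Rightarrow> circle_C0 \<Rightarrow> circle_C0" is scaleR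
  by (simp add: periodic_def)
lift_definition norm_circle_C0 :: "circle_C0 \<Rightarrow> real" is norm .
definition dist_circle_C0 :: "circle_C0 \<Rightarrow> circle_C0 \<Rightarrow> real" where
  "dist_circle_C0 u v = norm (u - v)"
definition sgn_circle_C0 :: "circle_C0 \<Rightarrow> circle_C0" where
  "sgn_circle_C0 u = scaleR (inverse (norm u)) u"
definition uniformity_circle_C0 :: "(circle_C0 \<times> circle_C0) filter" where
  "uniformity_circle_C0 = (INF e\<in>{0<..}. principal {(x, y). dist x y < e})"
definition open_circle_C0 :: "circle_C0 set \<Rightarrow> bool" where
  "open_circle_C0 U = (\<forall>x\<in>U. eventually (\<lambda>(x', y). x' = x \<longrightarrow> y \<in> U) uniformity)"

instance
proof
  fix a b :: real and x y z :: circle_C0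
  show "x + y + z = x + (y + z)" "x + y = y + x" "0 + x = x" "- x + x = 0" "x - y = x + - y"
    by (transfer, simp add: algebra_simps)+
  show "a *\<^sub>R (x + y) = a *\<^sub>R x + a *\<^sub>R y" "(a + b) *\<^sub>R x = a *\<^sub>R x + b *\<^sub>R x"
    "a *\<^sub>R b *\<^sub>R x = (a * b) *\<^sub>R x" "1 *\<^sub>R x = x"
    by (transfer, simp add: algebra_simps)+
  show "(norm x = 0) = (x = 0)" "norm (x + y) \<le> norm x + norm y" "norm (a *\<^sub>R x) = \<bar>a\<bar> * norm x"
    by (transfer, simp add: norm_triangle_ineq)+
qed (simp_all add: dist_circle_C0_def sgn_circle_C0_def uniformity_circle_C0_def open_circle_C0_def)

end

lift_definition eval_C0 :: "circle_C0 \<Rightarrow> real \<Rightarrow> real" is apply_bcontfun .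

lift_definition const_C0 :: "real \<Rightarrow> circle_C0" is const_bcontfun by (simp add: periodic_def)

text \<open>Only meaningful when \<open>g\<close> is continuous and 1-periodic.\<close>

definition mk_C0 :: "(real \<Rightarrow> real) \<Rightarrow> circle_C0" where
  "mk_C0 g = Abs_circle_C0 (Bcontfun g)"

lemma eval_C0_inject: "eval_C0 u = eval_C0 v \<longleftrightarrow> u = v"
  by transfer (simp add: apply_bcontfun_inject)

lemma eval_C0_simps [simp]:
  "eval_C0 0 t = 0" "eval_C0 (u + v) t = eval_C0 u t + eval_C0 v t"
  "eval_C0 (u - v) t = eval_C0 u t - eval_C0 v t" "eval_C0 (- u) t = - eval_C0 u t"
  "eval_C0 (r *\<^sub>R u) t = r * eval_C0 u t" "eval_C0 (const_C0 r) t = r"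
  by (transfer, simp)+

lemma continuous_on_eval_C0: "continuous_on S (eval_C0 u)"
  by transfer simp

lemma periodic_eval_C0: "periodic (eval_C0 u)"
  by transfer simp

lemma norm_C0_eq_SUP: "norm u = (SUP t. \<bar>eval_C0 u t\<bar>)"
  by transfer (simp add: norm_bcontfun_def dist_bcontfun.rep_eq)

lemma periodic_of_int:
  assumes "periodic u"
  shows "u (t + of_int n) = u t"
proof -
  have nat: "u (t + real k) = u t" for t and k :: nat
  proof (induction k)
    case (Suc k)
    have "u (t + real (Suc k)) = u ((t + real k) + 1)" by (simp add: algebra_simps)
    with Suc show ?case using assms by (simp add: periodic_def)
  qed simp
  show ?thesis
  proof (cases "n \<ge> 0")
    case True then show ?thesis using nat[of t "nat n"] by simp
  next
    case False then show ?thesis using nat[of "t + of_int n" "nat (- n)"] by simp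
  qed
qed

lemma periodic_frac: "periodic u \<Longrightarrow> u (frac t) = u t"
  using periodic_of_int[of u "frac t" "floor t"] by (simp add: frac_def)

lemma periodic_continuous_bounded:
  fixes u :: "real \<Rightarrow> real"
  assumes "periodic u" "continuous_on UNIV u"
  shows "bounded (range u)"
proof -
  have "range u \<subseteq> u ` {0..1}"
  proof
    fix y assume "y \<in> range u"
    then obtain t where "y = u t" by blast
    then have "y = u (frac t)" "frac t \<in> {0..1}"
      using periodic_frac[OF assms(1)] frac_lt_1[of t] by (auto simp: less_imp_le)
    then show "y \<in> u ` {0..1}" by blast
  qed
  moreover have "compact (u ` {0..1})"
    by (rule compact_continuous_image) (use assms(2) continuous_on_subset in auto)
  ultimately show ?thesis by (meson bounded_subset compact_imp_bounded)
qed

lemma eval_mk_C0: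
  assumes "periodic g" "continuous_on UNIV g"
  shows "eval_C0 (mk_C0 g) = g"
proof -
  have "g \<in> bcontfun"
    using assms periodic_continuous_bounded by (auto simp: bcontfun_def)
  then have "apply_bcontfun (Bcontfun g) = g" by (rule Bcontfun_inverse)
  with assms(1) show ?thesis
    by (simp add: mk_C0_def eval_C0.rep_eq Abs_circle_C0_inverse)
qed

definition has_deriv_C0 :: "circle_C0 \<Rightarrow> circle_C0 \<Rightarrow> bool" where
  "has_deriv_C0 u w \<longleftrightarrow> (\<forall>t. (eval_C0 u has_real_derivative eval_C0 w t) (at t))"

lemma has_deriv_C0_unique: "has_deriv_C0 u w \<Longrightarrow> has_deriv_C0 u w' \<Longrightarrow> w = w'"
  unfolding has_deriv_C0_def by (metis DERIV_unique eval_C0_inject ext)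

lemma has_deriv_C0_zero: "has_deriv_C0 0 0"
  and has_deriv_C0_add: "has_deriv_C0 u u' \<Longrightarrow> has_deriv_C0 v v' \<Longrightarrow> has_deriv_C0 (u + v) (u' + v')"
  and has_deriv_C0_diff: "has_deriv_C0 u u' \<Longrightarrow> has_deriv_C0 v v' \<Longrightarrow> has_deriv_C0 (u - v) (u' - v')"
  and has_deriv_C0_minus: "has_deriv_C0 u u' \<Longrightarrow> has_deriv_C0 (- u) (- u')"
  and has_deriv_C0_scaleR: "has_deriv_C0 u u' \<Longrightarrow> has_deriv_C0 (r *\<^sub>R u) (r *\<^sub>R u')"
proof -
  have e: "eval_C0 0 = (\<lambda>t. 0)" "eval_C0 (u + v) = (\<lambda>t. eval_C0 u t + eval_C0 v t)"
    "eval_C0 (u - v) = (\<lambda>t. eval_C0 u t - eval_C0 v t)" "eval_C0 (- u) = (\<lambda>t. - eval_C0 u t)"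
    "eval_C0 (r *\<^sub>R u) = (\<lambda>t. r * eval_C0 u t)" for u v r
    by auto
  note defs = has_deriv_C0_def e
  show "has_deriv_C0 0 0" by (simp add: defs)
  show "has_deriv_C0 (u + v) (u' + v')" if "has_deriv_C0 u u'" "has_deriv_C0 v v'"
    using that by (simp add: defs DERIV_add)
  show "has_deriv_C0 (u - v) (u' - v')" if "has_deriv_C0 u u'" "has_deriv_C0 v v'"
    using that by (simp add: defs DERIV_diff)
  show "has_deriv_C0 (- u) (- u')" if "has_deriv_C0 u u'"
    using that by (simp add: defs DERIV_minus)
  show "has_deriv_C0 (r *\<^sub>R u) (r *\<^sub>R u')" if "has_deriv_C0 u u'"
    using that by (simp add: defs DERIV_cmult)
qed

typedef circle_C1 = "{u :: circle_C0. \<exists>w. has_deriv_C0 u w}"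
  morphisms C0_of_C1 Abs_circle_C1
  using has_deriv_C0_zero by blast

definition deriv_C1 :: "circle_C1 \<Rightarrow> circle_C0" where
  "deriv_C1 u = (THE w. has_deriv_C0 (C0_of_C1 u) w)"

lemma has_deriv_C0_deriv_C1: "has_deriv_C0 (C0_of_C1 u) (deriv_C1 u)"
proof -
  obtain w where "has_deriv_C0 (C0_of_C1 u) w" using C0_of_C1[of u] by blast
  then show ?thesis unfolding deriv_C1_def by (rule theI) (use \<open>has_deriv_C0 _ w\<close> has_deriv_C0_unique in blast)
qed

lemma deriv_C1_eqI: "has_deriv_C0 (C0_of_C1 u) w \<Longrightarrow> deriv_C1 u = w"
  using has_deriv_C0_deriv_C1 has_deriv_C0_unique by blast

lemma C0_of_C1_Abs: "has_deriv_C0 u w \<Longrightarrow> C0_of_C1 (Abs_circle_C1 u) = u"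
  by (rule Abs_circle_C1_inverse) blast

text \<open>The norm is \<open>\<parallel>u\<parallel>\<^sub>\<infinity> + \<parallel>u'\<parallel>\<^sub>\<infinity>\<close>.\<close>

instantiation circle_C1 :: real_normed_vector
begin

definition zero_circle_C1 :: circle_C1 where
  "zero_circle_C1 = Abs_circle_C1 0"
definition plus_circle_C1 :: "circle_C1 \<Rightarrow> circle_C1 \<Rightarrow> circle_C1" where
  "plus_circle_C1 u v = Abs_circle_C1 (C0_of_C1 u + C0_of_C1 v)"
definition minus_circle_C1 :: "circle_C1 \<Rightarrow> circle_C1 \<Rightarrow> circle_C1" where
  "minus_circle_C1 u v = Abs_circle_C1 (C0_of_C1 u - C0_of_C1 v)"
definition uminus_circle_C1 :: "circle_C1 \<Rightarrow> circle_C1" where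
  "uminus_circle_C1 u = Abs_circle_C1 (- C0_of_C1 u)"
definition scaleR_circle_C1 :: "real \<Rightarrow> circle_C1 \<Rightarrow> circle_C1" where
  "scaleR_circle_C1 r u = Abs_circle_C1 (r *\<^sub>R C0_of_C1 u)"
definition norm_circle_C1 :: "circle_C1 \<Rightarrow> real" where
  "norm_circle_C1 u = norm (C0_of_C1 u) + norm (deriv_C1 u)"
definition dist_circle_C1 :: "circle_C1 \<Rightarrow> circle_C1 \<Rightarrow> real" where
  "dist_circle_C1 u v = norm (u - v)"
definition sgn_circle_C1 :: "circle_C1 \<Rightarrow> circle_C1" where
  "sgn_circle_C1 u = scaleR (inverse (norm u)) u"
definition uniformity_circle_C1 :: "(circle_C1 \<times> circle_C1) filter" where
  "uniformity_circle_C1 = (INF e\<in>{0<..}. principal {(x, y). dist x y < e})"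
definition open_circle_C1 :: "circle_C1 set \<Rightarrow> bool" where
  "open_circle_C1 U = (\<forall>x\<in>U. eventually (\<lambda>(x', y). x' = x \<longrightarrow> y \<in> U) uniformity)"

lemma C0_of_C1_simps:
  "C0_of_C1 0 = 0" "C0_of_C1 (u + v) = C0_of_C1 u + C0_of_C1 v"
  "C0_of_C1 (u - v) = C0_of_C1 u - C0_of_C1 v" "C0_of_C1 (- u) = - C0_of_C1 u"
  "C0_of_C1 (r *\<^sub>R u) = r *\<^sub>R C0_of_C1 u"
  unfolding zero_circle_C1_def plus_circle_C1_def minus_circle_C1_def uminus_circle_C1_def
    scaleR_circle_C1_def
  by (simp_all add: C0_of_C1_Abs[OF has_deriv_C0_zero]
      C0_of_C1_Abs[OF has_deriv_C0_add[OF has_deriv_C0_deriv_C1 has_deriv_C0_deriv_C1]] C0_of_C1_Abs[OF has_deriv_C0_diff[OF has_deriv_C0_deriv_C1 has_deriv_C0_deriv_C1]]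
      C0_of_C1_Abs[OF has_deriv_C0_minus[OF has_deriv_C0_deriv_C1]] C0_of_C1_Abs[OF has_deriv_C0_scaleR[OF has_deriv_C0_deriv_C1]])

lemma deriv_C1_simps:
  "deriv_C1 0 = 0" "deriv_C1 (u + v) = deriv_C1 u + deriv_C1 v"
  "deriv_C1 (u - v) = deriv_C1 u - deriv_C1 v" "deriv_C1 (- u) = - deriv_C1 u"
  "deriv_C1 (r *\<^sub>R u) = r *\<^sub>R deriv_C1 u"
  by (rule deriv_C1_eqI; simp add: C0_of_C1_simps has_deriv_C0_zero has_deriv_C0_add
      has_deriv_C0_diff has_deriv_C0_minus has_deriv_C0_scaleR has_deriv_C0_deriv_C1)+

instance
proof
  fix a b :: real and x y z :: circle_C1
  note e = C0_of_C1_simps and d = deriv_C1_simps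
  have eqI: "u = v" if "C0_of_C1 u = C0_of_C1 v" for u v
    using that by (simp add: C0_of_C1_inject)
  show "x + y + z = x + (y + z)" "x + y = y + x" "0 + x = x" "- x + x = 0" "x - y = x + - y"
    by (rule eqI, simp add: e)+
  show "a *\<^sub>R (x + y) = a *\<^sub>R x + a *\<^sub>R y" "(a + b) *\<^sub>R x = a *\<^sub>R x + b *\<^sub>R x"
    "a *\<^sub>R b *\<^sub>R x = (a * b) *\<^sub>R x" "1 *\<^sub>R x = x"
    by (rule eqI, simp add: e scaleR_add_right scaleR_add_left)+
  show "(norm x = 0) = (x = 0)"
  proof
    assume "norm x = 0"
    then have "C0_of_C1 x = C0_of_C1 0"
      by (simp add: norm_circle_C1_def add_nonneg_eq_0_iff e)
    then show "x = 0" by (simp add: C0_of_C1_inject)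
  qed (simp add: norm_circle_C1_def e d)
  show "norm (x + y) \<le> norm x + norm y"
    unfolding norm_circle_C1_def e d
    using norm_triangle_ineq[of "C0_of_C1 x" "C0_of_C1 y"] norm_triangle_ineq[of "deriv_C1 x" "deriv_C1 y"]
    by linarith
  show "norm (a *\<^sub>R x) = \<bar>a\<bar> * norm x"
    by (simp add: norm_circle_C1_def e d algebra_simps)
qed (simp_all add: dist_circle_C1_def sgn_circle_C1_def uniformity_circle_C1_def open_circle_C1_def)

end

abbreviation eval_C1 :: "circle_C1 \<Rightarrow> real \<Rightarrow> real" where
  "eval_C1 u \<equiv> eval_C0 (C0_of_C1 u)"

section \<open>The spaces \<open>L\<^sup>2(S\<^sup>1)\<close> and \<open>H\<^sup>1(S\<^sup>1)\<close>\<close>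

definition circle_measure :: "real measure" where
  "circle_measure = restrict_space lborel {0..<1}"

definition square_integrable :: "(real \<Rightarrow> real) \<Rightarrow> bool" where
  "square_integrable g \<longleftrightarrow>
     g \<in> borel_measurable circle_measure \<and> integrable circle_measure (\<lambda>t. (g t)\<^sup>2)"

lemma space_circle_measure [simp]: "space circle_measure = {0..<1}"
  by (simp add: circle_measure_def space_restrict_space)

lemma sets_circle_measure: "sets circle_measure = sets (restrict_space borel {0..<1})"
  unfolding circle_measure_def by (intro sets_restrict_space_cong) simp

lemma measurable_circle_borel: "g \<in> borel_measurable borel \<Longrightarrow> g \<in> borel_measurable circle_measure"
  unfolding circle_measure_def by (rule measurable_restrict_space1) simp

lemma emeasure_circle_measure: "emeasure circle_measure (space circle_measure) = 1"
  by (simp add: circle_measure_def emeasure_restrict_space space_restrict_space)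

interpretation circle: finite_measure circle_measure
  by standard (simp only: emeasure_circle_measure, simp)

lemma measure_circle_measure [simp]: "measure circle_measure {0..<1} = 1"
  using emeasure_circle_measure by (simp add: measure_def)

lemma square_integrable_bounded:
  assumes "g \<in> borel_measurable circle_measure" "AE t in circle_measure. \<bar>g t\<bar> \<le> K"
  shows "square_integrable g"
  unfolding square_integrable_def
proof
  show "integrable circle_measure (\<lambda>t. (g t)\<^sup>2)"
  proof (rule circle.integrable_const_bound[of _ "K\<^sup>2"])
    show "AE t in circle_measure. norm ((g t)\<^sup>2) \<le> K\<^sup>2"
      using assms(2) by eventually_elim (simp add: abs_le_square_iff[symmetric])
  qed (use assms(1) in measurable)
qed (rule assms(1))

lemma square_integrable_const: "square_integrable (\<lambda>_. c)"
  by (rule square_integrable_bounded[of _ "\<bar>c\<bar>"]) auto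

lemma square_integrable_mult:
  assumes "square_integrable f" "square_integrable g"
  shows "integrable circle_measure (\<lambda>t. f t * g t)"
proof (rule Bochner_Integration.integrable_bound)
  show "integrable circle_measure (\<lambda>t. (f t)\<^sup>2 + (g t)\<^sup>2)"
    using assms by (simp add: square_integrable_def)
  show "(\<lambda>t. f t * g t) \<in> borel_measurable circle_measure"
    using assms by (auto simp: square_integrable_def)
  have "\<bar>a * b\<bar> \<le> a\<^sup>2 + b\<^sup>2" for a b :: real
  proof -
    have "2 * (\<bar>a\<bar> * \<bar>b\<bar>) \<le> a\<^sup>2 + b\<^sup>2" "0 \<le> \<bar>a\<bar> * \<bar>b\<bar>"
      using sum_squares_bound[of "\<bar>a\<bar>" "\<bar>b\<bar>"] by (simp_all add: mult.assoc)
    then show ?thesis unfolding abs_mult by linarith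
  qed
  then show "AE t in circle_measure. norm (f t * g t) \<le> norm ((f t)\<^sup>2 + (g t)\<^sup>2)" by simp
qed

lemma square_integrable_integrable: "square_integrable f \<Longrightarrow> integrable circle_measure f"
  using square_integrable_mult[OF _ square_integrable_const[of 1]] by simp

lemma square_integrable_add:
  assumes "square_integrable f" "square_integrable g"
  shows "square_integrable (\<lambda>t. f t + g t)"
  using assms square_integrable_mult[OF assms]
  by (auto simp: square_integrable_def power2_sum mult.assoc)

lemma square_integrable_cmult: "square_integrable f \<Longrightarrow> square_integrable (\<lambda>t. c * f t)"
  by (auto simp: square_integrable_def power_mult_distrib)

lemma square_integrable_uminus: "square_integrable f \<Longrightarrow> square_integrable (\<lambda>t. - f t)"
  using square_integrable_cmult[of f "-1"] by simp

lemma square_integrable_diff: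
  "square_integrable f \<Longrightarrow> square_integrable g \<Longrightarrow> square_integrable (\<lambda>t. f t - g t)"
  using square_integrable_add[OF _ square_integrable_uminus, of f g] by simp

quotient_type circle_L2 = "real \<Rightarrow> real" / partial:
  "\<lambda>f g. square_integrable f \<and> square_integrable g \<and> (AE t in circle_measure. f t = g t)"
proof (rule part_equivpI)
  show "\<exists>x. square_integrable x \<and> square_integrable x \<and> (AE t in circle_measure. x t = x t)"
    using square_integrable_const[of 0] by auto
qed (auto intro!: sympI transpI elim: AE_mp)

text \<open>The norm is induced by the inner product \<open>\<integral> u v\<close>.\<close>

instantiation circle_L2 :: real_inner
begin

lift_definition zero_circle_L2 :: circle_L2 is "\<lambda>_. 0"
  by (simp add: square_integrable_const)
lift_definition plus_circle_L2 :: "circle_L2 \<Rightarrow> circle_L2 \<Rightarrow> circle_L2" is "\<lambda>f g t. f t + g t"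
  by (auto intro: square_integrable_add)
lift_definition minus_circle_L2 :: "circle_L2 \<Rightarrow> circle_L2 \<Rightarrow> circle_L2" is "\<lambda>f g t. f t - g t"
  by (auto intro: square_integrable_diff)
lift_definition uminus_circle_L2 :: "circle_L2 \<Rightarrow> circle_L2" is "\<lambda>f t. - f t"
  by (auto intro: square_integrable_uminus)
lift_definition scaleR_circle_L2 :: "real \<Rightarrow> circle_L2 \<Rightarrow> circle_L2" is "\<lambda>r f t. r * f t"
  by (auto intro: square_integrable_cmult)
lift_definition inner_circle_L2 :: "circle_L2 \<Rightarrow> circle_L2 \<Rightarrow> real"
  is "\<lambda>f g. LINT t|circle_measure. f t * g t"
proof -
  fix f f' g g' :: "real \<Rightarrow> real"
  assume f: "square_integrable f \<and> square_integrable f' \<and> (AE t in circle_measure. f t = f' t)"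
    and g: "square_integrable g \<and> square_integrable g' \<and> (AE t in circle_measure. g t = g' t)"
  have "AE t in circle_measure. f t * g t = f' t * g' t"
    using f g by auto
  with f g show "(LINT t|circle_measure. f t * g t) = (LINT t|circle_measure. f' t * g' t)"
    by (intro integral_cong_AE) (auto simp: square_integrable_def)
qed
definition norm_circle_L2 :: "circle_L2 \<Rightarrow> real" where
  "norm_circle_L2 u = sqrt (inner u u)"
definition dist_circle_L2 :: "circle_L2 \<Rightarrow> circle_L2 \<Rightarrow> real" where
  "dist_circle_L2 u v = norm (u - v)"
definition sgn_circle_L2 :: "circle_L2 \<Rightarrow> circle_L2" where
  "sgn_circle_L2 u = scaleR (inverse (norm u)) u"
definition uniformity_circle_L2 :: "(circle_L2 \<times> circle_L2) filter" where
  "uniformity_circle_L2 = (INF e\<in>{0<..}. principal {(x, y). dist x y < e})"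
definition open_circle_L2 :: "circle_L2 set \<Rightarrow> bool" where
  "open_circle_L2 U = (\<forall>x\<in>U. eventually (\<lambda>(x', y). x' = x \<longrightarrow> y \<in> U) uniformity)"

instance
proof
  fix a b :: real and x y z :: circle_L2
  show "x + y + z = x + (y + z)" "x + y = y + x" "0 + x = x" "- x + x = 0" "x - y = x + - y"
    by (transfer, auto simp: add.assoc add.commute
        intro: square_integrable_const square_integrable_add square_integrable_uminus square_integrable_diff)+
  show "a *\<^sub>R (x + y) = a *\<^sub>R x + a *\<^sub>R y" "(a + b) *\<^sub>R x = a *\<^sub>R x + b *\<^sub>R x"
    "a *\<^sub>R b *\<^sub>R x = (a * b) *\<^sub>R x" "1 *\<^sub>R x = x"
    by (transfer, auto simp: distrib_left distrib_right mult.assoc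
        intro!: square_integrable_add square_integrable_cmult)+
  show "inner x y = inner y x"
    by transfer (simp add: mult.commute)
  show "inner (x + y) z = inner x z + inner y z"
    by transfer (simp add: distrib_right square_integrable_mult)
  show "inner (a *\<^sub>R x) y = a * inner x y"
    by transfer (simp add: mult.assoc)
  show "0 \<le> inner x x"
    by transfer simp
  show "(inner x x = 0) = (x = 0)"
    by transfer (auto simp: square_integrable_const square_integrable_mult
        integral_nonneg_eq_0_iff_AE)
qed (simp_all add: dist_circle_L2_def sgn_circle_L2_def uniformity_circle_L2_def open_circle_L2_def
    norm_circle_L2_def)

end

lemma square_integrable_rep_L2: "square_integrable (rep_circle_L2 u)"
  using Quotient_rep_reflp[OF Quotient_circle_L2, of u] by simp

lemma rep_abs_L2: "square_integrable g \<Longrightarrow> AE t in circle_measure. rep_circle_L2 (abs_circle_L2 g) t = g t"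
  using Quotient_rep_abs[OF Quotient_circle_L2, of g] by simp

lemma circle_L2_eqI:
  assumes "AE t in circle_measure. rep_circle_L2 u t = rep_circle_L2 v t"
  shows "u = v"
  using Quotient_rel_rep[OF Quotient_circle_L2, of u v] assms square_integrable_rep_L2 by simp

lemma abs_rep_L2: "abs_circle_L2 (rep_circle_L2 u) = u"
  by (rule Quotient_abs_rep[OF Quotient_circle_L2])

lift_definition const_L2 :: "real \<Rightarrow> circle_L2" is "\<lambda>c _. c"
  by (simp add: square_integrable_const)

lemma rep_L2_zero: "AE t in circle_measure. rep_circle_L2 0 t = 0"
  and rep_L2_add: "AE t in circle_measure. rep_circle_L2 (u + v) t = rep_circle_L2 u t + rep_circle_L2 v t"
  and rep_L2_diff: "AE t in circle_measure. rep_circle_L2 (u - v) t = rep_circle_L2 u t - rep_circle_L2 v t"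
  and rep_L2_uminus: "AE t in circle_measure. rep_circle_L2 (- u) t = - rep_circle_L2 u t"
  and rep_L2_scaleR: "AE t in circle_measure. rep_circle_L2 (r *\<^sub>R u) t = r * rep_circle_L2 u t"
  and rep_L2_const: "AE t in circle_measure. rep_circle_L2 (const_L2 c) t = c"
proof -
  note sq = square_integrable_rep_L2 square_integrable_const square_integrable_add
    square_integrable_diff square_integrable_uminus square_integrable_cmult
  show "AE t in circle_measure. rep_circle_L2 0 t = 0"
    unfolding zero_circle_L2_def by (intro rep_abs_L2 sq)
  show "AE t in circle_measure. rep_circle_L2 (const_L2 c) t = c"
    unfolding const_L2_def map_fun_def o_def id_def by (intro rep_abs_L2 sq)
  show "AE t in circle_measure. rep_circle_L2 (u + v) t = rep_circle_L2 u t + rep_circle_L2 v t"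
    unfolding plus_circle_L2_def map_fun_def o_def id_def by (intro rep_abs_L2 sq)
  show "AE t in circle_measure. rep_circle_L2 (u - v) t = rep_circle_L2 u t - rep_circle_L2 v t"
    unfolding minus_circle_L2_def map_fun_def o_def id_def by (intro rep_abs_L2 sq)
  show "AE t in circle_measure. rep_circle_L2 (- u) t = - rep_circle_L2 u t"
    unfolding uminus_circle_L2_def map_fun_def o_def id_def by (intro rep_abs_L2 sq)
  show "AE t in circle_measure. rep_circle_L2 (r *\<^sub>R u) t = r * rep_circle_L2 u t"
    unfolding scaleR_circle_L2_def map_fun_def o_def id_def by (intro rep_abs_L2 sq)
qed

text \<open>Periodic \<open>C\<^sup>\<infinity>\<close> functions, the test functions of the definition of weak derivatives.\<close>

definition test_function :: "(real \<Rightarrow> real) \<Rightarrow> bool" where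
  "test_function \<phi> \<longleftrightarrow> periodic \<phi> \<and> (\<forall>n t. (deriv ^^ n) \<phi> field_differentiable at t)"

definition has_weak_deriv :: "circle_L2 \<Rightarrow> circle_L2 \<Rightarrow> bool" where
  "has_weak_deriv u w \<longleftrightarrow> (\<forall>\<phi>. test_function \<phi> \<longrightarrow>
     (LINT t|circle_measure. rep_circle_L2 u t * deriv \<phi> t) =
     - (LINT t|circle_measure. rep_circle_L2 w t * \<phi> t))"

lemma L2_pairing:
  assumes "square_integrable \<psi>"
  shows "(LINT t|circle_measure. rep_circle_L2 u t * \<psi> t) = inner u (abs_circle_L2 \<psi>)"
proof -
  have "inner (abs_circle_L2 (rep_circle_L2 u)) (abs_circle_L2 \<psi>) =
      (LINT t|circle_measure. rep_circle_L2 u t * \<psi> t)"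
    by (rule inner_circle_L2.abs_eq) (simp_all add: assms square_integrable_rep_L2)
  then show ?thesis by (simp add: abs_rep_L2)
qed

lemma test_function_DERIV: "test_function \<phi> \<Longrightarrow> (\<phi> has_real_derivative deriv \<phi> t) (at t)"
  unfolding test_function_def by (metis DERIV_deriv_iff_field_differentiable funpow_0)

lemma test_function_deriv:
  assumes "test_function \<phi>"
  shows "test_function (deriv \<phi>)"
  unfolding test_function_def periodic_def
proof (intro conjI allI)
  fix t
  have "((\<lambda>s. \<phi> (s + 1)) has_real_derivative deriv \<phi> (t + 1)) (at t)"
    using test_function_DERIV[OF assms] DERIV_shift by blast
  moreover have "(\<lambda>s. \<phi> (s + 1)) = \<phi>"
    using assms by (auto simp: test_function_def periodic_def)
  ultimately show "deriv \<phi> (t + 1) = deriv \<phi> t"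
    by (metis DERIV_imp_deriv)
next
  fix n t
  have "(deriv ^^ Suc n) \<phi> field_differentiable at t"
    using assms unfolding test_function_def by blast
  then show "(deriv ^^ n) (deriv \<phi>) field_differentiable at t"
    by (simp only: funpow_Suc_right o_def)
qed

lemma test_function_continuous: "test_function \<phi> \<Longrightarrow> continuous_on S \<phi>"
  by (meson DERIV_isCont continuous_at_imp_continuous_on test_function_DERIV)

lemma periodic_continuous_square_integrable:
  assumes "periodic g" "continuous_on UNIV g"
  shows "square_integrable g"
proof -
  obtain K where "\<And>t. norm (g t) \<le> K"
    using periodic_continuous_bounded[OF assms] by (auto simp: bounded_iff)
  then show ?thesis
    using assms(2) by (intro square_integrable_bounded[of _ K] measurable_circle_borel
        borel_measurable_continuous_onI) auto
qed

lemma square_integrable_test_function: "test_function \<phi> \<Longrightarrow> square_integrable \<phi>"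
  by (rule periodic_continuous_square_integrable)
     (auto simp: test_function_continuous, simp add: test_function_def)

lemma has_weak_deriv_iff_inner:
  "has_weak_deriv u w \<longleftrightarrow> (\<forall>\<phi>. test_function \<phi> \<longrightarrow>
     inner u (abs_circle_L2 (deriv \<phi>)) = - inner w (abs_circle_L2 \<phi>))"
  unfolding has_weak_deriv_def
  by (simp add: L2_pairing square_integrable_test_function test_function_deriv)

lemma has_weak_deriv_zero: "has_weak_deriv 0 0"
  and has_weak_deriv_add: "has_weak_deriv u u' \<Longrightarrow> has_weak_deriv v v' \<Longrightarrow> has_weak_deriv (u + v) (u' + v')"
  and has_weak_deriv_diff: "has_weak_deriv u u' \<Longrightarrow> has_weak_deriv v v' \<Longrightarrow> has_weak_deriv (u - v) (u' - v')"
  and has_weak_deriv_minus: "has_weak_deriv u u' \<Longrightarrow> has_weak_deriv (- u) (- u')"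
  and has_weak_deriv_scaleR: "has_weak_deriv u u' \<Longrightarrow> has_weak_deriv (r *\<^sub>R u) (r *\<^sub>R u')"
  by (auto simp: has_weak_deriv_iff_inner inner_add_left inner_diff_left)

lemma trig_polynomial_deriv:
  assumes "real_polynomial_function (p :: complex \<Rightarrow> real)"
  shows "\<exists>q. real_polynomial_function q \<and>
    (\<forall>t. ((\<lambda>t. p (cis (2 * pi * t))) has_real_derivative q (cis (2 * pi * t))) (at t))"
  using assms
proof induction
  case (linear f)
  define q where "q z = f (2 * pi * \<i> * z)" for z
  have "bounded_linear q"
    unfolding q_def by (rule bounded_linear_compose[OF linear bounded_linear_mult_right])
  moreover have "((\<lambda>t. f (cis (2 * pi * t))) has_real_derivative q (cis (2 * pi * t))) (at t)" for t
  proof -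
    have "((\<lambda>t. cis (2 * pi * t)) has_vector_derivative (2 * pi * \<i> * cis (2 * pi * t))) (at t)"
      unfolding cis_conv_exp
      by (auto intro!: derivative_eq_intros has_vector_derivative_real_field simp: algebra_simps)
    from bounded_linear.has_vector_derivative[OF linear this] show ?thesis
      by (simp add: q_def has_real_derivative_iff_has_vector_derivative)
  qed
  ultimately show ?case by (blast intro: real_polynomial_function.intros)
next
  case (const c)
  show ?case by (rule exI[of _ "\<lambda>_. 0"]) (auto intro: real_polynomial_function.intros(2))
next
  case (add f g)
  then obtain f' g' where *: "real_polynomial_function f'" "real_polynomial_function g'"
    "\<And>t. ((\<lambda>t. f (cis (2 * pi * t))) has_real_derivative f' (cis (2 * pi * t))) (at t)"
    "\<And>t. ((\<lambda>t. g (cis (2 * pi * t))) has_real_derivative g' (cis (2 * pi * t))) (at t)" by blast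
  show ?case
    by (rule exI[of _ "\<lambda>z. f' z + g' z"])
       (intro conjI allI real_polynomial_function.intros(3) DERIV_add *)
next
  case (mult f g)
  then obtain f' g' where *: "real_polynomial_function f'" "real_polynomial_function g'"
    "\<And>t. ((\<lambda>t. f (cis (2 * pi * t))) has_real_derivative f' (cis (2 * pi * t))) (at t)"
    "\<And>t. ((\<lambda>t. g (cis (2 * pi * t))) has_real_derivative g' (cis (2 * pi * t))) (at t)" by blast
  show ?case
    by (rule exI[of _ "\<lambda>z. f' z * g z + g' z * f z"])
       (intro conjI allI real_polynomial_function.intros(3) real_polynomial_function.intros(4) DERIV_mult * mult.hyps)
qed

lemma test_function_trig_polynomial:
  assumes "real_polynomial_function (p :: complex \<Rightarrow> real)"
  shows "test_function (\<lambda>t. p (cis (2 * pi * t)))"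
proof -
  have *: "\<exists>q. real_polynomial_function q \<and>
      (deriv ^^ n) (\<lambda>t. p (cis (2 * pi * t))) = (\<lambda>t. q (cis (2 * pi * t)))" for n
  proof (induction n)
    case 0
    then show ?case using assms by auto
  next
    case (Suc n)
    then obtain q where q: "real_polynomial_function q"
      "(deriv ^^ n) (\<lambda>t. p (cis (2 * pi * t))) = (\<lambda>t. q (cis (2 * pi * t)))" by blast
    from trig_polynomial_deriv[OF q(1)] obtain q' where q': "real_polynomial_function q'"
      "\<And>t. ((\<lambda>t. q (cis (2 * pi * t))) has_real_derivative q' (cis (2 * pi * t))) (at t)" by blast
    have "deriv (\<lambda>t. q (cis (2 * pi * t))) = (\<lambda>t. q' (cis (2 * pi * t)))"
      using q'(2) DERIV_imp_deriv by blast
    then show ?case using q q'(1) by auto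
  qed
  have "cis (2 * pi * (t + 1)) = cis (2 * pi * t)" for t
    by (simp add: complex_eq_iff distrib_left)
  moreover have "(deriv ^^ n) (\<lambda>t. p (cis (2 * pi * t))) field_differentiable at t" for n t
    using *[of n] trig_polynomial_deriv unfolding field_differentiable_def by metis
  ultimately show ?thesis by (simp add: test_function_def periodic_def)
qed

lemma cis_measurable [measurable]: "(\<lambda>t. cis (2 * pi * t)) \<in> measurable circle_measure borel"
  unfolding cis_conv_exp by (intro measurable_circle_borel borel_measurable_continuous_onI continuous_intros)

lemma fundamental_lemma:
  assumes g: "integrable circle_measure g"
    and orth: "\<And>\<phi>. test_function \<phi> \<Longrightarrow> (LINT t|circle_measure. g t * \<phi> t) = 0"
  shows "AE t in circle_measure. g t = 0"
proof -
  note [measurable] = borel_measurable_integrable[OF g]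
  have gint: "integrable circle_measure (\<lambda>t. g t * h t)"
    if "h \<in> borel_measurable circle_measure" "\<And>t. \<bar>h t\<bar> \<le> K" for h K
  proof (rule Bochner_Integration.integrable_bound)
    show "integrable circle_measure (\<lambda>t. K * g t)" using g by simp
    show "(\<lambda>t. g t * h t) \<in> borel_measurable circle_measure" using that(1) by measurable
    have "norm (g t * h t) \<le> norm (K * g t)" for t
      using that(2)[of t] mult_right_mono[of "\<bar>h t\<bar>" "\<bar>K\<bar>" "\<bar>g t\<bar>"] by (simp add: abs_mult mult.commute)
    then show "AE t in circle_measure. norm (g t * h t) \<le> norm (K * g t)" by simp
  qed
  have cont: "(LINT t|circle_measure. g t * h (cis (2 * pi * t))) = 0"
    if h: "continuous_on UNIV h" for h :: "complex \<Rightarrow> real"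
  proof -
    let ?I = "LINT t|circle_measure. g t * h (cis (2 * pi * t))"
    have hb: "\<exists>K. \<forall>t. \<bar>h (cis (2 * pi * t))\<bar> \<le> K"
    proof -
      have "compact (h ` sphere 0 1)"
        by (rule compact_continuous_image) (use h continuous_on_subset in auto)
      then have "bounded (h ` sphere 0 1)" by (rule compact_imp_bounded)
      then obtain K where "\<And>z. z \<in> sphere 0 1 \<Longrightarrow> norm (h z) \<le> K"
        unfolding bounded_iff by blast
      then have "\<bar>h (cis (2 * pi * t))\<bar> \<le> K" for t by (simp add: dist_norm)
      then show ?thesis by blast
    qed
    have hm [measurable]: "h \<in> borel_measurable borel"
      using h by (rule borel_measurable_continuous_onI)
    have "\<bar>?I\<bar> \<le> e * (LINT t|circle_measure. \<bar>g t\<bar>)" if "e > 0" for e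
    proof -
      obtain p where p: "real_polynomial_function p" "\<And>z. z \<in> sphere 0 1 \<Longrightarrow> \<bar>h z - p z\<bar> < e"
        using Stone_Weierstrass_real_polynomial_function[of "sphere 0 1" h e] h \<open>e > 0\<close>
          continuous_on_subset by (metis compact_sphere subset_UNIV)
      have bd: "\<bar>h (cis (2 * pi * t)) - p (cis (2 * pi * t))\<bar> \<le> e" for t
        using p(2)[of "cis (2 * pi * t)"] by (simp add: dist_norm less_imp_le)
      note tp = test_function_trig_polynomial[OF p(1)]
      have [measurable]: "(\<lambda>t. p (cis (2 * pi * t))) \<in> borel_measurable circle_measure"
        using square_integrable_test_function[OF tp] by (simp add: square_integrable_def)
      obtain K where K: "\<And>t. \<bar>h (cis (2 * pi * t))\<bar> \<le> K" using hb by blast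
      have ih: "integrable circle_measure (\<lambda>t. g t * h (cis (2 * pi * t)))"
        by (rule gint[OF _ K]) measurable
      have id: "integrable circle_measure (\<lambda>t. g t * (h (cis (2 * pi * t)) - p (cis (2 * pi * t))))"
        by (rule gint[OF _ bd]) measurable
      have "?I = ?I - (LINT t|circle_measure. g t * p (cis (2 * pi * t)))"
        using orth[OF tp] by simp
      also have "\<dots> = (LINT t|circle_measure. g t * h (cis (2 * pi * t)) - g t * p (cis (2 * pi * t)))"
      proof (rule Bochner_Integration.integral_diff[symmetric, OF ih])
        from Bochner_Integration.integrable_diff[OF ih id]
        show "integrable circle_measure (\<lambda>t. g t * p (cis (2 * pi * t)))"
          by (simp add: right_diff_distrib)
      qed
      finally have "?I = (LINT t|circle_measure. g t * (h (cis (2 * pi * t)) - p (cis (2 * pi * t))))"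
        by (simp add: right_diff_distrib)
      then have "\<bar>?I\<bar> \<le> (LINT t|circle_measure. \<bar>g t * (h (cis (2 * pi * t)) - p (cis (2 * pi * t)))\<bar>)"
        using integral_abs_bound by metis
      also have "\<dots> \<le> (LINT t|circle_measure. e * \<bar>g t\<bar>)"
      proof (rule integral_mono)
        show "\<bar>g t * (h (cis (2 * pi * t)) - p (cis (2 * pi * t)))\<bar> \<le> e * \<bar>g t\<bar>" for t
          using mult_right_mono[OF bd[of t], of "\<bar>g t\<bar>"] by (simp add: abs_mult mult.commute)
      qed (use id g in auto)
      finally show ?thesis by simp
    qed note le = this
    have "\<bar>?I\<bar> \<le> 0 + e" if "e > 0" for e
    proof -
      let ?N = "LINT t|circle_measure. \<bar>g t\<bar>"
      have N: "?N \<ge> 0" by simp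
      have "\<bar>?I\<bar> \<le> e / (?N + 1) * ?N" using le[of "e / (?N + 1)"] that N by simp
      also have "\<dots> \<le> e"
      proof -
        have "e / (N + 1) * N \<le> e" if "0 \<le> N" for N
          using that \<open>e > 0\<close> by (simp add: field_simps)
        from this[OF N] show ?thesis .
      qed
      finally show ?thesis by simp
    qed
    then show ?thesis using field_le_epsilon[of "\<bar>?I\<bar>" 0] by simp
  qed
  have closed0: "(LINT t|circle_measure. g t * indicator K (cis (2 * pi * t))) = 0"
    if K: "closed K" for K :: "complex set"
  proof (cases "K = {}")
    case False
    define h where "h n z = max 0 (1 - real n * infdist z K)" for n z
    have hc: "continuous_on UNIV (h n)" for n
      unfolding h_def by (intro continuous_intros)
    have [measurable]: "h n \<in> borel_measurable borel" for n
      using hc by (rule borel_measurable_continuous_onI)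
    have hb: "\<bar>h n z\<bar> \<le> 1" for n z
      unfolding h_def using infdist_nonneg[of z K] by auto
    have lim: "(\<lambda>n. h n z) \<longlonglongrightarrow> indicator K z" for z
    proof (cases "z \<in> K")
      case True
      then show ?thesis by (simp add: h_def)
    next
      case False
      then have pos: "infdist z K > 0"
        using K \<open>K \<noteq> {}\<close> in_closed_iff_infdist_zero[of K z] infdist_nonneg[of z K] by linarith
      have "eventually (\<lambda>n. h n z = 0) sequentially"
      proof -
        obtain N where N: "1 < real N * infdist z K"
          using reals_Archimedean3[OF pos] by blast
        have "h n z = 0" if "n \<ge> N" for n
        proof -
          have "real N * infdist z K \<le> real n * infdist z K"
            using that pos by (intro mult_right_mono) auto
          with N show ?thesis by (simp add: h_def)
        qed
        then show ?thesis by (auto simp: eventually_sequentially)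
      qed
      then show ?thesis using False by (simp add: tendsto_eventually)
    qed
    have [measurable]: "K \<in> sets borel" using K by simp
    have "(\<lambda>n. LINT t|circle_measure. g t * h n (cis (2 * pi * t))) \<longlonglongrightarrow>
        (LINT t|circle_measure. g t * indicator K (cis (2 * pi * t)))"
    proof (rule integral_dominated_convergence[where w = "\<lambda>t. \<bar>g t\<bar>"])
      show "AE t in circle_measure. (\<lambda>n. g t * h n (cis (2 * pi * t))) \<longlonglongrightarrow> g t * indicator K (cis (2 * pi * t))"
        by (intro AE_I2 tendsto_mult tendsto_const lim)
      show "AE t in circle_measure. norm (g t * h n (cis (2 * pi * t))) \<le> \<bar>g t\<bar>" for n
        using hb by (intro AE_I2) (simp add: abs_mult mult_left_le)
    qed (use g in auto)
    then show ?thesis using cont[OF hc] by (simp add: LIMSEQ_const_iff)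
  qed simp
  have borel0: "(LINT t|circle_measure. g t * indicator B (cis (2 * pi * t))) = 0"
    if "B \<in> sets borel" for B :: "complex set"
  proof -
    have "Int_stable (Collect (closed :: complex set \<Rightarrow> bool))"
      by (auto simp: Int_stable_def)
    moreover have "Collect (closed :: complex set \<Rightarrow> bool) \<subseteq> Pow UNIV" by simp
    moreover have "B \<in> sigma_sets UNIV (Collect closed)"
      using that by (simp add: borel_eq_closed)
    ultimately show ?thesis
    proof (induction rule: sigma_sets_induct_disjoint)
      case (basic A)
      then show ?case using closed0 by simp
    next
      case (compl A)
      have [measurable]: "A \<in> sets borel" using compl.hyps by (simp add: borel_eq_closed)
      have "(LINT t|circle_measure. g t * indicator (UNIV - A) (cis (2 * pi * t))) =
          (LINT t|circle_measure. g t * indicator UNIV (cis (2 * pi * t)) - g t * indicator A (cis (2 * pi * t)))"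
        by (intro Bochner_Integration.integral_cong) (auto simp: indicator_def)
      also have "\<dots> = (LINT t|circle_measure. g t * indicator UNIV (cis (2 * pi * t))) -
          (LINT t|circle_measure. g t * indicator A (cis (2 * pi * t)))"
        by (intro Bochner_Integration.integral_diff gint[where K = 1]) (auto simp: indicator_def)
      also have "\<dots> = 0"
        using compl closed0[OF closed_UNIV] by simp
      finally show ?case .
    next
      case (union A)
      have [measurable]: "A i \<in> sets borel" for i using union.hyps by (auto simp: borel_eq_closed)
      have [measurable]: "(\<Union>i. A i) \<in> sets borel" by measurable
      have "(\<lambda>n. LINT t|circle_measure. (\<Sum>i<n. g t * indicator (A i) (cis (2 * pi * t)))) \<longlonglongrightarrow>
          (LINT t|circle_measure. g t * indicator (\<Union>i. A i) (cis (2 * pi * t)))"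
      proof (rule integral_dominated_convergence[where w = "\<lambda>t. \<bar>g t\<bar>"])
        have s: "(\<lambda>i. indicator (A i) z :: real) sums indicator (\<Union>i. A i) z" for z
        proof (cases "\<exists>k. z \<in> A k")
          case True
          then obtain k where k: "z \<in> A k" by blast
          have "(\<lambda>i. indicator (A i) z :: real) = (\<lambda>i. if i = k then 1 else 0)"
            using union.hyps(1) k by (fastforce simp: disjoint_family_on_def indicator_def)
          then show ?thesis using k sums_single[of k "\<lambda>_. 1 :: real"] by (auto simp: indicator_def)
        next
          case False
          then show ?thesis by (simp add: indicator_def)
        qed
        have "(\<lambda>i. g t * indicator (A i) z) sums (g t * indicator (\<Union>i. A i) z)" for t z
          by (intro sums_mult s)
        then show "AE t in circle_measure. (\<lambda>n. \<Sum>i<n. g t * indicator (A i) (cis (2 * pi * t)))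
            \<longlonglongrightarrow> g t * indicator (\<Union>i. A i) (cis (2 * pi * t))"
          by (simp add: sums_def)
        have b: "\<bar>\<Sum>i<n. indicator (A i) z :: real\<bar> \<le> 1" for n z
        proof -
          have "(\<Sum>i<n. indicator (A i) z :: real) \<le> (\<Sum>i. indicator (A i) z)"
            by (rule sum_le_suminf) (use s[of z] in \<open>auto simp: sums_iff\<close>)
          also have "\<dots> = indicator (\<Union>i. A i) z" using s[of z] by (simp add: sums_iff)
          also have "\<dots> \<le> 1" by (simp add: indicator_def)
          finally show ?thesis by (simp add: sum_nonneg)
        qed
        show "AE t in circle_measure. norm (\<Sum>i<n. g t * indicator (A i) (cis (2 * pi * t))) \<le> \<bar>g t\<bar>" for n
          using b by (intro AE_I2) (simp add: sum_distrib_left[symmetric] abs_mult mult_left_le)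
      show "(\<lambda>t. g t * indicator (\<Union>i. A i) (cis (2 * pi * t))) \<in> borel_measurable circle_measure"
          by measurable
        show "(\<lambda>t. \<Sum>i<n. g t * indicator (A i) (cis (2 * pi * t))) \<in> borel_measurable circle_measure" for n
          by measurable
      qed (use g in simp)
      moreover have "(LINT t|circle_measure. (\<Sum>i<n. g t * indicator (A i) (cis (2 * pi * t)))) = 0" for n
      proof -
        have "(LINT t|circle_measure. (\<Sum>i<n. g t * indicator (A i) (cis (2 * pi * t)))) =
            (\<Sum>i<n. LINT t|circle_measure. g t * indicator (A i) (cis (2 * pi * t)))"
          by (intro Bochner_Integration.integral_sum gint[where K = 1]) (auto simp: indicator_def)
        then show ?thesis using union by simp
      qed
      ultimately show ?case by (simp add: LIMSEQ_const_iff)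
    qed simp
  qed
  have real0: "(LINT t|circle_measure. g t * indicator A t) = 0" if A: "A \<in> sets circle_measure" for A
  proof -
    have Ab [measurable]: "A \<in> sets borel"
      using A by (auto simp: sets_circle_measure sets_restrict_space)
    have [measurable]: "Arg2pi \<in> borel_measurable borel"
      unfolding borel_measurable_iff_le using closed_Arg2pi2pi_le by simp
    define B where "B = {z. Arg2pi z / (2 * pi) \<in> A}"
    have "B = (\<lambda>z. Arg2pi z / (2 * pi)) -` A \<inter> space borel" by (auto simp: B_def)
    also have "\<dots> \<in> sets borel" by measurable
    finally have "B \<in> sets borel" .
    have "indicator B (cis (2 * pi * t)) = (indicator A t :: real)" if "t \<in> space circle_measure" for t
    proof -
      have "Arg2pi (cis (2 * pi * t)) = 2 * pi * t"
        using that by (intro Arg2pi_unique[of 1]) (auto simp: cis_conv_exp)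
      then show ?thesis by (simp add: B_def indicator_def)
    qed
    then have "(LINT t|circle_measure. g t * indicator A t) =
        (LINT t|circle_measure. g t * indicator B (cis (2 * pi * t)))"
      by (intro Bochner_Integration.integral_cong) auto
    with borel0[OF \<open>B \<in> sets borel\<close>] show ?thesis by simp
  qed
  have sgn0: "AE t in circle_measure. g t * indicator A t = 0"
    if A: "A \<in> sets circle_measure" and s: "\<And>t. t \<in> A \<Longrightarrow> 0 \<le> c * g t" and c: "c \<noteq> 0" for A c
  proof -
    have int: "integrable circle_measure (\<lambda>t. c * (g t * indicator A t))"
      using A by (intro integrable_mult_right gint[where K = 1]) (auto simp: indicator_def)
    have nn: "AE t in circle_measure. 0 \<le> c * (g t * indicator A t)"
      using s by (auto simp: indicator_def)
    have "(LINT t|circle_measure. c * (g t * indicator A t)) = 0"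
      using real0[OF A] by simp
    then have "AE t in circle_measure. c * (g t * indicator A t) = 0"
      using integral_nonneg_eq_0_iff_AE[OF int nn] by simp
    then show ?thesis using c by simp
  qed
  have "AE t in circle_measure. g t * indicator {t \<in> space circle_measure. 0 < g t} t = 0"
    by (rule sgn0[where c = 1], measurable)
  moreover have "AE t in circle_measure. g t * indicator {t \<in> space circle_measure. g t < 0} t = 0"
    by (rule sgn0[where c = "-1"], measurable)
  ultimately show ?thesis
    using AE_space by eventually_elim (auto simp: indicator_def split: if_splits)
qed

lemma has_weak_deriv_unique:
  assumes "has_weak_deriv u w" "has_weak_deriv u w'"
  shows "w = w'"
proof -
  let ?d = "w - w'"
  have "has_weak_deriv 0 ?d"
    using has_weak_deriv_diff[OF assms] by simp
  then have "(LINT t|circle_measure. rep_circle_L2 ?d t * \<phi> t) = 0" if "test_function \<phi>" for \<phi>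
    using that by (simp add: has_weak_deriv_iff_inner L2_pairing square_integrable_test_function)
  then have "AE t in circle_measure. rep_circle_L2 ?d t = 0"
    by (intro fundamental_lemma square_integrable_integrable square_integrable_rep_L2)
  with rep_L2_zero have "AE t in circle_measure. rep_circle_L2 ?d t = rep_circle_L2 0 t"
    by eventually_elim simp
  then show ?thesis using circle_L2_eqI[of ?d 0] by simp
qed

typedef circle_H1 = "{u :: circle_L2. \<exists>w. has_weak_deriv u w}"
  morphisms L2_of_H1 Abs_circle_H1
  using has_weak_deriv_zero by blast

definition weak_deriv :: "circle_H1 \<Rightarrow> circle_L2" where
  "weak_deriv u = (THE w. has_weak_deriv (L2_of_H1 u) w)"

lemma has_weak_deriv_weak_deriv: "has_weak_deriv (L2_of_H1 u) (weak_deriv u)"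
proof -
  obtain w where "has_weak_deriv (L2_of_H1 u) w" using L2_of_H1[of u] by blast
  then show ?thesis unfolding weak_deriv_def
    by (rule theI) (use \<open>has_weak_deriv _ w\<close> has_weak_deriv_unique in blast)
qed

lemma weak_deriv_eqI: "has_weak_deriv (L2_of_H1 u) w \<Longrightarrow> weak_deriv u = w"
  using has_weak_deriv_weak_deriv has_weak_deriv_unique by blast

lemma L2_of_H1_Abs: "has_weak_deriv u w \<Longrightarrow> L2_of_H1 (Abs_circle_H1 u) = u"
  by (rule Abs_circle_H1_inverse) blast

text \<open>The norm is induced by the inner product \<open>\<integral> u v + \<integral> u' v'\<close>.\<close>

instantiation circle_H1 :: real_inner
begin

definition zero_circle_H1 :: circle_H1 where
  "zero_circle_H1 = Abs_circle_H1 0"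
definition plus_circle_H1 :: "circle_H1 \<Rightarrow> circle_H1 \<Rightarrow> circle_H1" where
  "plus_circle_H1 u v = Abs_circle_H1 (L2_of_H1 u + L2_of_H1 v)"
definition minus_circle_H1 :: "circle_H1 \<Rightarrow> circle_H1 \<Rightarrow> circle_H1" where
  "minus_circle_H1 u v = Abs_circle_H1 (L2_of_H1 u - L2_of_H1 v)"
definition uminus_circle_H1 :: "circle_H1 \<Rightarrow> circle_H1" where
  "uminus_circle_H1 u = Abs_circle_H1 (- L2_of_H1 u)"
definition scaleR_circle_H1 :: "real \<Rightarrow> circle_H1 \<Rightarrow> circle_H1" where
  "scaleR_circle_H1 r u = Abs_circle_H1 (r *\<^sub>R L2_of_H1 u)"
definition inner_circle_H1 :: "circle_H1 \<Rightarrow> circle_H1 \<Rightarrow> real" where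
  "inner_circle_H1 u v = inner (L2_of_H1 u) (L2_of_H1 v) + inner (weak_deriv u) (weak_deriv v)"
definition norm_circle_H1 :: "circle_H1 \<Rightarrow> real" where
  "norm_circle_H1 u = sqrt (inner u u)"
definition dist_circle_H1 :: "circle_H1 \<Rightarrow> circle_H1 \<Rightarrow> real" where
  "dist_circle_H1 u v = norm (u - v)"
definition sgn_circle_H1 :: "circle_H1 \<Rightarrow> circle_H1" where
  "sgn_circle_H1 u = scaleR (inverse (norm u)) u"
definition uniformity_circle_H1 :: "(circle_H1 \<times> circle_H1) filter" where
  "uniformity_circle_H1 = (INF e\<in>{0<..}. principal {(x, y). dist x y < e})"
definition open_circle_H1 :: "circle_H1 set \<Rightarrow> bool" where
  "open_circle_H1 U = (\<forall>x\<in>U. eventually (\<lambda>(x', y). x' = x \<longrightarrow> y \<in> U) uniformity)"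

lemma L2_of_H1_simps:
  "L2_of_H1 0 = 0" "L2_of_H1 (u + v) = L2_of_H1 u + L2_of_H1 v"
  "L2_of_H1 (u - v) = L2_of_H1 u - L2_of_H1 v" "L2_of_H1 (- u) = - L2_of_H1 u"
  "L2_of_H1 (r *\<^sub>R u) = r *\<^sub>R L2_of_H1 u"
  unfolding zero_circle_H1_def plus_circle_H1_def minus_circle_H1_def uminus_circle_H1_def
    scaleR_circle_H1_def
  by (simp_all add: L2_of_H1_Abs[OF has_weak_deriv_zero]
      L2_of_H1_Abs[OF has_weak_deriv_add[OF has_weak_deriv_weak_deriv has_weak_deriv_weak_deriv]]
      L2_of_H1_Abs[OF has_weak_deriv_diff[OF has_weak_deriv_weak_deriv has_weak_deriv_weak_deriv]]
      L2_of_H1_Abs[OF has_weak_deriv_minus[OF has_weak_deriv_weak_deriv]]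
      L2_of_H1_Abs[OF has_weak_deriv_scaleR[OF has_weak_deriv_weak_deriv]])

lemma weak_deriv_simps:
  "weak_deriv 0 = 0" "weak_deriv (u + v) = weak_deriv u + weak_deriv v"
  "weak_deriv (u - v) = weak_deriv u - weak_deriv v" "weak_deriv (- u) = - weak_deriv u"
  "weak_deriv (r *\<^sub>R u) = r *\<^sub>R weak_deriv u"
  by (rule weak_deriv_eqI; simp add: L2_of_H1_simps has_weak_deriv_zero has_weak_deriv_add
      has_weak_deriv_diff has_weak_deriv_minus has_weak_deriv_scaleR has_weak_deriv_weak_deriv)+

instance
proof
  fix a b :: real and x y z :: circle_H1
  note e = L2_of_H1_simps and d = weak_deriv_simps
  have eqI: "u = v" if "L2_of_H1 u = L2_of_H1 v" for u v
    using that by (simp add: L2_of_H1_inject)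
  show "x + y + z = x + (y + z)" "x + y = y + x" "0 + x = x" "- x + x = 0" "x - y = x + - y"
    by (rule eqI, simp add: e)+
  show "a *\<^sub>R (x + y) = a *\<^sub>R x + a *\<^sub>R y" "(a + b) *\<^sub>R x = a *\<^sub>R x + b *\<^sub>R x"
    "a *\<^sub>R b *\<^sub>R x = (a * b) *\<^sub>R x" "1 *\<^sub>R x = x"
    by (rule eqI, simp add: e scaleR_add_right scaleR_add_left)+
  show "inner x y = inner y x"
    by (simp add: inner_circle_H1_def inner_commute)
  show "inner (x + y) z = inner x z + inner y z"
    by (simp add: inner_circle_H1_def e d inner_add_left)
  show "inner (a *\<^sub>R x) y = a * inner x y"
    by (simp add: inner_circle_H1_def e d distrib_left)
  show "0 \<le> inner x x"
    by (simp add: inner_circle_H1_def)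
  show "(inner x x = 0) = (x = 0)"
  proof
    assume "inner x x = 0"
    then have "L2_of_H1 x = L2_of_H1 0"
      by (simp add: inner_circle_H1_def add_nonneg_eq_0_iff e)
    then show "x = 0" by (rule eqI)
  qed (simp add: inner_circle_H1_def e d)
qed (simp_all add: dist_circle_H1_def sgn_circle_H1_def uniformity_circle_H1_def open_circle_H1_def
    norm_circle_H1_def)

end

lemma circle_FTC:
  assumes F: "\<And>t. (F has_real_derivative f t) (at t)" and f: "continuous_on UNIV f"
    and s: "0 \<le> s" "s \<le> 1"
  shows "(LINT t|circle_measure. indicator {s<..} t * f t) = F 1 - F s"
proof -
  have [measurable]: "f \<in> borel_measurable borel" using f by (rule borel_measurable_continuous_onI)
  have "(LINT t|circle_measure. indicator {s<..} t * f t) =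
      (LINT t|lborel. indicator {0..<1} t *\<^sub>R (indicator {s<..} t * f t))"
    unfolding circle_measure_def by (rule integral_restrict_space) simp
  also have "\<dots> = (LINT t|lborel. indicator {s..1} t *\<^sub>R f t)"
  proof (rule integral_cong_AE)
    have "AE t in lborel. t \<noteq> s \<and> t \<noteq> 1"
      using AE_lborel_singleton[of s] AE_lborel_singleton[of 1] by auto
    then show "AE t in lborel. indicator {0..<1} t *\<^sub>R (indicator {s<..} t * f t) = indicator {s..1} t *\<^sub>R f t"
      by eventually_elim (use s in \<open>auto simp: indicator_def\<close>)
  qed measurable
  also have "\<dots> = F 1 - F s"
    using s by (intro integral_FTC_atLeastAtMost)
      (auto intro: continuous_on_subset[OF f] has_field_derivative_at_within[OF F]
        simp: has_real_derivative_iff_has_vector_derivative[symmetric])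
  finally show ?thesis .
qed

lemma test_function_const: "test_function (\<lambda>_. c)"
  using test_function_trig_polynomial[of "\<lambda>_. c"] by (simp add: real_polynomial_function.intros)

lemma test_function_antiderivative:
  assumes \<psi>: "test_function \<psi>"
  obtains \<Phi> where "test_function \<Phi>"
    "\<And>t. deriv \<Phi> t = \<psi> t - (LINT t|circle_measure. \<psi> t)"
proof -
  define m where "m = (LINT t|circle_measure. \<psi> t)"
  define \<psi>0 where "\<psi>0 t = \<psi> t - m" for t
  have c: "continuous_on UNIV \<psi>0"
    unfolding \<psi>0_def by (intro continuous_intros test_function_continuous \<psi>)
  have "\<exists>F. \<forall>x::real. - \<infinity> < ereal x \<longrightarrow> ereal x < \<infinity> \<longrightarrow> (F has_vector_derivative \<psi>0 x) (at x)"
    by (rule einterval_antiderivative) (use c in \<open>auto simp: continuous_on_eq_continuous_at\<close>)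
  then obtain F where F: "\<And>x. (F has_real_derivative \<psi>0 x) (at x)"
    by (auto simp: has_real_derivative_iff_has_vector_derivative)
  have dF: "deriv F = \<psi>0"
    using F DERIV_imp_deriv by blast
  have p0: "\<psi>0 (t + 1) = \<psi>0 t" for t
    using \<psi> by (simp add: \<psi>0_def test_function_def periodic_def)
  have "((\<lambda>t. F (t + 1) - F t) has_real_derivative 0) (at t)" for t
  proof -
    have "((\<lambda>s. F (s + 1)) has_real_derivative \<psi>0 (t + 1)) (at t)"
      using F DERIV_shift by blast
    from DERIV_diff[OF this F[of t]] show ?thesis by (simp add: p0)
  qed
  then have const: "F (t + 1) - F t = F (0 + 1) - F 0" for t
    using DERIV_isconst_all by blast
  have "F 1 - F 0 = (LINT t|circle_measure. indicator {0<..} t * \<psi>0 t)"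
    using circle_FTC[OF F c, of 0] by simp
  also have "\<dots> = (LINT t|circle_measure. \<psi>0 t)"
  proof (rule integral_cong_AE)
    have [measurable]: "\<psi>0 \<in> borel_measurable circle_measure"
      using c by (intro measurable_circle_borel borel_measurable_continuous_onI)
    show "(\<lambda>t. indicator {0<..} t * \<psi>0 t) \<in> borel_measurable circle_measure"
      by (intro borel_measurable_times measurable_circle_borel borel_measurable_indicator
          \<open>\<psi>0 \<in> borel_measurable circle_measure\<close>) simp
    have "AE t in lborel. t \<in> {0..<1} \<longrightarrow> t \<noteq> 0" using AE_lborel_singleton[of 0] by auto
    then have "AE t in circle_measure. t \<noteq> (0::real)"
      unfolding circle_measure_def by (subst AE_restrict_space_iff) auto
    then show "AE t in circle_measure. indicator {0<..} t * \<psi>0 t = \<psi>0 t"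
      using AE_space by eventually_elim auto
  qed (intro measurable_circle_borel borel_measurable_continuous_onI c)
  also have "\<dots> = 0"
    using square_integrable_integrable[OF square_integrable_test_function[OF \<psi>]]
    by (simp add: \<psi>0_def Bochner_Integration.integral_diff m_def[symmetric])
  finally have per: "F (t + 1) = F t" for t
    using const[of t] by simp
  have \<psi>0_eq: "(deriv ^^ Suc n) \<psi>0 = (deriv ^^ Suc n) \<psi>" for n
  proof -
    have "deriv \<psi>0 = deriv \<psi>"
    proof
      fix t
      have "(\<psi>0 has_real_derivative deriv \<psi> t) (at t)"
        unfolding \<psi>0_def using DERIV_diff[OF test_function_DERIV[OF \<psi>] DERIV_const[of m]] by simp
      then show "deriv \<psi>0 t = deriv \<psi> t" by (rule DERIV_imp_deriv)
    qed
    then show ?thesis by (simp only: funpow_Suc_right o_def)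
  qed
  have "(deriv ^^ n) F field_differentiable at t" for n t
  proof (cases n)
    case 0
    then show ?thesis using F by (auto simp: field_differentiable_def)
  next
    case (Suc k)
    have "(deriv ^^ n) F = (deriv ^^ k) \<psi>0"
      by (simp only: Suc funpow_Suc_right o_def dF)
    moreover have "(deriv ^^ k) \<psi>0 field_differentiable at t"
    proof (cases k)
      case 0
      then show ?thesis
        unfolding \<psi>0_def using DERIV_diff[OF test_function_DERIV[OF \<psi>] DERIV_const[of m]]
        by (auto simp: field_differentiable_def)
    next
      case (Suc j)
      then show ?thesis using \<psi> \<psi>0_eq[of j] by (simp add: test_function_def del: funpow.simps)
    qed
    ultimately show ?thesis by simp
  qed
  then have "test_function F"
    using per by (simp add: test_function_def periodic_def)
  then show ?thesis using that dF by (simp add: \<psi>0_def m_def)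
qed

lemma H1_essentially_bounded:
  "\<exists>K. AE t in circle_measure. \<bar>rep_circle_L2 (L2_of_H1 u) t\<bar> \<le> K"
proof -
  define r where "r = rep_circle_L2 (L2_of_H1 u)"
  define g where "g = rep_circle_L2 (weak_deriv u)"
  have gi: "integrable circle_measure g" and ri: "integrable circle_measure r"
    unfolding g_def r_def by (intro square_integrable_integrable square_integrable_rep_L2)+
  note [measurable] = borel_measurable_integrable[OF gi] borel_measurable_integrable[OF ri]
  have wd: "(LINT t|circle_measure. r t * deriv \<phi> t) = - (LINT t|circle_measure. g t * \<phi> t)"
    if "test_function \<phi>" for \<phi>
    using has_weak_deriv_weak_deriv[of u] that unfolding has_weak_deriv_def r_def g_def by blast
  have g0: "(LINT t|circle_measure. g t) = 0"
    using wd[OF test_function_const[of 1]] by simp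
  have id_m [measurable]: "(\<lambda>t. t) \<in> borel_measurable circle_measure"
    by (rule measurable_circle_borel) simp
  define U where "U t = (LINT s|circle_measure. indicator {s. s < t} s * g s)" for t
  interpret pair_sigma_finite circle_measure circle_measure
    by (simp add: pair_sigma_finite_def circle.sigma_finite_measure_axioms)
  have Um [measurable]: "U \<in> borel_measurable circle_measure"
  proof -
    have "(\<lambda>t. LINT s|circle_measure. (if s < t then g s else 0)) \<in> borel_measurable circle_measure"
      by measurable
    moreover have "U = (\<lambda>t. LINT s|circle_measure. (if s < t then g s else 0))"
      unfolding U_def by (intro ext Bochner_Integration.integral_cong) auto
    ultimately show ?thesis by simp
  qed
  have Ub: "\<bar>U t\<bar> \<le> (LINT s|circle_measure. \<bar>g s\<bar>)" for t
  proof -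
    have "\<bar>U t\<bar> \<le> (LINT s|circle_measure. \<bar>indicator {s. s < t} s * g s\<bar>)"
      unfolding U_def by (rule integral_abs_bound)
    also have "\<dots> \<le> (LINT s|circle_measure. \<bar>g s\<bar>)"
      by (rule integral_mono_AE') (use gi in \<open>auto simp: indicator_def\<close>)
    finally show ?thesis .
  qed
  have Ui: "integrable circle_measure U"
    by (rule circle.integrable_const_bound[where B = "LINT s|circle_measure. \<bar>g s\<bar>"]) (use Ub in auto)
  have parts: "(LINT t|circle_measure. U t * deriv \<phi> t) = - (LINT t|circle_measure. g t * \<phi> t)"
    if \<phi>: "test_function \<phi>" for \<phi>
  proof -
    note d\<phi> = test_function_deriv[OF \<phi>]
    obtain K where K: "\<And>t. \<bar>deriv \<phi> t\<bar> \<le> K"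
      using periodic_continuous_bounded[OF _ test_function_continuous[OF d\<phi>]] d\<phi>
      by (auto simp: bounded_iff test_function_def)
    have [measurable]: "deriv \<phi> \<in> borel_measurable circle_measure"
      using square_integrable_test_function[OF d\<phi>] by (simp add: square_integrable_def)
    let ?f = "\<lambda>s t. (if s < t then g s else 0) * deriv \<phi> t"
    have int: "integrable (circle_measure \<Otimes>\<^sub>M circle_measure) (case_prod ?f)"
    proof (rule Bochner_Integration.integrable_bound)
      show "integrable (circle_measure \<Otimes>\<^sub>M circle_measure) (\<lambda>(s, t). K * g s)"
        by (rule Fubini_integrable) (use gi in \<open>auto simp: abs_mult\<close>)
      show "case_prod ?f \<in> borel_measurable (circle_measure \<Otimes>\<^sub>M circle_measure)"
        by measurable
      have "\<bar>?f s t\<bar> \<le> \<bar>K * g s\<bar>" for s t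
        using K[of t] mult_mono[of "\<bar>g s\<bar>" "\<bar>g s\<bar>" "\<bar>deriv \<phi> t\<bar>" "\<bar>K\<bar>"]
        by (auto simp: abs_mult mult.commute)
      then show "AE x in circle_measure \<Otimes>\<^sub>M circle_measure. norm (case_prod ?f x) \<le> norm (case x of (s, t) \<Rightarrow> K * g s)"
        by (auto simp: split_beta)
    qed
    have "(LINT t|circle_measure. U t * deriv \<phi> t) =
        (LINT t|circle_measure. LINT s|circle_measure. ?f s t)"
    proof (rule Bochner_Integration.integral_cong)
      fix t
      have "U t = (LINT s|circle_measure. (if s < t then g s else 0))"
        unfolding U_def by (intro Bochner_Integration.integral_cong) auto
      then show "U t * deriv \<phi> t = (LINT s|circle_measure. ?f s t)" by simp
    qed simp
    also have "\<dots> = (LINT s|circle_measure. LINT t|circle_measure. ?f s t)"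
      by (rule Fubini_integral[OF int])
    also have "\<dots> = (LINT s|circle_measure. \<phi> 1 * g s - g s * \<phi> s)"
    proof (rule Bochner_Integration.integral_cong)
      fix s assume "s \<in> space circle_measure"
      then have s: "0 \<le> s" "s \<le> 1" by auto
      have "(LINT t|circle_measure. ?f s t) = (LINT t|circle_measure. g s * (indicator {s<..} t * deriv \<phi> t))"
        by (intro Bochner_Integration.integral_cong) auto
      also have "\<dots> = g s * (\<phi> 1 - \<phi> s)"
        using circle_FTC[OF test_function_DERIV[OF \<phi>] test_function_continuous[OF d\<phi>] s] by simp
      finally show "(LINT t|circle_measure. ?f s t) = \<phi> 1 * g s - g s * \<phi> s"
        by (simp add: algebra_simps)
    qed simp
    also have "\<dots> = (LINT s|circle_measure. \<phi> 1 * g s) - (LINT s|circle_measure. g s * \<phi> s)"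
    proof (rule Bochner_Integration.integral_diff)
      show "integrable circle_measure (\<lambda>s. g s * \<phi> s)"
        unfolding g_def
        by (intro square_integrable_mult square_integrable_rep_L2 square_integrable_test_function \<phi>)
    qed (use gi in simp)
    finally show ?thesis using g0 by simp
  qed
  define d where "d t = r t - U t" for t
  define c where "c = (LINT t|circle_measure. d t)"
  have Usq: "square_integrable U"
    by (rule square_integrable_bounded) (use Ub in auto)
  have dsq: "square_integrable d"
    unfolding d_def r_def by (intro square_integrable_diff square_integrable_rep_L2 Usq)
  have rsq: "square_integrable r"
    unfolding r_def by (rule square_integrable_rep_L2)
  have "AE t in circle_measure. d t - c = 0"
  proof (rule fundamental_lemma)
    show "integrable circle_measure (\<lambda>t. d t - c)"
      by (intro square_integrable_integrable square_integrable_diff dsq square_integrable_const)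
    fix \<psi> assume \<psi>: "test_function \<psi>"
    define m where "m = (LINT t|circle_measure. \<psi> t)"
    obtain \<Phi> where \<Phi>: "test_function \<Phi>" "\<And>t. deriv \<Phi> t = \<psi> t - m"
      using test_function_antiderivative[OF \<psi>] unfolding m_def by blast
    note \<psi>sq = square_integrable_test_function[OF \<psi>]
    note \<Phi>sq = square_integrable_test_function[OF test_function_deriv[OF \<Phi>(1)]]
    have di: "integrable circle_measure d" and \<psi>i: "integrable circle_measure \<psi>"
      and d\<psi>i: "integrable circle_measure (\<lambda>t. d t * \<psi> t)"
      by (intro square_integrable_integrable square_integrable_mult dsq \<psi>sq)+
    have "0 = (LINT t|circle_measure. r t * deriv \<Phi> t) - (LINT t|circle_measure. U t * deriv \<Phi> t)"
      using wd[OF \<Phi>(1)] parts[OF \<Phi>(1)] by simp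
    also have "\<dots> = (LINT t|circle_measure. d t * deriv \<Phi> t)"
      unfolding d_def left_diff_distrib
      by (intro Bochner_Integration.integral_diff[symmetric] square_integrable_mult rsq Usq \<Phi>sq)
    also have "\<dots> = (LINT t|circle_measure. d t * \<psi> t) - c * m"
      using di d\<psi>i by (simp add: \<Phi>(2) right_diff_distrib c_def)
    also have "\<dots> = (LINT t|circle_measure. (d t - c) * \<psi> t)"
      using \<psi>i d\<psi>i by (simp add: left_diff_distrib m_def)
    finally show "(LINT t|circle_measure. (d t - c) * \<psi> t) = 0" by simp
  qed
  then have "AE t in circle_measure. \<bar>r t\<bar> \<le> \<bar>c\<bar> + (LINT s|circle_measure. \<bar>g s\<bar>)"
  proof eventually_elim
    case (elim t)
    then show ?case using Ub[of t] by (simp add: d_def)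
  qed
  then show ?thesis unfolding r_def by blast
qed

section \<open>The maps \<open>F\<close> and \<open>\<Psi>\<close>\<close>

definition mean_C0 :: "circle_C0 \<Rightarrow> real" where
  "mean_C0 u = (LINT t|circle_measure. eval_C0 u t)"

definition mean_L2 :: "circle_L2 \<Rightarrow> real" where
  "mean_L2 u = (LINT t|circle_measure. rep_circle_L2 u t)"

definition F_C :: "(real \<Rightarrow> real \<Rightarrow> real) \<Rightarrow> circle_C1 \<Rightarrow> circle_C0" where
  "F_C f u = mk_C0 (\<lambda>t. eval_C0 (deriv_C1 u) t + f t (eval_C1 u t))"

definition F_H :: "(real \<Rightarrow> real \<Rightarrow> real) \<Rightarrow> circle_H1 \<Rightarrow> circle_L2" where
  "F_H f u = abs_circle_L2 (\<lambda>t. rep_circle_L2 (weak_deriv u) t + f t (rep_circle_L2 (L2_of_H1 u) t))"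

definition Psi_C :: "(real \<Rightarrow> real \<Rightarrow> real) \<Rightarrow> circle_C1 \<Rightarrow> circle_C0" where
  "Psi_C f u = (F_C f u - const_C0 (mean_C0 (F_C f u))) + const_C0 (mean_C0 (C0_of_C1 u))"

definition Psi_H :: "(real \<Rightarrow> real \<Rightarrow> real) \<Rightarrow> circle_H1 \<Rightarrow> circle_L2" where
  "Psi_H f u = (F_H f u - const_L2 (mean_L2 (F_H f u))) + const_L2 (mean_L2 (L2_of_H1 u))"

text \<open>
  For smooth periodic \<open>f\<close> the functions to which \<^const>\<open>mk_C0\<close> and \<^const>\<open>abs_circle_L2\<close> are applied
  above do represent elements of \<open>C\<^sup>0\<close> and \<open>L\<^sup>2\<close>, so that \<open>F\<close> is given by the intended formula.
\<close>

lemma eval_F_C: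
  assumes f: "smooth (\<lambda>(t, s). f t s)" "periodic f"
  shows "eval_C0 (F_C f u) t = eval_C0 (deriv_C1 u) t + f t (eval_C1 u t)"
proof -
  have "continuous_on UNIV ((\<lambda>(t, s). f t s) \<circ> (\<lambda>t. (t, eval_C1 u t)))"
    by (intro continuous_on_compose continuous_intros continuous_on_eval_C0
        smooth_imp_continuous_on[OF f(1)])
  then have "continuous_on UNIV (\<lambda>t. eval_C0 (deriv_C1 u) t + f t (eval_C1 u t))"
    by (intro continuous_intros continuous_on_eval_C0) (simp add: o_def)
  moreover have "periodic (\<lambda>t. eval_C0 (deriv_C1 u) t + f t (eval_C1 u t))"
    using f(2) periodic_eval_C0 by (simp add: periodic_def)
  ultimately show ?thesis unfolding F_C_def by (simp add: eval_mk_C0)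
qed

lemma rep_F_H:
  assumes f: "smooth (\<lambda>(t, s). f t s)"
  shows "AE t in circle_measure. rep_circle_L2 (F_H f u) t =
    rep_circle_L2 (weak_deriv u) t + f t (rep_circle_L2 (L2_of_H1 u) t)"
proof -
  define r where "r = rep_circle_L2 (L2_of_H1 u)"
  obtain K where K: "AE t in circle_measure. \<bar>r t\<bar> \<le> K"
    using H1_essentially_bounded unfolding r_def by blast
  have [measurable]: "r \<in> borel_measurable circle_measure"
    using square_integrable_rep_L2 by (simp add: r_def square_integrable_def)
  have cf: "continuous_on S (\<lambda>(t, s). f t s)" for S
    by (rule smooth_imp_continuous_on[OF f])
  have "compact ((\<lambda>(t, s). f t s) ` ({0..1} \<times> {-K..K}))"
    by (intro compact_continuous_image cf compact_Times compact_Icc)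
  then have "bounded ((\<lambda>(t, s). f t s) ` ({0..1} \<times> {-K..K}))" by (rule compact_imp_bounded)
  then obtain B where B: "\<And>t s. t \<in> {0..1} \<Longrightarrow> s \<in> {-K..K} \<Longrightarrow> \<bar>f t s\<bar> \<le> B"
    unfolding bounded_iff by fastforce
  have "square_integrable (\<lambda>t. f t (r t))"
  proof (rule square_integrable_bounded)
    have "(\<lambda>t. (t, r t)) \<in> borel_measurable circle_measure"
      by (intro borel_measurable_Pair \<open>r \<in> borel_measurable circle_measure\<close>) (simp add: measurable_circle_borel)
    from borel_measurable_continuous_on[OF cf this]
    show "(\<lambda>t. f t (r t)) \<in> borel_measurable circle_measure" by simp
    show "AE t in circle_measure. \<bar>f t (r t)\<bar> \<le> B"
      using K AE_space by eventually_elim (rule B, auto)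
  qed
  then show ?thesis
    unfolding F_H_def r_def[symmetric]
    by (intro rep_abs_L2 square_integrable_add square_integrable_rep_L2)
qed

end

theory Submission
  imports Defs
begin

text \<open>
  Let \<open>S p\<close> be the primitive of mean zero of \<open>p - \<integral>p\<close> and \<open>N u = f(\<cdot>, u)\<close>. The linear isomorphism
  \<open>A u = u' + \<integral>u\<close> of \<open>B\<^sup>1\<close> onto \<open>B\<^sup>0\<close> turns \<open>\<Psi>\<close> into \<open>y \<mapsto> y + (N(T y) - \<integral>N(T y))\<close> on \<open>B\<^sup>0\<close>, where \<open>T = A\<^sup>-\<^sup>1\<close>.
  This map sends \<open>y\<close> to \<open>z\<close> if and only if \<open>y\<close> is obtained from a solution \<open>u = T y\<close> of
  \<open>u + S (N u) = T z\<close>, an equation in \<open>C\<^sup>0\<close> that is the same in both cases.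

  A periodic function with a zero whose derivative \<open>w'\<close> stays within \<open>P + L|w|\<close> of a constant \<open>c\<close> satisfies
  \<open>|c| \<le> P\<close>, since otherwise it could cross zero in one direction only; Gronwall's inequality
  then bounds \<open>w\<close>. For Lipschitz nonlinearities this gives uniqueness, Lipschitz dependence and, by the
  method of continuity, existence. It applies to the linearised equation and to the truncated function
  \<open>f(t, max(-r, min(r, s)))\<close>, hence \<open>\<Psi>\<close> is injective with smooth inverse on its image.

  For surjectivity one bounds the solution \<open>u\<close> of the truncated equation independently of \<open>r\<close>. The
  constant \<open>c\<close> is bounded as above, so \<open>u' - (T z)' \<le> B + M(u)\<close> with \<open>M = max(1, sup\<^sub>t(-f))\<close> and a similar
  bound from below. If \<open>1/M\<close> is not integrable at \<open>+\<infinity>\<close> and \<open>G' = 1/M\<close>, then \<open>G(u)\<close> grows by a bounded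
  amount over a period, which bounds \<open>u\<close> from above; the other cases of tameness follow by reversing
  time and the sign of \<open>u\<close>.
\<close>

section \<open>Continuous functions on the circle\<close>

text \<open>Both cases are moved to C^0 because superposition with a smooth function is Frechet
  differentiable for the supremum norm, whereas on L^2 it is in general not. What remains case
  dependent is linear: the operators \<open>A\<close> and \<open>T\<close>, and a lift
  \<open>Q\<close> with \<open>T (Q u) = S u\<close>.

  \<open>smooth\<close> asks for derivatives of all orders as multilinear maps, so one derivative of
  the inverse does not settle the matter. The higher ones are produced by a formal calculus of
  multilinear expressions, which also covers the forward map through the trivial choice
  \<open>S = 0\<close>.

  The delicate point of surjectivity is that no constant may depend on the truncation level. The
  bound on \<open>c\<close> uses the nonlinearity only at zeros of \<open>w = u - T z\<close>, where
  \<open>u\<close> equals \<open>T z\<close> and so is bounded in advance. The two integrals in the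
  definition of wildness belong to the two directions of time; control in one direction is enough,
  since a periodic function can be followed either way round the circle. In the H case
  \<open>T z\<close> need not be differentiable at every point, so its increments are measured by
  those of an auxiliary function \<open>W\<close>.\<close>

lemma abs_eval_C0_le_norm: "\<bar>eval_C0 u t\<bar> \<le> norm u"
  unfolding norm_C0_eq_SUP
  by (rule cSUP_upper) (use periodic_continuous_bounded[OF periodic_eval_C0 continuous_on_eval_C0, of u] in
      \<open>auto simp: bounded_iff bdd_above_def\<close>)

lemma norm_C0_le: "(\<And>t. \<bar>eval_C0 u t\<bar> \<le> b) \<Longrightarrow> norm u \<le> b"
  unfolding norm_C0_eq_SUP by (rule cSUP_least) auto

lemma C0_eqI: "(\<And>t. eval_C0 u t = eval_C0 v t) \<Longrightarrow> u = v"
  using eval_C0_inject by blast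

text \<open>Periodicity survives pointwise limits, so the circle functions are closed in the
  complete space of bounded continuous functions. Completeness is wanted for the Banach fixed point
  theorem in \<open>ex_solution_lipschitz\<close>.\<close>

lemma complete_UNIV_C0: "complete (UNIV :: circle_C0 set)"
proof (rule completeI)
  fix X :: "nat \<Rightarrow> circle_C0" assume X: "Cauchy X"
  have d: "dist (Rep_circle_C0 u) (Rep_circle_C0 v) = dist u v" for u v
    by (simp add: dist_norm norm_circle_C0.rep_eq minus_circle_C0.rep_eq)
  then have "Cauchy (\<lambda>n. Rep_circle_C0 (X n))"
    using X by (simp add: Cauchy_def)
  then obtain l where l: "(\<lambda>n. Rep_circle_C0 (X n)) \<longlonglongrightarrow> l"
    using Cauchy_convergent convergent_def by blast
  have ev: "(\<lambda>n. apply_bcontfun (Rep_circle_C0 (X n)) t) \<longlonglongrightarrow> apply_bcontfun l t" for t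
    unfolding lim_sequentially
  proof (intro allI impI)
    fix e :: real assume "e > 0"
    with l obtain N where N: "\<And>n. n \<ge> N \<Longrightarrow> dist (Rep_circle_C0 (X n)) l < e"
      unfolding lim_sequentially by blast
    then show "\<exists>N. \<forall>n\<ge>N. dist (apply_bcontfun (Rep_circle_C0 (X n)) t) (apply_bcontfun l t) < e"
      using dist_bounded le_less_trans by blast
  qed
  have per: "apply_bcontfun (Rep_circle_C0 (X n)) (t + 1) = apply_bcontfun (Rep_circle_C0 (X n)) t" for n t
    using Rep_circle_C0[of "X n"] by (simp add: periodic_def)
  have "periodic (apply_bcontfun l)"
    unfolding periodic_def
  proof
    fix t
    show "apply_bcontfun l (t + 1) = apply_bcontfun l t"
      using ev[of "t + 1"] ev[of t] by (simp add: per LIMSEQ_unique)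
  qed
  then have "l = Rep_circle_C0 (Abs_circle_C0 l)"
    by (simp add: Abs_circle_C0_inverse)
  with l have "X \<longlonglongrightarrow> Abs_circle_C0 l"
    unfolding lim_sequentially using d by metis
  then show "\<exists>l\<in>UNIV. X \<longlonglongrightarrow> l" by blast
qed

lemma integrable_eval_C0: "integrable circle_measure (eval_C0 u)"
  by (intro square_integrable_integrable periodic_continuous_square_integrable periodic_eval_C0
      continuous_on_eval_C0)

lemma LINT_circle_const [simp]: "(LINT t|circle_measure. c) = (c :: real)"
  by simp

lemma mean_C0_simps [simp]:
  "mean_C0 0 = 0" "mean_C0 (u + v) = mean_C0 u + mean_C0 v"
  "mean_C0 (u - v) = mean_C0 u - mean_C0 v" "mean_C0 (- u) = - mean_C0 u"
  "mean_C0 (r *\<^sub>R u) = r * mean_C0 u" "mean_C0 (const_C0 r) = r"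
  by (simp_all add: mean_C0_def integrable_eval_C0)

lemma abs_mean_C0_le_norm: "\<bar>mean_C0 u\<bar> \<le> norm u"
proof -
  have "\<bar>mean_C0 u\<bar> \<le> (LINT t|circle_measure. \<bar>eval_C0 u t\<bar>)"
    unfolding mean_C0_def by (rule integral_abs_bound)
  also have "\<dots> \<le> (LINT t|circle_measure. norm u)"
    by (rule integral_mono) (auto simp: integrable_eval_C0 abs_eval_C0_le_norm)
  finally show ?thesis by simp
qed

lemma norm_const_C0 [simp]: "norm (const_C0 r) = \<bar>r\<bar>"
  by (simp add: norm_C0_eq_SUP)

lemma const_C0_simps:
  "const_C0 0 = 0" "const_C0 (a + b) = const_C0 a + const_C0 b" "const_C0 (a - b) = const_C0 a - const_C0 b"
  "const_C0 (- a) = - const_C0 a" "const_C0 (r * a) = r *\<^sub>R const_C0 a"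
  by (rule C0_eqI; simp)+

lemma mean_C0_pos:
  assumes "\<And>t. eval_C0 u t > 0"
  shows "mean_C0 u > 0"
proof -
  have "mean_C0 u \<ge> 0"
    unfolding mean_C0_def by (rule Bochner_Integration.integral_nonneg) (use assms less_imp_le in blast)
  moreover have "mean_C0 u \<noteq> 0"
  proof
    assume "mean_C0 u = 0"
    then have "AE t in circle_measure. eval_C0 u t = 0"
      unfolding mean_C0_def
      by (subst (asm) integral_nonneg_eq_0_iff_AE) (auto simp: integrable_eval_C0 less_imp_le[OF assms])
    then have "AE t in circle_measure. False"
      using assms by (auto simp: less_le)
    then show False
      using emeasure_circle_measure by (simp add: eventually_False ae_filter_eq_bot_iff)
  qed
  ultimately show ?thesis by simp
qed

text \<open>Without a zero the function would have constant sign by connectedness of its range, and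
  then a nonzero mean. Every a priori bound below starts from such a zero.\<close>

lemma mean_zero_has_zero:
  assumes "mean_C0 u = 0"
  obtains t where "eval_C0 u t = 0"
proof (rule ccontr)
  assume "\<not> thesis"
  then have nz: "eval_C0 u t \<noteq> 0" for t using that by blast
  have "\<not> (eval_C0 u s < 0 \<and> 0 < eval_C0 u t)" for s t
  proof
    assume *: "eval_C0 u s < 0 \<and> 0 < eval_C0 u t"
    have "connected (range (eval_C0 u))"
      by (intro connected_continuous_image continuous_on_eval_C0 connected_UNIV)
    then have "0 \<in> range (eval_C0 u)"
      by (rule connectedD_interval[of _ "eval_C0 u s" "eval_C0 u t"]) (use * in auto)
    then show False using nz by force
  qed
  then have "(\<forall>t. eval_C0 u t > 0) \<or> (\<forall>t. eval_C0 (- u) t > 0)"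
    using nz by (simp; metis not_less_iff_gr_or_eq)
  then show False
    using mean_C0_pos[of u] mean_C0_pos[of "- u"] assms by auto
qed

section \<open>Primitives of continuous functions on the circle\<close>

lemma AE_circle_neq: "AE t in circle_measure. t \<noteq> s"
proof -
  have "AE t in lborel. t \<in> {0..<1} \<longrightarrow> t \<noteq> s" using AE_lborel_singleton[of s] by auto
  then show ?thesis
    unfolding circle_measure_def by (subst AE_restrict_space_iff) auto
qed

lemma mean_C0_antideriv:
  assumes "\<And>t. (F has_real_derivative eval_C0 w t) (at t)"
  shows "mean_C0 w = F 1 - F 0"
proof -
  \<comment> \<open>The indicator removes the null set {0} and brings the integral into the form of
    \<open>circle_FTC\<close>.\<close>
  have "mean_C0 w = (LINT r|circle_measure. indicator {0<..} r * eval_C0 w r)"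
    unfolding mean_C0_def
  proof (rule integral_cong_AE)
    have [measurable]: "eval_C0 w \<in> borel_measurable circle_measure"
      using integrable_eval_C0 by (rule borel_measurable_integrable)
    show "eval_C0 w \<in> borel_measurable circle_measure" by measurable
    show "(\<lambda>r. indicator {0<..} r * eval_C0 w r) \<in> borel_measurable circle_measure"
      by (intro borel_measurable_times measurable_circle_borel[of "indicator {0<..}"]
            borel_measurable_indicator) auto
    show "AE r in circle_measure. eval_C0 w r = indicator {0<..} r * eval_C0 w r"
      using AE_circle_neq[of 0] AE_space by eventually_elim auto
  qed
  also have "\<dots> = F 1 - F 0"
    by (rule circle_FTC) (use assms in \<open>auto simp: continuous_on_eval_C0\<close>)
  finally show ?thesis .
qed

lemma mean_C0_deriv: "has_deriv_C0 u w \<Longrightarrow> mean_C0 w = 0"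
  using mean_C0_antideriv[of "eval_C0 u" w] periodic_eval_C0[of u]
  by (auto simp: has_deriv_C0_def periodic_def dest: spec[of _ 0])

lemma has_deriv_const_C0: "has_deriv_C0 (const_C0 c) 0"
  unfolding has_deriv_C0_def by (simp add: eval_C0_simps(6)[abs_def])

lemma has_deriv_C0_0_const:
  assumes "has_deriv_C0 u 0"
  shows "u = const_C0 (mean_C0 u)"
proof -
  have "eval_C0 u t = eval_C0 u 0" for t
    using assms DERIV_isconst_all[of "eval_C0 u"] by (auto simp: has_deriv_C0_def)
  then have "u = const_C0 (eval_C0 u 0)" by (intro C0_eqI) simp
  then show ?thesis using mean_C0_simps(6) by metis
qed

text \<open>Subtracting the mean makes the increment of an antiderivative over one period vanish,
  hence the antiderivative periodic; the free constant is spent on making its mean zero.\<close>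

lemma ex_primitive_C0: "\<exists>w. has_deriv_C0 w (p - const_C0 (mean_C0 p)) \<and> mean_C0 w = 0"
proof -
  let ?q = "p - const_C0 (mean_C0 p)"
  have "\<exists>F. \<forall>x::real. - \<infinity> < ereal x \<longrightarrow> ereal x < \<infinity> \<longrightarrow> (F has_vector_derivative eval_C0 ?q x) (at x)"
    by (rule einterval_antiderivative)
      (use continuous_on_eval_C0[of UNIV ?q] in \<open>auto simp: continuous_on_eq_continuous_at\<close>)
  then obtain F where F: "\<And>x. (F has_real_derivative eval_C0 ?q x) (at x)"
    by (auto simp: has_real_derivative_iff_has_vector_derivative)
  have "((\<lambda>t. F (t + 1) - F t) has_real_derivative 0) (at t)" for t
  proof -
    have "((\<lambda>s. F (s + 1)) has_real_derivative eval_C0 ?q (t + 1)) (at t)"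
      using F DERIV_shift by blast
    from DERIV_diff[OF this F[of t]] show ?thesis
      using periodic_eval_C0[of ?q] by (simp add: periodic_def del: eval_C0_simps)
  qed
  then have const: "F (t + 1) - F t = F (0 + 1) - F 0" for t
    using DERIV_isconst_all by blast
  have "F 1 - F 0 = 0" using mean_C0_antideriv[OF F] by simp
  then have per: "periodic F" using const by (simp add: periodic_def)
  have cont: "continuous_on UNIV F"
    using F DERIV_isCont continuous_at_imp_continuous_on by blast
  define w where "w = mk_C0 F - const_C0 (mean_C0 (mk_C0 F))"
  have "has_deriv_C0 (mk_C0 F) ?q"
    unfolding has_deriv_C0_def eval_mk_C0[OF per cont] using F by blast
  then have "has_deriv_C0 w (?q - 0)"
    unfolding w_def by (intro has_deriv_C0_diff has_deriv_const_C0)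
  then show ?thesis by (intro exI[of _ w]) (simp add: w_def)
qed

text \<open>This is the operator \<open>S\<close> of the overview; \<open>prim_C0_eqI\<close> shows
  that the choice is unique. Its kernel consists of the constants.\<close>

definition prim_C0 :: "circle_C0 \<Rightarrow> circle_C0" where
  "prim_C0 p = (SOME w. has_deriv_C0 w (p - const_C0 (mean_C0 p)) \<and> mean_C0 w = 0)"

lemma has_deriv_prim_C0: "has_deriv_C0 (prim_C0 p) (p - const_C0 (mean_C0 p))"
  and mean_prim_C0 [simp]: "mean_C0 (prim_C0 p) = 0"
  using someI_ex[OF ex_primitive_C0[of p]] unfolding prim_C0_def by blast+

lemma prim_C0_eqI:
  assumes "has_deriv_C0 w (p - const_C0 (mean_C0 p))" "mean_C0 w = 0"
  shows "prim_C0 p = w"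
proof -
  have "has_deriv_C0 (prim_C0 p - w) 0"
    using has_deriv_C0_diff[OF has_deriv_prim_C0[of p] assms(1)] by simp
  from has_deriv_C0_0_const[OF this] show ?thesis
    using assms(2) by (simp add: const_C0_simps)
qed

lemma prim_C0_const [simp]: "prim_C0 (const_C0 c) = 0"
  by (rule prim_C0_eqI) (simp_all add: has_deriv_C0_zero)

lemma prim_C0_0 [simp]: "prim_C0 0 = 0"
  by (rule prim_C0_eqI) (simp_all add: const_C0_simps has_deriv_C0_zero)

text \<open>The primitive has a zero within distance 1 to the left of every point, and the mean
  value inequality is applied from there. The factor 2 comes from estimating \<open>p\<close> and
  its mean separately.\<close>

lemma norm_prim_C0_le: "norm (prim_C0 p) \<le> 2 * norm p"
proof (rule norm_C0_le)
  fix t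
  obtain s where s: "eval_C0 (prim_C0 p) s = 0" using mean_zero_has_zero[OF mean_prim_C0] .
  define s' where "s' = s + of_int \<lfloor>t - s\<rfloor>"
  have s': "eval_C0 (prim_C0 p) s' = 0"
    unfolding s'_def using periodic_of_int[OF periodic_eval_C0] s by simp
  have st: "s' \<le> t" "t - s' \<le> 1" unfolding s'_def by linarith+
  have d: "\<bar>eval_C0 (p - const_C0 (mean_C0 p)) r\<bar> \<le> 2 * norm p" for r
    using abs_eval_C0_le_norm[of p r] abs_mean_C0_le_norm[of p] by simp
  have "norm (eval_C0 (prim_C0 p) t - eval_C0 (prim_C0 p) s') \<le> 2 * norm p * norm (t - s')"
    by (rule field_differentiable_bound[of UNIV])
      (use has_deriv_prim_C0[of p] d in \<open>auto simp: has_deriv_C0_def simp del: eval_C0_simps intro: has_field_derivative_at_within\<close>)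
  also have "\<dots> \<le> 2 * norm p" using st by (simp add: mult_left_le)
  finally show "\<bar>eval_C0 (prim_C0 p) t\<bar> \<le> 2 * norm p" using s' by simp
qed

lemma prim_C0_add: "prim_C0 (p + q) = prim_C0 p + prim_C0 q"
  by (rule prim_C0_eqI) (use has_deriv_C0_add[OF has_deriv_prim_C0[of p] has_deriv_prim_C0[of q]] in
      \<open>simp_all add: const_C0_simps algebra_simps\<close>)

lemma prim_C0_scaleR: "prim_C0 (r *\<^sub>R p) = r *\<^sub>R prim_C0 p"
  by (rule prim_C0_eqI) (use has_deriv_C0_scaleR[OF has_deriv_prim_C0[of p], of r] in
      \<open>simp_all add: const_C0_simps algebra_simps\<close>)

lemma bounded_linear_prim_C0: "bounded_linear prim_C0"
  by (rule bounded_linear_intro[where K = 2]) (use norm_prim_C0_le in \<open>auto simp: prim_C0_add prim_C0_scaleR mult.commute\<close>)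

lemmas prim_C0_diff = bounded_linear.linear[OF bounded_linear_prim_C0, THEN linear_diff]

definition mult_C0 :: "circle_C0 \<Rightarrow> circle_C0 \<Rightarrow> circle_C0" where
  "mult_C0 u v = mk_C0 (\<lambda>t. eval_C0 u t * eval_C0 v t)"

lemma eval_mult_C0 [simp]: "eval_C0 (mult_C0 u v) t = eval_C0 u t * eval_C0 v t"
  unfolding mult_C0_def
  by (subst eval_mk_C0) (use periodic_eval_C0 in \<open>auto simp: periodic_def intro!: continuous_intros continuous_on_eval_C0\<close>)

lemma norm_mult_C0_le: "norm (mult_C0 u v) \<le> norm u * norm v"
  by (rule norm_C0_le) (auto simp: abs_mult intro!: mult_mono abs_eval_C0_le_norm)

lemma bounded_bilinear_mult_C0: "bounded_bilinear mult_C0"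
  by standard (auto intro!: C0_eqI exI[of _ 1] simp: algebra_simps norm_mult_C0_le)

section \<open>Periodic solutions of Lipschitz equations\<close>

text \<open>Just after a zero \<open>w\<close> is positive, and by periodicity it becomes
  nonpositive again within one period. At the first such point it can neither be negative, since a
  zero would come earlier, nor zero, since a positive derivative makes it negative just
  before.\<close>

lemma periodic_no_upcrossing:
  fixes w w' :: "real \<Rightarrow> real"
  assumes der: "\<And>t. (w has_real_derivative w' t) (at t)" and per: "periodic w"
    and up: "\<And>t. w t = 0 \<Longrightarrow> w' t > 0"
  shows "w t0 \<noteq> 0"
proof
  assume w0: "w t0 = 0"
  have cont: "continuous_on S w" for S
    using der DERIV_isCont continuous_at_imp_continuous_on by blast
  obtain d where d: "d > 0" "\<And>h. 0 < h \<Longrightarrow> h < d \<Longrightarrow> w t0 < w (t0 + h)"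
    using DERIV_pos_inc_right[OF der up[OF w0]] by blast
  define a where "a = t0 + min d 1 / 2"
  have a: "t0 < a" "a < t0 + 1" "w a > 0"
    using d(2)[of "min d 1 / 2"] d(1) w0 by (auto simp: a_def)
  define Z where "Z = {a..t0 + 1} \<inter> w -` {..0}"
  have "closed Z"
    unfolding Z_def by (intro continuous_closed_preimage cont) auto
  then have "compact Z"
    using compact_Int_closed[of "{a..t0 + 1}" Z] by (simp add: Z_def Int_assoc[symmetric])
  moreover have "t0 + 1 \<in> Z"
    using a w0 spec[OF per[unfolded periodic_def], of t0] by (simp add: Z_def)
  ultimately obtain t1 where t1: "t1 \<in> Z" "\<And>t. t \<in> Z \<Longrightarrow> t1 \<le> t"
    using compact_attains_inf[of Z] by blast
  have "t1 > a" using t1(1) a(3) by (cases "t1 = a") (auto simp: Z_def)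
  have "\<exists>t\<in>{a..<t1}. w t \<le> 0"
  proof (cases "w t1 = 0")
    case True
    then obtain e where e: "e > 0" "\<And>h. 0 < h \<Longrightarrow> h < e \<Longrightarrow> w (t1 - h) < w t1"
      using DERIV_pos_inc_left[OF der up[OF True]] by blast
    have "0 < min e (t1 - a)" using e(1) \<open>t1 > a\<close> by simp
    then obtain h where "0 < h" "h < min e (t1 - a)" using dense by blast
    then show ?thesis using e(2)[of h] True by (intro bexI[of _ "t1 - h"]) simp_all
  next
    case False
    then have "w t1 < 0" using t1(1) by (auto simp: Z_def)
    then obtain t where "a \<le> t" "t \<le> t1" "w t = 0"
      using IVT2'[OF less_imp_le less_imp_le less_imp_le cont, of t1 0 a] a(3) \<open>t1 > a\<close> by blast
    moreover from this have "t < t1" using False by (cases "t = t1") simp_all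
    ultimately show ?thesis by (intro bexI[of _ t]) simp_all
  qed
  then obtain t where t: "a \<le> t" "t < t1" "w t \<le> 0" by (meson atLeastLessThan_iff)
  then have "t \<in> Z" using t1(1) by (simp add: Z_def)
  then show False using t1(2)[of t] t(2) by linarith
qed

text \<open>If \<open>c\<close> were larger than \<open>P\<close> in modulus, \<open>w'\<close>
  would have the sign of \<open>c\<close> at every zero of \<open>w\<close>. Only values at zeros
  enter, which later keeps the bound independent of the truncation.\<close>

lemma periodic_drift_bound:
  fixes w w' :: "real \<Rightarrow> real"
  assumes der: "\<And>t. (w has_real_derivative w' t) (at t)" and per: "periodic w" and w0: "w t0 = 0"
    and bd: "\<And>t. w t = 0 \<Longrightarrow> \<bar>w' t - c\<bar> \<le> P"
  shows "\<bar>c\<bar> \<le> P"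
proof (rule ccontr)
  assume "\<not> \<bar>c\<bar> \<le> P"
  then consider "c > P" | "- c > P" by linarith
  then show False
  proof cases
    case 1
    have "w' t > 0" if "w t = 0" for t using bd[OF that] 1 by linarith
    with periodic_no_upcrossing[OF der per] w0 show False by blast
  next
    case 2
    have "- w' t > 0" if "- w t = 0" for t using bd[of t] that 2 by simp
    moreover have "periodic (\<lambda>t. - w t)" using per by (simp add: periodic_def)
    ultimately show False
      using periodic_no_upcrossing[of "\<lambda>t. - w t" "\<lambda>t. - w' t" t0] DERIV_minus[OF der] w0 by auto
  qed
qed

text \<open>The unknown constant \<open>c\<close> is absorbed first:
  \<open>periodic_drift_bound\<close> turns the hypothesis into a linear growth condition on
  \<open>w'\<close> with \<open>2 * P\<close> in place of \<open>P\<close>. Gronwall then runs over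
  at most one period, from the nearest zero to the left of \<open>t\<close>.\<close>

lemma periodic_growth_bound:
  fixes w w' :: "real \<Rightarrow> real"
  assumes der: "\<And>t. (w has_real_derivative w' t) (at t)" and per: "periodic w" and w0: "w t0 = 0"
    and bd: "\<And>t. \<bar>w' t - c\<bar> \<le> P + L * \<bar>w t\<bar>" and L: "L \<ge> 0"
  shows "\<bar>w t\<bar> \<le> 2 * P * exp (L + 1)"
proof -
  have c: "\<bar>c\<bar> \<le> P"
    using periodic_drift_bound[OF der per w0] bd by (metis abs_zero add.right_neutral mult_zero_right)
  then have P: "P \<ge> 0" by linarith
  have w': "\<bar>w' t\<bar> \<le> 2 * P + L * \<bar>w t\<bar>" for t using bd[of t] c by linarith
  \<comment> \<open>The summand 1 pays for the cross term of \<open>2 * w * w'\<close>, by 2 |w| (2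
    P) \<le> w^2 + 4 P^2. Since \<open>k \<le> 2 * (L + 1)\<close>, taking the square root at the
    end leaves \<open>exp (L + 1)\<close>.\<close>
  define k where "k = 2 * L + 1"
  have k: "k \<ge> 1" using L by (simp add: k_def)
  \<comment> \<open>Gronwall for \<open>w\<^sup>2\<close>, whose derivative is at most \<open>4 P\<^sup>2 + k w\<^sup>2\<close>.\<close>
  define g where "g t = ((w t)\<^sup>2 + 4 * P\<^sup>2 / k) * exp (- k * t)" for t
  have dg: "(g has_real_derivative (2 * w t * w' t - k * (w t)\<^sup>2 - 4 * P\<^sup>2) * exp (- k * t)) (at t)" for t
    unfolding g_def using k
    by (auto intro!: derivative_eq_intros der simp: field_simps power2_eq_square)
  have neg: "(2 * w t * w' t - k * (w t)\<^sup>2 - 4 * P\<^sup>2) * exp (- k * t) \<le> 0" for t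
  proof -
    have "2 * w t * w' t \<le> 2 * (\<bar>w t\<bar> * \<bar>w' t\<bar>)"
      by (simp add: abs_mult[symmetric])
    also have "\<dots> \<le> 2 * (\<bar>w t\<bar> * (2 * P + L * \<bar>w t\<bar>))"
      using w'[of t] by (simp add: mult_left_mono)
    also have "\<dots> = 2 * \<bar>w t\<bar> * (2 * P) + 2 * L * (w t)\<^sup>2"
      by (simp add: algebra_simps power2_eq_square)
    also have "\<dots> \<le> k * (w t)\<^sup>2 + 4 * P\<^sup>2"
      using sum_squares_bound[of "\<bar>w t\<bar>" "2 * P"] by (simp add: k_def algebra_simps)
    finally show ?thesis by (simp add: mult_nonpos_nonneg)
  qed
  define s where "s = t0 + of_int \<lfloor>t - t0\<rfloor>"
  have s: "w s = 0" unfolding s_def using periodic_of_int[OF per] w0 by simp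
  have st: "s \<le> t" "t - s \<le> 1" unfolding s_def by linarith+
  have "g t \<le> g s"
    by (rule DERIV_nonpos_imp_nonincreasing[OF st(1)]) (use dg neg in blast)
  then have "((w t)\<^sup>2 + 4 * P\<^sup>2 / k) * exp (- k * t) \<le> 4 * P\<^sup>2 / k * exp (- k * s)"
    by (simp add: g_def s)
  then have "((w t)\<^sup>2 + 4 * P\<^sup>2 / k) \<le> 4 * P\<^sup>2 / k * (exp (- k * s) / exp (- k * t))"
    using pos_le_divide_eq[of "exp (- k * t)"] by (metis exp_gt_zero times_divide_eq_right)
  also have "exp (- k * s) / exp (- k * t) = exp (k * (t - s))"
    by (simp add: exp_diff[symmetric] algebra_simps)
  also have "4 * P\<^sup>2 / k * exp (k * (t - s)) \<le> 4 * P\<^sup>2 / k * exp (2 * (L + 1))"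
  proof -
    have "k * (t - s) \<le> k * 1" using st(2) k by (intro mult_left_mono) auto
    also have "\<dots> \<le> 2 * (L + 1)" by (simp add: k_def)
    finally show ?thesis using k P by (intro mult_left_mono) auto
  qed
  also have "\<dots> \<le> 4 * P\<^sup>2 * exp (2 * (L + 1))"
    using k P by (intro mult_right_mono) (simp_all add: divide_le_eq mult_le_cancel_left1)
  also have "\<dots> = (2 * P * exp (L + 1))\<^sup>2"
    by (simp only: exp_double power_mult_distrib) simp
  finally have "(w t)\<^sup>2 + 4 * P\<^sup>2 / k \<le> (2 * P * exp (L + 1))\<^sup>2" .
  moreover have "0 \<le> 4 * P\<^sup>2 / k" using k by simp
  ultimately have "(w t)\<^sup>2 \<le> (2 * P * exp (L + 1))\<^sup>2" by linarith
  then show ?thesis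
    by (rule power2_le_imp_le[where x = "\<bar>w t\<bar>", simplified power2_abs]) (use P in simp)
qed

text \<open>The right-hand side \<open>x\<close> is only continuous, but \<open>w = u - x\<close> is
  differentiable, has mean zero and therefore a zero, and its derivative differs from the constant
  \<open>mean_C0 p\<close> by \<open>p\<close>. Hence \<open>periodic_growth_bound\<close> applies
  to \<open>w\<close> with \<open>P = L * norm x + q\<close>.\<close>

lemma solution_bound:
  assumes eq: "u + prim_C0 p = x" and bd: "\<And>t. \<bar>eval_C0 p t\<bar> \<le> L * \<bar>eval_C0 u t\<bar> + q" and L: "L \<ge> 0"
  shows "norm u \<le> norm x + 2 * (L * norm x + q) * exp (L + 1)"
proof -
  define w where "w = - prim_C0 p"
  have w: "has_deriv_C0 w (- (p - const_C0 (mean_C0 p)))"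
    unfolding w_def by (intro has_deriv_C0_minus has_deriv_prim_C0)
  obtain t0 where t0: "eval_C0 w t0 = 0"
    using mean_zero_has_zero[of w] by (auto simp: w_def)
  have u: "u = x + w" using eq by (simp add: w_def algebra_simps)
  have "\<bar>eval_C0 w t\<bar> \<le> 2 * (L * norm x + q) * exp (L + 1)" for t
  proof (rule periodic_growth_bound[OF _ periodic_eval_C0 t0 _ L])
    show "(eval_C0 w has_real_derivative mean_C0 p - eval_C0 p t) (at t)" for t
      using w by (simp add: has_deriv_C0_def)
    fix t
    have "\<bar>eval_C0 p t\<bar> \<le> L * (\<bar>eval_C0 x t\<bar> + \<bar>eval_C0 w t\<bar>) + q"
      using bd[of t] L mult_left_mono[OF abs_triangle_ineq[of "eval_C0 x t" "eval_C0 w t"] L]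
      by (simp add: u)
    also have "\<dots> \<le> L * (norm x + \<bar>eval_C0 w t\<bar>) + q"
      using L abs_eval_C0_le_norm[of x t] by (simp add: mult_left_mono)
    finally show "\<bar>mean_C0 p - eval_C0 p t - mean_C0 p\<bar> \<le> L * norm x + q + L * \<bar>eval_C0 w t\<bar>"
      by (simp add: algebra_simps)
  qed
  then have "norm w \<le> 2 * (L * norm x + q) * exp (L + 1)" by (rule norm_C0_le)
  then show ?thesis using norm_triangle_ineq[of x w] by (simp add: u)
qed

text \<open>The factor in front of \<open>norm x\<close> that \<open>solution_bound\<close> yields
  for \<open>q = 0\<close>.\<close>

definition sol_const :: "real \<Rightarrow> real" where
  "sol_const L = 1 + 2 * L * exp (L + 1)"

lemma sol_const_ge_1: "L \<ge> 0 \<Longrightarrow> sol_const L \<ge> 1"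
  by (simp add: sol_const_def)

text \<open>The equation is linear in the pair formed by \<open>u\<close> and \<open>p\<close>, so
  the difference of two solutions satisfies the hypotheses of \<open>solution_bound\<close> with
  zero constant term.\<close>

lemma solution_lipschitz:
  assumes "u + prim_C0 p = x" "v + prim_C0 q = y"
    and "\<And>t. \<bar>eval_C0 p t - eval_C0 q t\<bar> \<le> L * \<bar>eval_C0 u t - eval_C0 v t\<bar>" and L: "L \<ge> 0"
  shows "norm (u - v) \<le> sol_const L * norm (x - y)"
proof -
  have "(u - v) + prim_C0 (p - q) = x - y"
    using assms(1,2) by (auto simp: prim_C0_diff)
  from solution_bound[OF this _ L, of 0] assms(3) show ?thesis
    by (simp add: sol_const_def algebra_simps)
qed

text \<open>Method of continuity in the parameter \<open>l\<close>: the a priori bound is uniform in \<open>l\<close>, so the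
  step size of the contraction argument is, too.\<close>

lemma ex_solution_lipschitz:
  assumes lip: "\<And>u v t. \<bar>eval_C0 (N u) t - eval_C0 (N v) t\<bar> \<le> L * \<bar>eval_C0 u t - eval_C0 v t\<bar>"
    and L: "L \<ge> 0"
  shows "\<exists>u. u + prim_C0 (N u) = x"
proof -
  define solvable where "solvable l \<longleftrightarrow> (\<forall>x. \<exists>u. u + prim_C0 (l *\<^sub>R N u) = x)" for l
  have N_lip: "norm (N u - N v) \<le> L * norm (u - v)" for u v
  proof (rule norm_C0_le)
    fix t
    show "\<bar>eval_C0 (N u - N v) t\<bar> \<le> L * norm (u - v)"
      using lip[of u t v] mult_left_mono[OF abs_eval_C0_le_norm[of "u - v" t] L] by simp
  qed
  define K where "K = sol_const L"
  have K: "K \<ge> 1" unfolding K_def by (rule sol_const_ge_1[OF L])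
  \<comment> \<open>For \<open>l \<le> 1\<close> the solution operator at \<open>l\<close> has
    Lipschitz constant \<open>K\<close>, and \<open>norm_prim_C0_le\<close> contributes a factor 2.
    The contraction constant is therefore \<open>2 * K * L * d\<close>, at most 1/2 by the condition
    on \<open>d\<close>.\<close>
  have step: "solvable (l + d)" if l: "0 \<le> l" "l \<le> 1" and d: "0 \<le> d" "d * (4 * K * L) \<le> 1" and "solvable l" for l d
    unfolding solvable_def
  proof
    fix x
    obtain sol where sol: "\<And>y. sol y + prim_C0 (l *\<^sub>R N (sol y)) = y"
      using \<open>solvable l\<close> unfolding solvable_def by metis
    \<comment> \<open>The surplus term with coefficient \<open>d\<close> is treated as part of the
      right-hand side, so that fixed points solve the equation for the parameter
      \<open>l + d\<close>.\<close>
    define \<phi> where "\<phi> u = sol (x - d *\<^sub>R prim_C0 (N u))" for u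
    have contr: "dist (\<phi> u) (\<phi> v) \<le> 1/2 * dist u v" for u v
    proof -
      have "norm (\<phi> u - \<phi> v) \<le> K * norm ((x - d *\<^sub>R prim_C0 (N u)) - (x - d *\<^sub>R prim_C0 (N v)))"
        unfolding \<phi>_def K_def
      proof (rule solution_lipschitz[OF sol sol _ L])
        fix y z t
        show "\<bar>eval_C0 (l *\<^sub>R N (sol y)) t - eval_C0 (l *\<^sub>R N (sol z)) t\<bar>
            \<le> L * \<bar>eval_C0 (sol y) t - eval_C0 (sol z) t\<bar>"
          using lip[of "sol y" t "sol z"] l
            mult_left_le_one_le[of "\<bar>eval_C0 (N (sol y)) t - eval_C0 (N (sol z)) t\<bar>" l]
          by (simp add: right_diff_distrib[symmetric] abs_mult)
      qed
      also have "(x - d *\<^sub>R prim_C0 (N u)) - (x - d *\<^sub>R prim_C0 (N v)) = - (d *\<^sub>R prim_C0 (N u - N v))"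
        by (simp add: prim_C0_diff scaleR_diff_right)
      also have "K * norm \<dots> = K * (d * norm (prim_C0 (N u - N v)))" using d by simp
      also have "\<dots> \<le> K * (d * (2 * (L * norm (u - v))))"
        using K d norm_prim_C0_le[of "N u - N v"] N_lip[of u v] by (intro mult_left_mono) auto
      also have "\<dots> = d * (4 * K * L) * (1/2 * norm (u - v))" by simp
      also have "\<dots> \<le> 1 * (1/2 * norm (u - v))"
        using d by (intro mult_right_mono) auto
      finally show ?thesis by (simp add: dist_norm)
    qed
    have "\<exists>!u\<in>UNIV. \<phi> u = u"
      by (rule Banach_fix[OF complete_UNIV_C0, of "1/2"]) (use contr in auto)
    then obtain u where "\<phi> u = u" by blast
    then have "u + prim_C0 (l *\<^sub>R N u) = x - d *\<^sub>R prim_C0 (N u)"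
      using sol[of "x - d *\<^sub>R prim_C0 (N u)"] by (simp add: \<phi>_def)
    then have "u + (prim_C0 (l *\<^sub>R N u) + d *\<^sub>R prim_C0 (N u)) = x"
      by (simp add: algebra_simps)
    then have "u + prim_C0 ((l + d) *\<^sub>R N u) = x"
      by (simp only: scaleR_add_left prim_C0_add prim_C0_scaleR[symmetric])
    then show "\<exists>u. u + prim_C0 ((l + d) *\<^sub>R N u) = x" by blast
  qed
  obtain n :: nat where n: "4 * K * L \<le> real n" "n > 0"
    using real_arch_simple[of "max 1 (4 * K * L)"] by (metis max.bounded_iff of_nat_0_less_iff less_le_trans zero_less_one)
  have "solvable (real k / real n)" if "k \<le> n" for k
    using that
  proof (induction k)
    case 0
    show ?case by (simp add: solvable_def)
  next
    case (Suc k)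
    then have "solvable (real k / real n + 1 / real n)"
      using n by (intro step) (auto simp: divide_le_eq)
    then show ?case by (simp add: add_divide_distrib[symmetric] add.commute)
  qed
  from this[of n] n show ?thesis by (simp add: solvable_def)
qed

section \<open>Smooth dependence on the right-hand side\<close>

text \<open>Landau symbols for forms that depend on an increment \<open>h\<close> and, typically,
  multilinearly on vectors \<open>\<rho> i\<close> with labels \<open>i\<close> in \<open>I\<close>:
  \<open>big_family m I\<close> is O(|h|^m) and \<open>small_family I\<close> is o(|h|), uniformly
  with respect to the product of the norms of the labelled vectors.\<close>

definition big_family :: "nat \<Rightarrow> nat set \<Rightarrow> ('y::real_normed_vector \<Rightarrow> (nat \<Rightarrow> 'y) \<Rightarrow> circle_C0) \<Rightarrow> bool" where
  "big_family m I E \<longleftrightarrow> (\<exists>K\<ge>0. eventually (\<lambda>h. \<forall>\<rho>. norm (E h \<rho>) \<le> K * norm h ^ m * (\<Prod>i\<in>I. norm (\<rho> i))) (nhds 0))"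

definition small_family :: "nat set \<Rightarrow> ('y::real_normed_vector \<Rightarrow> (nat \<Rightarrow> 'y) \<Rightarrow> circle_C0) \<Rightarrow> bool" where
  "small_family I E \<longleftrightarrow> (\<forall>e>0. eventually (\<lambda>h. \<forall>\<rho>. norm (E h \<rho>) \<le> e * norm h * (\<Prod>i\<in>I. norm (\<rho> i))) (nhds 0))"

lemma small_familyD:
  "small_family I E \<Longrightarrow> e > 0 \<Longrightarrow> eventually (\<lambda>h. \<forall>\<rho>. norm (E h \<rho>) \<le> e * norm h * (\<Prod>i\<in>I. norm (\<rho> i))) (nhds 0)"
  by (simp add: small_family_def)

lemma prod_norm_nonneg [simp]: "0 \<le> (\<Prod>i\<in>I. norm (\<rho> i))"
  by (rule prod_nonneg) simp

lemma small_family_add: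
  assumes "small_family I E" "small_family I F"
  shows "small_family I (\<lambda>h \<rho>. E h \<rho> + F h \<rho>)"
  unfolding small_family_def
proof (intro allI impI)
  fix e :: real assume "e > 0"
  then have "e/2 > 0" by simp
  from small_familyD[OF assms(1) this] small_familyD[OF assms(2) this]
  show "eventually (\<lambda>h. \<forall>\<rho>. norm (E h \<rho> + F h \<rho>) \<le> e * norm h * (\<Prod>i\<in>I. norm (\<rho> i))) (nhds 0)"
  proof eventually_elim
    case (elim h)
    show ?case
    proof
      fix \<rho>
      have "norm (E h \<rho> + F h \<rho>) \<le> norm (E h \<rho>) + norm (F h \<rho>)" by (rule norm_triangle_ineq)
      also have "\<dots> \<le> e/2 * norm h * (\<Prod>i\<in>I. norm (\<rho> i)) + e/2 * norm h * (\<Prod>i\<in>I. norm (\<rho> i))"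
        by (rule add_mono) (use elim in blast)+
      finally show "norm (E h \<rho> + F h \<rho>) \<le> e * norm h * (\<Prod>i\<in>I. norm (\<rho> i))" by simp
    qed
  qed
qed

lemma big_family_add:
  assumes "big_family m I E" "big_family m I F"
  shows "big_family m I (\<lambda>h \<rho>. E h \<rho> + F h \<rho>)"
proof -
  from assms obtain K L where K: "K \<ge> 0" "eventually (\<lambda>h. \<forall>\<rho>. norm (E h \<rho>) \<le> K * norm h ^ m * (\<Prod>i\<in>I. norm (\<rho> i))) (nhds 0)"
    and L: "L \<ge> 0" "eventually (\<lambda>h. \<forall>\<rho>. norm (F h \<rho>) \<le> L * norm h ^ m * (\<Prod>i\<in>I. norm (\<rho> i))) (nhds 0)"
    unfolding big_family_def by blast
  from K(2) L(2) have "eventually (\<lambda>h. \<forall>\<rho>. norm (E h \<rho> + F h \<rho>) \<le> (K + L) * norm h ^ m * (\<Prod>i\<in>I. norm (\<rho> i))) (nhds 0)"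
  proof eventually_elim
    case (elim h)
    show ?case
    proof
      fix \<rho>
      have "norm (E h \<rho> + F h \<rho>) \<le> norm (E h \<rho>) + norm (F h \<rho>)" by (rule norm_triangle_ineq)
      also have "\<dots> \<le> K * norm h ^ m * (\<Prod>i\<in>I. norm (\<rho> i)) + L * norm h ^ m * (\<Prod>i\<in>I. norm (\<rho> i))"
        by (rule add_mono) (use elim in blast)+
      finally show "norm (E h \<rho> + F h \<rho>) \<le> (K + L) * norm h ^ m * (\<Prod>i\<in>I. norm (\<rho> i))"
        by (simp add: algebra_simps)
    qed
  qed
  with K(1) L(1) show ?thesis unfolding big_family_def by (intro exI[of _ "K + L"]) simp
qed

lemma big_family_small:
  assumes "small_family I E"
  shows "big_family 1 I E"
  unfolding big_family_def using small_familyD[OF assms, of 1] by (intro exI[of _ 1]) simp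

lemma small_family_big:
  assumes "big_family 2 I E"
  shows "small_family I E"
  unfolding small_family_def
proof (intro allI impI)
  fix e :: real assume e: "e > 0"
  obtain K where K: "K \<ge> 0" "eventually (\<lambda>h. \<forall>\<rho>. norm (E h \<rho>) \<le> K * norm h ^ 2 * (\<Prod>i\<in>I. norm (\<rho> i))) (nhds 0)"
    using assms unfolding big_family_def by blast
  have "eventually (\<lambda>h. norm (h::'a) < e / (K + 1)) (nhds 0)"
    using e K(1) eventually_nhds_metric[of "\<lambda>h. norm (h::'a) < e / (K + 1)" 0]
    by (auto intro!: exI[of _ "e / (K + 1)"])
  with K(2) show "eventually (\<lambda>h. \<forall>\<rho>. norm (E h \<rho>) \<le> e * norm h * (\<Prod>i\<in>I. norm (\<rho> i))) (nhds 0)"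
  proof eventually_elim
    case (elim h)
    have "(K + 1) * norm h \<le> e" using elim(2) K(1) by (simp add: field_simps)
    then have "K * norm h \<le> e" using norm_ge_zero[of h] by (simp add: distrib_right del: norm_ge_zero)
    then have "K * norm h ^ 2 \<le> e * norm h"
      using mult_right_mono[of "K * norm h" e "norm h"] by (simp add: power2_eq_square)
    then show ?case
      using elim(1) by (blast intro: order_trans mult_right_mono prod_norm_nonneg)
  qed
qed

lemma big_family_diff:
  assumes "big_family 1 I E'" "small_family I (\<lambda>h \<rho>. E h \<rho> - E' h \<rho>)"
  shows "big_family 1 I E"
  using big_family_add[OF assms(1) big_family_small[OF assms(2)]] by simp

lemma big_family_mult:
  assumes "big_family m I E" "big_family n J F" and IJ: "finite I" "finite J" "I \<inter> J = {}"
  shows "big_family (m + n) (I \<union> J) (\<lambda>h \<rho>. mult_C0 (E h \<rho>) (F h \<rho>))"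
proof -
  from assms obtain K L where K: "K \<ge> 0" "eventually (\<lambda>h. \<forall>\<rho>. norm (E h \<rho>) \<le> K * norm h ^ m * (\<Prod>i\<in>I. norm (\<rho> i))) (nhds 0)"
    and L: "L \<ge> 0" "eventually (\<lambda>h. \<forall>\<rho>. norm (F h \<rho>) \<le> L * norm h ^ n * (\<Prod>i\<in>J. norm (\<rho> i))) (nhds 0)"
    unfolding big_family_def by blast
  from K(2) L(2) have "eventually (\<lambda>h. \<forall>\<rho>. norm (mult_C0 (E h \<rho>) (F h \<rho>)) \<le> (K * L) * norm h ^ (m + n) * (\<Prod>i\<in>I \<union> J. norm (\<rho> i))) (nhds 0)"
  proof eventually_elim
    case (elim h)
    show ?case
    proof
      fix \<rho>
      have "norm (mult_C0 (E h \<rho>) (F h \<rho>)) \<le> norm (E h \<rho>) * norm (F h \<rho>)" by (rule norm_mult_C0_le)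
      also have "\<dots> \<le> (K * norm h ^ m * (\<Prod>i\<in>I. norm (\<rho> i))) * (L * norm h ^ n * (\<Prod>i\<in>J. norm (\<rho> i)))"
        by (rule mult_mono) (use elim K(1) in \<open>auto intro!: mult_nonneg_nonneg prod_norm_nonneg\<close>)
      also have "\<dots> = (K * L) * norm h ^ (m + n) * (\<Prod>i\<in>I \<union> J. norm (\<rho> i))"
        using IJ by (simp add: prod.union_disjoint power_add)
      finally show "norm (mult_C0 (E h \<rho>) (F h \<rho>)) \<le> (K * L) * norm h ^ (m + n) * (\<Prod>i\<in>I \<union> J. norm (\<rho> i))" .
    qed
  qed
  with K(1) L(1) show ?thesis unfolding big_family_def by (intro exI[of _ "K * L"]) simp
qed

lemma small_family_mult:
  assumes "small_family I E" "big_family 0 J F" and IJ: "finite I" "finite J" "I \<inter> J = {}"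
  shows "small_family (I \<union> J) (\<lambda>h \<rho>. mult_C0 (E h \<rho>) (F h \<rho>))"
  unfolding small_family_def
proof (intro allI impI)
  fix e :: real assume e: "e > 0"
  from assms obtain L where
    L: "L \<ge> 0" "eventually (\<lambda>h. \<forall>\<rho>. norm (F h \<rho>) \<le> L * norm h ^ 0 * (\<Prod>i\<in>J. norm (\<rho> i))) (nhds 0)"
    unfolding big_family_def by blast
  \<comment> \<open>The bound \<open>L\<close> may be 0, hence the \<open>L + 1\<close> in the
    denominator.\<close>
  have e': "e / (L + 1) > 0" using e L(1) by simp
  from small_familyD[OF assms(1) e'] L(2)
  show "eventually (\<lambda>h. \<forall>\<rho>. norm (mult_C0 (E h \<rho>) (F h \<rho>)) \<le> e * norm h * (\<Prod>i\<in>I \<union> J. norm (\<rho> i))) (nhds 0)"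
  proof eventually_elim
    case (elim h)
    show ?case
    proof
      fix \<rho>
      have "norm (mult_C0 (E h \<rho>) (F h \<rho>)) \<le> norm (E h \<rho>) * norm (F h \<rho>)" by (rule norm_mult_C0_le)
      also have "\<dots> \<le> (e / (L + 1) * norm h * (\<Prod>i\<in>I. norm (\<rho> i))) * (L * norm h ^ 0 * (\<Prod>i\<in>J. norm (\<rho> i)))"
        by (rule mult_mono) (use elim e L(1) in \<open>auto intro!: mult_nonneg_nonneg divide_nonneg_nonneg\<close>)
      also have "\<dots> = (e / (L + 1) * L) * (norm h * (\<Prod>i\<in>I \<union> J. norm (\<rho> i)))"
        using IJ by (simp add: prod.union_disjoint)
      also have "\<dots> \<le> e * (norm h * (\<Prod>i\<in>I \<union> J. norm (\<rho> i)))"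
        by (rule mult_right_mono) (use e L(1) in \<open>auto simp: field_simps\<close>)
      finally show "norm (mult_C0 (E h \<rho>) (F h \<rho>)) \<le> e * norm h * (\<Prod>i\<in>I \<union> J. norm (\<rho> i))" by simp
    qed
  qed
qed

lemma small_family_comp:
  assumes "small_family I E" and A: "\<And>x. norm (A x) \<le> K * norm x"
  shows "small_family I (\<lambda>h \<rho>. A (E h \<rho>))"
  unfolding small_family_def
proof (intro allI impI)
  fix e :: real assume e: "e > 0"
  have e': "e / (\<bar>K\<bar> + 1) > 0" using e by simp
  from small_familyD[OF assms(1) e']
  show "eventually (\<lambda>h. \<forall>\<rho>. norm (A (E h \<rho>)) \<le> e * norm h * (\<Prod>i\<in>I. norm (\<rho> i))) (nhds 0)"
  proof eventually_elim
    case (elim h)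
    show ?case
    proof
      fix \<rho>
      have "norm (A (E h \<rho>)) \<le> (\<bar>K\<bar> + 1) * norm (E h \<rho>)"
        by (rule order_trans[OF A]) (simp add: mult_right_mono)
      also have "\<dots> \<le> (\<bar>K\<bar> + 1) * (e / (\<bar>K\<bar> + 1) * norm h * (\<Prod>i\<in>I. norm (\<rho> i)))"
        using elim by (intro mult_left_mono) auto
      also have "\<dots> = e * norm h * (\<Prod>i\<in>I. norm (\<rho> i))" by (simp add: field_simps)
      finally show "norm (A (E h \<rho>)) \<le> e * norm h * (\<Prod>i\<in>I. norm (\<rho> i))" .
    qed
  qed
qed

lemma big_family_comp:
  assumes "big_family m I E" and A: "eventually (\<lambda>h. \<forall>x. norm (A h x) \<le> K * norm h ^ n * norm x) (nhds 0)" and K: "K \<ge> 0"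
  shows "big_family (m + n) I (\<lambda>h \<rho>. A h (E h \<rho>))"
proof -
  from assms obtain L where
    L: "L \<ge> 0" "eventually (\<lambda>h. \<forall>\<rho>. norm (E h \<rho>) \<le> L * norm h ^ m * (\<Prod>i\<in>I. norm (\<rho> i))) (nhds 0)"
    unfolding big_family_def by blast
  from A L(2) have "eventually (\<lambda>h. \<forall>\<rho>. norm (A h (E h \<rho>)) \<le> (K * L) * norm h ^ (m + n) * (\<Prod>i\<in>I. norm (\<rho> i))) (nhds 0)"
  proof eventually_elim
    case (elim h)
    show ?case
    proof
      fix \<rho>
      have "norm (A h (E h \<rho>)) \<le> K * norm h ^ n * norm (E h \<rho>)" using elim by blast
      also have "\<dots> \<le> K * norm h ^ n * (L * norm h ^ m * (\<Prod>i\<in>I. norm (\<rho> i)))"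
        using elim K by (intro mult_left_mono) auto
      finally show "norm (A h (E h \<rho>)) \<le> (K * L) * norm h ^ (m + n) * (\<Prod>i\<in>I. norm (\<rho> i))"
        by (simp add: power_add mult_ac)
    qed
  qed
  with K(1) L(1) show ?thesis unfolding big_family_def by (intro exI[of _ "K * L"]) simp
qed

text \<open>This serves the case where the linearisation error sits in an operator depending on
  \<open>h\<close>, such as \<open>Lam (z + h)\<close>, while its argument is a fixed multilinear
  expression.\<close>

lemma small_family_apply:
  assumes A: "\<And>e. e > 0 \<Longrightarrow> eventually (\<lambda>h. \<forall>x. norm (A h x) \<le> e * norm h * norm x) (nhds 0)"
    and E: "\<And>\<rho>. norm (E \<rho>) \<le> K * (\<Prod>i\<in>I. norm (\<rho> i))" and K: "K \<ge> 0"
  shows "small_family I (\<lambda>h \<rho>. A h (E \<rho>))"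
  unfolding small_family_def
proof (intro allI impI)
  fix e :: real assume e: "e > 0"
  have e': "e / (K + 1) > 0" using e K by simp
  from A[OF e']
  show "eventually (\<lambda>h. \<forall>\<rho>. norm (A h (E \<rho>)) \<le> e * norm h * (\<Prod>i\<in>I. norm (\<rho> i))) (nhds 0)"
  proof eventually_elim
    case (elim h)
    show ?case
    proof
      fix \<rho>
      have "norm (A h (E \<rho>)) \<le> e / (K + 1) * norm h * norm (E \<rho>)" using elim by blast
      also have "\<dots> \<le> e / (K + 1) * norm h * (K * (\<Prod>i\<in>I. norm (\<rho> i)))"
        using E[of \<rho>] e K by (intro mult_left_mono) auto
      also have "\<dots> = e / (K + 1) * K * (norm h * (\<Prod>i\<in>I. norm (\<rho> i)))" by simp
      also have "\<dots> \<le> e * (norm h * (\<Prod>i\<in>I. norm (\<rho> i)))"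
        by (rule mult_right_mono) (use e K in \<open>auto simp: field_simps\<close>)
      finally show "norm (A h (E \<rho>)) \<le> e * norm h * (\<Prod>i\<in>I. norm (\<rho> i))" by simp
    qed
  qed
qed

text \<open>
  \<open>R z\<close> solves \<open>u + S (a\<^sub>0 u) = T z\<close>, where \<open>a\<^sub>j\<close> stands for the \<open>j\<close>-th derivative of a superposition
  operator, and \<open>\<Lambda> z\<close> inverts the linearisation at \<open>R z\<close>. The iterated derivatives of \<open>a\<^sub>0 (R z)\<close> are sums
  of products of the functions in the inductive class below, which is closed under differentiation;
  the index set \<open>I\<close> keeps track of the vectors on which a function depends multilinearly.
\<close>

locale smooth_equation =
  fixes T :: "'y::real_normed_vector \<Rightarrow> circle_C0" and S :: "circle_C0 \<Rightarrow> circle_C0"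
    and a :: "nat \<Rightarrow> circle_C0 \<Rightarrow> circle_C0" and R :: "'y \<Rightarrow> circle_C0"
    and Lam :: "'y \<Rightarrow> circle_C0 \<Rightarrow> circle_C0"
  assumes T: "bounded_linear T" and S: "bounded_linear S"
    and a: "\<And>j u. (a j has_derivative mult_C0 (a (Suc j) u)) (at u)"
    and R_cont: "\<And>z. isCont R z"
    and R_eq: "\<And>z. R z + S (a 0 (R z)) = T z"
    and Lam_iff: "\<And>z w x. w + S (mult_C0 (a 1 (R z)) w) = x \<longleftrightarrow> w = Lam z x"
    and Lam_bounded: "\<And>z. \<exists>K. \<forall>x. norm (Lam z x) \<le> K * norm x"
begin

interpretation mult: bounded_bilinear mult_C0 by (rule bounded_bilinear_mult_C0)
interpretation S: bounded_linear S by (rule S)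
interpretation T: bounded_linear T by (rule T)

section \<open>Differentiability of the solution and of the inverse linearisation\<close>

lemma Lam_eq: "Lam z x + S (mult_C0 (a 1 (R z)) (Lam z x)) = x"
  using Lam_iff by blast

lemma bounded_linear_Lam: "bounded_linear (Lam z)"
proof -
  have "Lam z (x + y) = Lam z x + Lam z y" for x y
    using arg_cong2[OF Lam_eq[of z x] Lam_eq[of z y], of "(+)"]
    by (intro Lam_iff[THEN iffD1, symmetric]) (simp add: mult.add_right S.add algebra_simps)
  moreover have "Lam z (r *\<^sub>R x) = r *\<^sub>R Lam z x" for r x
    using arg_cong[OF Lam_eq[of z x], of "scaleR r"]
    by (intro Lam_iff[THEN iffD1, symmetric]) (simp add: mult.scaleR_right S.scaleR scaleR_add_right)
  moreover obtain K where "\<And>x. norm (Lam z x) \<le> K * norm x" using Lam_bounded by blast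
  ultimately show ?thesis by (intro bounded_linear_intro[of _ K]) (auto simp: mult.commute)
qed

lemma Lam_pos_bound: obtains K where "K > 0" "\<And>x. norm (Lam z x) \<le> K * norm x"
  using bounded_linear.pos_bounded[OF bounded_linear_Lam, of z] by (auto simp: mult.commute)

text \<open>Implicit differentiation: the increment of \<open>R\<close> solves the linearised
  equation up to a superposition error \<open>r\<close>, and \<open>Lam z\<close> inverts that
  equation. Continuity of \<open>R\<close> makes \<open>r\<close> small compared with the increment;
  this first bounds the increment by a multiple of \<open>norm (y - z)\<close> and then makes the
  error o(norm (y - z)).\<close>

lemma has_derivative_R: "(R has_derivative (\<lambda>h. Lam z (T h))) (at z)"
  unfolding has_derivative_at_alt
proof (intro conjI allI impI)
  show bl: "bounded_linear (\<lambda>h. Lam z (T h))"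
    by (rule bounded_linear_compose[OF bounded_linear_Lam T])
  obtain K where K: "K > 0" "\<And>x. norm (Lam z x) \<le> K * norm x" using Lam_pos_bound by blast
  obtain KS where KS: "KS > 0" "\<And>x. norm (S x) \<le> KS * norm x"
    using S.pos_bounded by (auto simp: mult.commute)
  obtain KT where KT: "KT > 0" "\<And>x. norm (T x) \<le> KT * norm x"
    using T.pos_bounded by (auto simp: mult.commute)
  fix e :: real assume e: "e > 0"
  \<comment> \<open>The first entry lets half of the increment be absorbed on the left; the second
    brings the final error below \<open>e\<close>, once the increment is bounded by
    \<open>2 * K * KT * norm (y - z)\<close>.\<close>
  define e1 where "e1 = min (1 / (2 * K * KS)) (e / (2 * K * K * KS * KT))"
  have e1: "e1 > 0" using e K KS KT by (simp add: e1_def)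
  have e1a: "K * KS * e1 \<le> 1/2"
  proof -
    have "K * KS * e1 \<le> K * KS * (1 / (2 * K * KS))"
      using K KS by (intro mult_left_mono) (auto simp: e1_def)
    then show ?thesis using K KS by simp
  qed
  have e1b: "K * KS * e1 * (2 * K * KT) \<le> e"
  proof -
    have "K * KS * e1 * (2 * K * KT) \<le> K * KS * (e / (2 * K * K * KS * KT)) * (2 * K * KT)"
      using K KS KT by (intro mult_right_mono mult_left_mono) (auto simp: e1_def)
    also have "\<dots> = e" using K KS KT by (simp add: field_simps)
    finally show ?thesis .
  qed
  obtain d1 where d1: "d1 > 0" "\<And>v. norm (v - R z) < d1 \<Longrightarrow>
      norm (a 0 v - a 0 (R z) - mult_C0 (a 1 (R z)) (v - R z)) \<le> e1 * norm (v - R z)"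
    using a[of 0 "R z"] e1 unfolding has_derivative_at_alt by auto
  obtain d where d: "d > 0" "\<And>y. dist y z < d \<Longrightarrow> dist (R y) (R z) < d1"
    using R_cont[of z] d1(1) unfolding continuous_at_eps_delta by blast
  have "norm (R y - R z - Lam z (T (y - z))) \<le> e * norm (y - z)" if y: "norm (y - z) < d" for y
  proof -
    define \<delta> where "\<delta> = R y - R z"
    define r where "r = a 0 (R y) - a 0 (R z) - mult_C0 (a 1 (R z)) \<delta>"
    have r: "norm r \<le> e1 * norm \<delta>"
      unfolding r_def \<delta>_def using d(2)[of y] y by (intro d1(2)) (simp add: dist_norm)
    have "\<delta> + S (a 0 (R y) - a 0 (R z)) = T (y - z)"
      using R_eq[of y] R_eq[of z] by (simp add: \<delta>_def S.diff T.diff algebra_simps)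
    then have "\<delta> + S (mult_C0 (a 1 (R z)) \<delta>) = T (y - z) - S r"
      by (simp add: r_def S.diff S.add algebra_simps)
    then have \<delta>: "\<delta> = Lam z (T (y - z)) - Lam z (S r)"
      using Lam_iff by (metis bounded_linear_Lam linear_diff bounded_linear.linear)
    have Sr: "norm (Lam z (S r)) \<le> K * KS * e1 * norm \<delta>"
    proof -
      have "norm (Lam z (S r)) \<le> K * (KS * (e1 * norm \<delta>))"
        using K KS r by (meson less_imp_le mult_left_mono order_trans)
      then show ?thesis by (simp add: mult.assoc)
    qed
    have "norm \<delta> \<le> norm (Lam z (T (y - z))) + norm (Lam z (S r))"
      by (subst (1) \<delta>) (rule norm_triangle_ineq4)
    also have "norm (Lam z (T (y - z))) \<le> K * (KT * norm (y - z))"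
      using K KT by (meson less_imp_le mult_left_mono order_trans)
    also have "norm (Lam z (S r)) \<le> 1/2 * norm \<delta>"
      using Sr mult_right_mono[OF e1a norm_ge_zero[of \<delta>]] by linarith
    finally have "norm \<delta> \<le> 2 * K * KT * norm (y - z)" by simp
    then have "K * KS * e1 * norm \<delta> \<le> K * KS * e1 * (2 * K * KT * norm (y - z))"
      using K KS e1 by (intro mult_left_mono) auto
    also have "\<dots> \<le> e * norm (y - z)"
      using mult_right_mono[OF e1b norm_ge_zero[of "y - z"]] by (simp add: mult.assoc)
    finally show ?thesis using Sr \<delta> by (simp add: \<delta>_def)
  qed
  with d(1) show "\<exists>d>0. \<forall>y. norm (y - z) < d \<longrightarrow> norm (R y - R z - Lam z (T (y - z))) \<le> e * norm (y - z)"
    by blast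
qed

lemma has_derivative_coeff:
  "((\<lambda>z. a j (R z)) has_derivative (\<lambda>h. mult_C0 (a (Suc j) (R z)) (Lam z (T h)))) (at z)"
  using has_derivative_compose[OF has_derivative_R a] by simp

lemma eventually_coeff_diff:
  assumes "e > 0"
  shows "eventually (\<lambda>h. norm (a j (R (z + h)) - a j (R z) - mult_C0 (a (Suc j) (R z)) (Lam z (T h))) \<le> e * norm h) (nhds 0)"
proof -
  obtain d where "d > 0" "\<And>y. norm (y - z) < d \<Longrightarrow>
      norm (a j (R y) - a j (R z) - mult_C0 (a (Suc j) (R z)) (Lam z (T (y - z)))) \<le> e * norm (y - z)"
    using has_derivative_coeff[of j z] assms unfolding has_derivative_at_alt by blast
  from this(1) this(2)[of "z + _"] show ?thesis
    unfolding eventually_nhds_metric by (intro exI[of _ d]) simp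
qed

lemma eventually_coeff_lipschitz:
  obtains C where "C > 0" "eventually (\<lambda>h. norm (a j (R (z + h)) - a j (R z)) \<le> C * norm h) (nhds 0)"
proof -
  obtain B where B: "B > 0" "\<And>h. norm (mult_C0 (a (Suc j) (R z)) (Lam z (T h))) \<le> B * norm h"
    using bounded_linear.pos_bounded[OF has_derivative_bounded_linear[OF has_derivative_coeff[of j z]]]
    by (auto simp: mult.commute)
  have "eventually (\<lambda>h. norm (a j (R (z + h)) - a j (R z)) \<le> (B + 1) * norm h) (nhds 0)"
    using eventually_coeff_diff[of 1 j z, simplified]
  proof eventually_elim
    case (elim h)
    have "norm (a j (R (z + h)) - a j (R z)) \<le>
        norm (a j (R (z + h)) - a j (R z) - mult_C0 (a (Suc j) (R z)) (Lam z (T h))) + norm (mult_C0 (a (Suc j) (R z)) (Lam z (T h)))"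
      using norm_triangle_ineq[of "a j (R (z + h)) - a j (R z) - mult_C0 (a (Suc j) (R z)) (Lam z (T h))" "mult_C0 (a (Suc j) (R z)) (Lam z (T h))"]
      by simp
    then show ?case using elim B(2)[of h] by (simp add: distrib_right)
  qed
  with B(1) show thesis by (intro that[of "B + 1"]) auto
qed

text \<open>The resolvent identity B' - A' = - A' (B - A) B' for the inverses A' and B' of the
  linearised operators A at \<open>z\<close> and B at \<open>y\<close>.\<close>

lemma Lam_diff_eq:
  "Lam y x - Lam z x = - Lam z (S (mult_C0 (a 1 (R y) - a 1 (R z)) (Lam y x)))"
proof -
  have "Lam y x + S (mult_C0 (a 1 (R z)) (Lam y x)) = x - S (mult_C0 (a 1 (R y) - a 1 (R z)) (Lam y x))"
    using Lam_eq[of y x] by (simp add: mult.diff_left S.diff algebra_simps)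
  then have "Lam y x = Lam z (x - S (mult_C0 (a 1 (R y) - a 1 (R z)) (Lam y x)))"
    by (simp only: Lam_iff)
  then show ?thesis
    by (metis (no_types) bounded_linear_Lam linear_diff bounded_linear.linear add_diff_cancel_left' diff_add_cancel minus_diff_eq)
qed

lemma Lam_S_mult_bound:
  obtains C where "C > 0" "\<And>u v. norm (Lam z (S (mult_C0 u v))) \<le> C * norm u * norm v"
proof -
  obtain K where K: "K > 0" "\<And>x. norm (Lam z x) \<le> K * norm x" using Lam_pos_bound by blast
  obtain KS where KS: "KS > 0" "\<And>x. norm (S x) \<le> KS * norm x"
    using S.pos_bounded by (auto simp: mult.commute)
  have "norm (Lam z (S (mult_C0 u v))) \<le> K * (KS * (norm u * norm v))" for u v
    using K KS norm_mult_C0_le[of u v] by (meson less_imp_le mult_left_mono order_trans)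
  with K(1) KS(1) show thesis by (intro that[of "K * KS"]) (auto simp: mult.assoc)
qed

text \<open>\<open>Lam_bounded\<close> gives a bound for each base point only. The resolvent
  identity makes it locally uniform: for small \<open>h\<close> the right-hand side is at most half
  of \<open>Lam (z + h) x\<close>, which is then bounded by
  \<open>2 * norm (Lam z x)\<close>.\<close>

lemma Lam_local_lipschitz:
  obtains C where "C > 0" "eventually (\<lambda>h. \<forall>x. norm (Lam (z + h) x - Lam z x) \<le> C * norm h * norm x) (nhds 0)"
proof -
  obtain K where K: "K > 0" "\<And>x. norm (Lam z x) \<le> K * norm x" using Lam_pos_bound by blast
  obtain C where C: "C > 0" "\<And>u v. norm (Lam z (S (mult_C0 u v))) \<le> C * norm u * norm v"
    using Lam_S_mult_bound by blast
  obtain B where B: "B > 0" "eventually (\<lambda>h. norm (a 1 (R (z + h)) - a 1 (R z)) \<le> B * norm h) (nhds 0)"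
    using eventually_coeff_lipschitz by blast
  have "eventually (\<lambda>h::'y. norm h < 1 / (2 * C * B)) (nhds 0)"
    using B(1) C(1) by (auto simp: eventually_nhds_metric intro!: exI[of _ "1 / (2 * C * B)"])
  with B(2) have "eventually (\<lambda>h. \<forall>x. norm (Lam (z + h) x - Lam z x) \<le> (C * B * 2 * K) * norm h * norm x) (nhds 0)"
  proof eventually_elim
    case (elim h)
    show ?case
    proof
      fix x
      have h: "C * B * norm h \<le> 1/2" using elim(2) C(1) B(1) by (simp add: field_simps)
      have *: "norm (Lam (z + h) x - Lam z x) \<le> C * B * norm h * norm (Lam (z + h) x)"
      proof -
        have "norm (Lam (z + h) x - Lam z x) \<le> C * norm (a 1 (R (z + h)) - a 1 (R z)) * norm (Lam (z + h) x)"
          using C(2) by (subst Lam_diff_eq) simp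
        also have "\<dots> \<le> C * (B * norm h) * norm (Lam (z + h) x)"
          using elim(1) C(1) by (intro mult_right_mono mult_left_mono) auto
        finally show ?thesis by (simp add: mult.assoc)
      qed
      also have "\<dots> \<le> 1/2 * norm (Lam (z + h) x)" using h by (rule mult_right_mono) simp
      finally have "norm (Lam (z + h) x) \<le> 2 * norm (Lam z x)"
        using norm_triangle_ineq2[of "Lam (z + h) x" "Lam z x"] by linarith
      also have "\<dots> \<le> 2 * (K * norm x)" using K(2)[of x] by simp
      finally have "C * B * norm h * norm (Lam (z + h) x) \<le> C * B * norm h * (2 * (K * norm x))"
        using C(1) B(1) by (intro mult_left_mono) auto
      with * show "norm (Lam (z + h) x - Lam z x) \<le> (C * B * 2 * K) * norm h * norm x"
        by (simp add: mult_ac)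
    qed
  qed
  with that[of "C * B * 2 * K"] C(1) B(1) K(1) show thesis by simp
qed

text \<open>This differentiates the inverse operator. In the resolvent identity, replacing
  \<open>Lam (z + h)\<close> by \<open>Lam z\<close> costs a term quadratic in \<open>h\<close>, and
  replacing the increment of the coefficient by its derivative costs o(|h|).\<close>

lemma Lam_small_remainder:
  assumes "e > 0"
  shows "eventually (\<lambda>h. \<forall>x. norm (Lam (z + h) x - Lam z x
    + Lam z (S (mult_C0 (mult_C0 (a 2 (R z)) (Lam z (T h))) (Lam z x)))) \<le> e * norm h * norm x) (nhds 0)"
proof -
  obtain K where K: "K > 0" "\<And>x. norm (Lam z x) \<le> K * norm x" using Lam_pos_bound by blast
  obtain C where C: "C > 0" "\<And>u v. norm (Lam z (S (mult_C0 u v))) \<le> C * norm u * norm v"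
    using Lam_S_mult_bound by blast
  obtain B where B: "B > 0" "eventually (\<lambda>h. norm (a 1 (R (z + h)) - a 1 (R z)) \<le> B * norm h) (nhds 0)"
    using eventually_coeff_lipschitz by blast
  obtain C' where C': "C' > 0" "eventually (\<lambda>h. \<forall>x. norm (Lam (z + h) x - Lam z x) \<le> C' * norm h * norm x) (nhds 0)"
    using Lam_local_lipschitz by blast
  define e1 where "e1 = e / (2 * C * K)"
  have e1: "e1 > 0" using assms C K by (simp add: e1_def)
  have "eventually (\<lambda>h::'y. norm h < e / (2 * C * B * C')) (nhds 0)"
    using assms B(1) C(1) C'(1) by (auto simp: eventually_nhds_metric intro!: exI[of _ "e / (2 * C * B * C')"])
  with B(2) C'(2) eventually_coeff_diff[OF e1, of 1 z] show ?thesis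
  proof eventually_elim
    case (elim h)
    show ?case
    proof
      fix x
      define A where "A = a 1 (R (z + h)) - a 1 (R z)"
      define D where "D = mult_C0 (a 2 (R z)) (Lam z (T h))"
      define \<Delta> where "\<Delta> = Lam (z + h) x - Lam z x"
      have lin: "linear (\<lambda>u. Lam z (S u))"
        by (intro bounded_linear.linear bounded_linear_compose[OF bounded_linear_Lam S])
      have "\<Delta> = - Lam z (S (mult_C0 A (Lam (z + h) x)))" by (simp add: \<Delta>_def A_def Lam_diff_eq)
      also have "mult_C0 A (Lam (z + h) x) = mult_C0 A \<Delta> + mult_C0 (A - D) (Lam z x) + mult_C0 D (Lam z x)"
        by (simp add: \<Delta>_def mult.diff_left mult.diff_right)
      finally have "\<Delta> + Lam z (S (mult_C0 D (Lam z x))) = - Lam z (S (mult_C0 A \<Delta>)) - Lam z (S (mult_C0 (A - D) (Lam z x)))"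
        by (simp add: linear_add[OF lin] algebra_simps)
      then have "norm (\<Delta> + Lam z (S (mult_C0 D (Lam z x)))) \<le> norm (Lam z (S (mult_C0 A \<Delta>))) + norm (Lam z (S (mult_C0 (A - D) (Lam z x))))"
        using norm_triangle_ineq4[of "- Lam z (S (mult_C0 A \<Delta>))" "Lam z (S (mult_C0 (A - D) (Lam z x)))"] by simp
      also have "norm (Lam z (S (mult_C0 A \<Delta>))) \<le> C * (B * norm h) * (C' * norm h * norm x)"
      proof (rule order_trans[OF C(2)])
        show "C * norm A * norm \<Delta> \<le> C * (B * norm h) * (C' * norm h * norm x)"
          using elim C(1) B(1) C'(1) unfolding A_def \<Delta>_def
          by (intro mult_mono mult_left_mono) auto
      qed
      also have "\<dots> \<le> e / 2 * norm h * norm x"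
      proof -
        have "2 * C * B * C' * norm h \<le> e" using elim(4) C(1) B(1) C'(1) by (simp add: field_simps)
        from mult_right_mono[OF this, of "norm h * norm x"] show ?thesis by (simp add: mult_ac)
      qed
      also have "norm (Lam z (S (mult_C0 (A - D) (Lam z x)))) \<le> C * (e1 * norm h) * (K * norm x)"
      proof (rule order_trans[OF C(2)])
        show "C * norm (A - D) * norm (Lam z x) \<le> C * (e1 * norm h) * (K * norm x)"
          using elim C(1) K e1 unfolding A_def D_def
          by (intro mult_mono mult_left_mono) (auto simp: numeral_2_eq_2)
      qed
      also have "\<dots> = e / 2 * norm h * norm x"
        using C(1) K(1) by (simp add: e1_def)
      finally show "norm (Lam (z + h) x - Lam z x + Lam z (S (mult_C0 (mult_C0 (a 2 (R z)) (Lam z (T h))) (Lam z x)))) \<le> e * norm h * norm x"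
        by (simp add: \<Delta>_def D_def)
    qed
  qed
qed

section \<open>Formal expressions for iterated derivatives\<close>

inductive derivative_class :: "nat set \<Rightarrow> ('y \<Rightarrow> (nat \<Rightarrow> 'y) \<Rightarrow> circle_C0) \<Rightarrow> bool" where
  zero: "finite I \<Longrightarrow> derivative_class I (\<lambda>z \<rho>. 0)"
| coeff: "derivative_class {} (\<lambda>z \<rho>. a j (R z))"
| var: "derivative_class {i} (\<lambda>z \<rho>. T (\<rho> i))"
| add: "derivative_class I G \<Longrightarrow> derivative_class I H \<Longrightarrow> derivative_class I (\<lambda>z \<rho>. G z \<rho> + H z \<rho>)"
| mult: "derivative_class I G \<Longrightarrow> derivative_class J H \<Longrightarrow> I \<inter> J = {} \<Longrightarrow>
    derivative_class (I \<union> J) (\<lambda>z \<rho>. mult_C0 (G z \<rho>) (H z \<rho>))"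
| Lam: "derivative_class I G \<Longrightarrow> derivative_class I (\<lambda>z \<rho>. Lam z (G z \<rho>))"
| minus_S: "derivative_class I G \<Longrightarrow> derivative_class I (\<lambda>z \<rho>. - S (G z \<rho>))"

lemma derivative_class_finite: "derivative_class I G \<Longrightarrow> finite I"
  by (induction rule: derivative_class.induct) auto

lemma derivative_class_cong:
  "derivative_class I G \<Longrightarrow> \<forall>i\<in>I. \<rho> i = \<rho>' i \<Longrightarrow> G z \<rho> = G z \<rho>'"
  by (induction arbitrary: z rule: derivative_class.induct) auto

lemma derivative_class_upd: "derivative_class I G \<Longrightarrow> n \<notin> I \<Longrightarrow> G z (\<rho>(n := h)) = G z \<rho>"
  by (erule derivative_class_cong) auto

lemma derivative_class_linear:
  "derivative_class I G \<Longrightarrow> i \<in> I \<Longrightarrow> linear (\<lambda>x. G z (\<rho>(i := x)))"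
proof (induction arbitrary: z rule: derivative_class.induct)
  case (var i)
  then show ?case using T.linear by (simp add: linear_iff)
next
  case (add I G H)
  then show ?case by (intro linear_compose_add) auto
next
  case (mult I G J H)
  show ?case
  proof (cases "i \<in> I")
    case True
    then have *: "H z (\<rho>(i := x)) = H z \<rho>" for x
      using derivative_class_upd[OF mult.hyps(2)] mult.hyps(3) by blast
    then show ?thesis
      using mult.IH(1)[OF True, of z] unfolding * linear_iff by (metis mult.add_left mult.scaleR_left)
  next
    case False
    then have *: "G z (\<rho>(i := x)) = G z \<rho>" for x
      using derivative_class_upd[OF mult.hyps(1)] by blast
    have "i \<in> J" using False mult.prems by blast
    then show ?thesis
      using mult.IH(2)[of z] unfolding * linear_iff by (metis mult.add_right mult.scaleR_right)
  qed
next
  case (Lam I G)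
  then show ?case
    using bounded_linear.linear[OF bounded_linear_Lam[of z]] by (simp add: linear_iff)
next
  case (minus_S I G)
  then show ?case by (simp add: linear_iff S.add S.scaleR)
qed (auto simp: linear_iff)

lemma derivative_class_bound:
  "derivative_class I G \<Longrightarrow> \<exists>K\<ge>0. \<forall>\<rho>. norm (G z \<rho>) \<le> K * (\<Prod>i\<in>I. norm (\<rho> i))"
proof (induction arbitrary: z rule: derivative_class.induct)
  case (zero I)
  then show ?case by (intro exI[of _ 0]) simp
next
  case (coeff j)
  show ?case by (intro exI[of _ "norm (a j (R z))"]) simp
next
  case (var i)
  show ?case using T.nonneg_bounded by (auto simp: mult.commute)
next
  case (add I G H)
  obtain K L where "K \<ge> 0" "\<And>\<rho>. norm (G z \<rho>) \<le> K * (\<Prod>i\<in>I. norm (\<rho> i))"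
    "L \<ge> 0" "\<And>\<rho>. norm (H z \<rho>) \<le> L * (\<Prod>i\<in>I. norm (\<rho> i))"
    using add.IH by meson
  then show ?case
    by (intro exI[of _ "K + L"]) (auto simp: distrib_right intro: order_trans[OF norm_triangle_ineq] add_mono)
next
  case (mult I G J H)
  obtain K L where KL: "K \<ge> 0" "\<And>\<rho>. norm (G z \<rho>) \<le> K * (\<Prod>i\<in>I. norm (\<rho> i))"
    "L \<ge> 0" "\<And>\<rho>. norm (H z \<rho>) \<le> L * (\<Prod>i\<in>J. norm (\<rho> i))"
    using mult.IH by meson
  have "norm (mult_C0 (G z \<rho>) (H z \<rho>)) \<le> K * L * (\<Prod>i\<in>I \<union> J. norm (\<rho> i))" for \<rho>
  proof -
    have "norm (mult_C0 (G z \<rho>) (H z \<rho>)) \<le> (K * (\<Prod>i\<in>I. norm (\<rho> i))) * (L * (\<Prod>i\<in>J. norm (\<rho> i)))"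
      by (rule order_trans[OF norm_mult_C0_le]) (use KL in \<open>auto intro!: mult_mono\<close>)
    then show ?thesis
      using mult.hyps by (simp add: prod.union_disjoint derivative_class_finite mult_ac)
  qed
  with KL show ?case by (intro exI[of _ "K * L"]) simp
next
  case (Lam I G)
  obtain K where K: "K \<ge> 0" "\<And>\<rho>. norm (G z \<rho>) \<le> K * (\<Prod>i\<in>I. norm (\<rho> i))"
    using Lam.IH by meson
  obtain L where L: "L > 0" "\<And>x. norm (Lam z x) \<le> L * norm x" using Lam_pos_bound by blast
  have "norm (Lam z (G z \<rho>)) \<le> L * K * (\<Prod>i\<in>I. norm (\<rho> i))" for \<rho>
    using order_trans[OF L(2) mult_left_mono[OF K(2)]] L(1) by (simp add: mult.assoc)
  with K L show ?case by (intro exI[of _ "L * K"]) simp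
next
  case (minus_S I G)
  obtain K where K: "K \<ge> 0" "\<And>\<rho>. norm (G z \<rho>) \<le> K * (\<Prod>i\<in>I. norm (\<rho> i))"
    using minus_S.IH by meson
  obtain L where L: "L \<ge> 0" "\<And>x. norm (S x) \<le> L * norm x" using S.nonneg_bounded by (auto simp: mult.commute)
  have "norm (- S (G z \<rho>)) \<le> L * K * (\<Prod>i\<in>I. norm (\<rho> i))" for \<rho>
    using order_trans[OF L(2) mult_left_mono[OF K(2)]] L(1) by (simp add: mult.assoc)
  with K L show ?case by (intro exI[of _ "L * K"]) simp
qed

text \<open>The new direction \<open>h\<close> is stored under the fresh label \<open>n\<close>, so
  the derivative is again a labelled form, with one argument more.\<close>

definition derivative_in :: "nat \<Rightarrow> nat set \<Rightarrow> ('y \<Rightarrow> (nat \<Rightarrow> 'y) \<Rightarrow> circle_C0) \<Rightarrow>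
    ('y \<Rightarrow> (nat \<Rightarrow> 'y) \<Rightarrow> circle_C0) \<Rightarrow> 'y \<Rightarrow> bool" where
  "derivative_in n I G G' z \<longleftrightarrow> small_family I (\<lambda>h \<rho>. G (z + h) \<rho> - G z \<rho> - G' z (\<rho>(n := h)))"

lemma derivative_class_big:
  assumes "derivative_class (insert n I) G'" "n \<notin> I"
  shows "big_family 1 I (\<lambda>h \<rho>. G' z (\<rho>(n := h)))"
proof -
  obtain K where K: "K \<ge> 0" "\<And>\<rho>. norm (G' z \<rho>) \<le> K * (\<Prod>i\<in>insert n I. norm (\<rho> i))"
    using derivative_class_bound[OF assms(1)] by meson
  have "finite I" using derivative_class_finite[OF assms(1)] by simp
  have "norm (G' z (\<rho>(n := h))) \<le> K * norm h ^ 1 * (\<Prod>i\<in>I. norm (\<rho> i))" for \<rho> h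
  proof -
    have "(\<Prod>i\<in>I. norm ((\<rho>(n := h)) i)) = (\<Prod>i\<in>I. norm (\<rho> i))"
      by (rule prod.cong) (use assms(2) in auto)
    then have "(\<Prod>i\<in>insert n I. norm ((\<rho>(n := h)) i)) = norm h * (\<Prod>i\<in>I. norm (\<rho> i))"
      using assms(2) \<open>finite I\<close> by simp
    then show ?thesis using K(2)[of "\<rho>(n := h)"] by (simp add: mult.assoc)
  qed
  with K(1) show ?thesis unfolding big_family_def by (intro exI[of _ K] conjI) auto
qed

lemma derivative_in_lipschitz:
  assumes "derivative_in n I G G' z" "derivative_class (insert n I) G'" "n \<notin> I"
  shows "big_family 1 I (\<lambda>h \<rho>. G (z + h) \<rho> - G z \<rho>)"
  by (rule big_family_diff[OF derivative_class_big[OF assms(2,3)]]) (use assms(1) in \<open>simp add: derivative_in_def\<close>)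

lemma derivative_class_big_const:
  assumes "derivative_class I G"
  shows "big_family 0 I (\<lambda>h \<rho>. G z \<rho>)"
  using derivative_class_bound[OF assms, of z] by (auto simp: big_family_def)

text \<open>Structural induction by the sum, product and resolvent rules. In the case of
  \<open>Lam\<close>, differentiating the operator yields \<open>Lam\<close> applied to
  \<open>- S\<close> of a product with \<open>a 2\<close> and two further \<open>Lam\<close>
  factors, which is why both \<open>Lam\<close> and \<open>minus_S\<close> are constructors.\<close>

lemma derivative_class_deriv:
  "derivative_class I G \<Longrightarrow> n \<notin> I \<Longrightarrow>
    \<exists>G'. derivative_class (insert n I) G' \<and> (\<forall>z. derivative_in n I G G' z)"
proof (induction rule: derivative_class.induct)
  case (zero I)
  then show ?case
    by (intro exI[of _ "\<lambda>z \<rho>. 0"]) (auto simp: derivative_in_def small_family_def intro: derivative_class.zero)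
next
  case (coeff j)
  have "derivative_class ({} \<union> {n}) (\<lambda>z \<rho>. mult_C0 (a (Suc j) (R z)) (Lam z (T (\<rho> n))))"
    by (intro derivative_class.intros) auto
  moreover have "derivative_in n {} (\<lambda>z \<rho>. a j (R z)) (\<lambda>z \<rho>. mult_C0 (a (Suc j) (R z)) (Lam z (T (\<rho> n)))) z" for z
    unfolding derivative_in_def small_family_def using eventually_coeff_diff[of _ j z] by simp
  ultimately show ?case by (intro exI[of _ "\<lambda>z \<rho>. mult_C0 (a (Suc j) (R z)) (Lam z (T (\<rho> n)))"]) simp
next
  case (var i)
  then show ?case
    by (intro exI[of _ "\<lambda>z \<rho>. 0"]) (auto simp: derivative_in_def small_family_def intro: derivative_class.zero)
next
  case (add I G H)
  then obtain G' H' where *: "derivative_class (insert n I) G'" "derivative_class (insert n I) H'"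
    "\<And>z. derivative_in n I G G' z" "\<And>z. derivative_in n I H H' z" by blast
  have "derivative_in n I (\<lambda>z \<rho>. G z \<rho> + H z \<rho>) (\<lambda>z \<rho>. G' z \<rho> + H' z \<rho>) z" for z
    using small_family_add[OF *(3)[of z, unfolded derivative_in_def] *(4)[of z, unfolded derivative_in_def]]
    unfolding derivative_in_def by (simp add: algebra_simps)
  with derivative_class.add[OF *(1,2)] show ?case by blast
next
  case (mult I G J H)
  then have n: "n \<notin> I" "n \<notin> J" by auto
  with mult.IH obtain G' H' where *: "derivative_class (insert n I) G'" "derivative_class (insert n J) H'"
    "\<And>z. derivative_in n I G G' z" "\<And>z. derivative_in n J H H' z" by blast
  note fin = derivative_class_finite[OF mult.hyps(1)] derivative_class_finite[OF mult.hyps(2)]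
  let ?D = "\<lambda>z \<rho>. mult_C0 (G' z \<rho>) (H z \<rho>) + mult_C0 (G z \<rho>) (H' z \<rho>)"
  have "derivative_class (insert n I \<union> J) (\<lambda>z \<rho>. mult_C0 (G' z \<rho>) (H z \<rho>))"
    "derivative_class (I \<union> insert n J) (\<lambda>z \<rho>. mult_C0 (G z \<rho>) (H' z \<rho>))"
    using mult.hyps n by (intro derivative_class.mult *; auto)+
  then have D: "derivative_class (insert n (I \<union> J)) ?D"
    by (intro derivative_class.add) simp_all
  have "derivative_in n (I \<union> J) (\<lambda>z \<rho>. mult_C0 (G z \<rho>) (H z \<rho>)) ?D z" for z
  proof -
    let ?dG = "\<lambda>h \<rho>. G (z + h) \<rho> - G z \<rho>" and ?dH = "\<lambda>h \<rho>. H (z + h) \<rho> - H z \<rho>"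
    let ?G' = "\<lambda>h \<rho>. G' z (\<rho>(n := h))" and ?H' = "\<lambda>h \<rho>. H' z (\<rho>(n := h))"
    \<comment> \<open>Leibniz rule: the product of the two increments is quadratic in
      \<open>h\<close>, and the other two terms carry the linearisation error of one factor
      each.\<close>
    have "small_family (I \<union> J) (\<lambda>h \<rho>. mult_C0 (?dG h \<rho>) (?dH h \<rho>))"
      using big_family_mult[OF derivative_in_lipschitz[OF *(3,1) n(1)] derivative_in_lipschitz[OF *(4,2) n(2)] fin mult.hyps(3)]
      by (intro small_family_big) (simp add: numeral_2_eq_2)
    moreover have "small_family (I \<union> J) (\<lambda>h \<rho>. mult_C0 (?dG h \<rho> - ?G' h \<rho>) (H z \<rho>))"
      by (intro small_family_mult fin mult.hyps derivative_class_big_const *(3)[unfolded derivative_in_def])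
    moreover have "small_family (J \<union> I) (\<lambda>h \<rho>. mult_C0 (?dH h \<rho> - ?H' h \<rho>) (G z \<rho>))"
      using mult.hyps(3)
      by (intro small_family_mult fin mult.hyps derivative_class_big_const *(4)[unfolded derivative_in_def]) auto
    ultimately have "small_family (I \<union> J) (\<lambda>h \<rho>. mult_C0 (?dG h \<rho>) (?dH h \<rho>)
        + mult_C0 (?dG h \<rho> - ?G' h \<rho>) (H z \<rho>) + mult_C0 (?dH h \<rho> - ?H' h \<rho>) (G z \<rho>))"
      by (intro small_family_add) (simp_all add: Un_commute)
    moreover have "mult_C0 (?dG h \<rho>) (?dH h \<rho>)
        + mult_C0 (?dG h \<rho> - ?G' h \<rho>) (H z \<rho>) + mult_C0 (?dH h \<rho> - ?H' h \<rho>) (G z \<rho>)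
        = mult_C0 (G (z + h) \<rho>) (H (z + h) \<rho>) - mult_C0 (G z \<rho>) (H z \<rho>) - ?D z (\<rho>(n := h))" for h \<rho>
      unfolding derivative_class_upd[OF mult.hyps(1) n(1)] derivative_class_upd[OF mult.hyps(2) n(2)]
      by (rule C0_eqI) (simp add: algebra_simps)
    ultimately show ?thesis unfolding derivative_in_def by simp
  qed
  with D show ?case by blast
next
  case (Lam I G)
  then obtain G' where *: "derivative_class (insert n I) G'" "\<And>z. derivative_in n I G G' z" by blast
  note n = Lam.prems
  let ?B = "\<lambda>z \<rho>. mult_C0 (mult_C0 (a 2 (R z)) (Lam z (T (\<rho> n)))) (Lam z (G z \<rho>))"
  let ?D = "\<lambda>z \<rho>. Lam z (G' z \<rho>) + Lam z (- S (?B z \<rho>))"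
  have "derivative_class (({} \<union> {n}) \<union> I) ?B"
    using n by (intro derivative_class.intros Lam.hyps) auto
  then have D: "derivative_class (insert n I) ?D"
    by (intro derivative_class.intros *) simp
  have "derivative_in n I (\<lambda>z \<rho>. Lam z (G z \<rho>)) ?D z" for z
  proof -
    let ?dG = "\<lambda>h \<rho>. G (z + h) \<rho> - G z \<rho>" and ?G' = "\<lambda>h \<rho>. G' z (\<rho>(n := h))"
    let ?dL = "\<lambda>h x. Lam (z + h) x - Lam z x"
    let ?E = "\<lambda>h x. ?dL h x + Lam z (S (mult_C0 (mult_C0 (a 2 (R z)) (Lam z (T h))) (Lam z x)))"
    obtain K where K: "K \<ge> 0" "\<And>\<rho>. norm (G z \<rho>) \<le> K * (\<Prod>i\<in>I. norm (\<rho> i))"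
      using derivative_class_bound[OF Lam.hyps] by meson
    obtain C where C: "C > 0" "eventually (\<lambda>h. \<forall>x. norm (?dL h x) \<le> C * norm h * norm x) (nhds 0)"
      using Lam_local_lipschitz by blast
    obtain L where L: "L > 0" "\<And>x. norm (Lam z x) \<le> L * norm x" using Lam_pos_bound by blast
    \<comment> \<open>The remainder splits into the linearisation error of the operator at a fixed
      argument, the joint change of operator and argument, which is quadratic in \<open>h\<close>,
      and the linearisation error of the argument.\<close>
    have s1: "small_family I (\<lambda>h \<rho>. ?E h (G z \<rho>))"
      by (rule small_family_apply[OF Lam_small_remainder K(2,1)])
    have s2: "small_family I (\<lambda>h \<rho>. ?dL h (?dG h \<rho>))"
      using big_family_comp[OF derivative_in_lipschitz[OF *(2,1) n], of ?dL C 1] C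
      by (intro small_family_big) (simp add: numeral_2_eq_2)
    have s3: "small_family I (\<lambda>h \<rho>. Lam z (?dG h \<rho> - ?G' h \<rho>))"
      by (intro small_family_comp[OF _ L(2)] *(2)[unfolded derivative_in_def])
    note small_family_add[OF small_family_add[OF s1 s2] s3]
    moreover have "?E h (G z \<rho>) + ?dL h (?dG h \<rho>) + Lam z (?dG h \<rho> - ?G' h \<rho>)
        = Lam (z + h) (G (z + h) \<rho>) - Lam z (G z \<rho>) - ?D z (\<rho>(n := h))" for h \<rho>
    proof -
      note lin = bounded_linear.linear[OF bounded_linear_Lam]
      show ?thesis
        unfolding derivative_class_upd[OF Lam.hyps n] fun_upd_same
        by (simp add: linear_diff[OF lin] linear_neg[OF lin] linear_add[OF lin] algebra_simps)
    qed
    ultimately show ?thesis unfolding derivative_in_def by simp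
  qed
  with D show ?case by blast
next
  case (minus_S I G)
  then obtain G' where *: "derivative_class (insert n I) G'" "\<And>z. derivative_in n I G G' z" by blast
  obtain L where L: "L \<ge> 0" "\<And>x. norm (S x) \<le> L * norm x" using S.nonneg_bounded by (auto simp: mult.commute)
  have "derivative_in n I (\<lambda>z \<rho>. - S (G z \<rho>)) (\<lambda>z \<rho>. - S (G' z \<rho>)) z" for z
    using small_family_comp[OF *(2)[of z, unfolded derivative_in_def], of "\<lambda>x. - S x" L] L
    unfolding derivative_in_def by (simp add: S.diff S.add algebra_simps)
  with derivative_class.minus_S[OF *(1)] show ?case by blast
qed

text \<open>The claim concerns \<open>a 0 (R z)\<close> rather than \<open>R\<close>, because the
  inverse map is obtained from it by a bounded linear map into the space of \<open>z\<close>, while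
  \<open>R\<close> takes values in C^0.\<close>

theorem smooth_coeff: "smooth (\<lambda>z. a 0 (R z))"
proof -
  \<comment> \<open>Dependent choice prescribes the first member of the sequence only through a
    property, hence the clause for \<open>k = 0\<close>.\<close>
  have "\<exists>G. \<forall>k. (derivative_class {..<k} (G k) \<and> (k = 0 \<longrightarrow> G k = (\<lambda>z \<rho>. a 0 (R z)))) \<and>
      (\<forall>z. derivative_in k {..<k} (G k) (G (Suc k)) z)"
  proof (rule dependent_nat_choice)
    show "\<exists>G. derivative_class {..<0} G \<and> (0 = 0 \<longrightarrow> G = (\<lambda>z \<rho>. a 0 (R z)))"
      using derivative_class.coeff by simp
  next
    fix G k
    assume "derivative_class {..<k} G \<and> (k = 0 \<longrightarrow> G = (\<lambda>z \<rho>. a 0 (R z)))"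
    then obtain G' where "derivative_class (insert k {..<k}) G'" "\<And>z. derivative_in k {..<k} G G' z"
      using derivative_class_deriv[of "{..<k}" G k] by auto
    then show "\<exists>G'. (derivative_class {..<Suc k} G' \<and> (Suc k = 0 \<longrightarrow> G' = (\<lambda>z \<rho>. a 0 (R z)))) \<and>
        (\<forall>z. derivative_in k {..<k} G G' z)"
      by (auto simp: lessThan_Suc)
  qed
  then obtain G where G: "\<And>k. derivative_class {..<k} (G k)" "G 0 = (\<lambda>z \<rho>. a 0 (R z))"
    "\<And>k z. derivative_in k {..<k} (G k) (G (Suc k)) z" by blast
  \<comment> \<open>\<open>smooth\<close> puts the newest direction at the head of the list, but
    here it carries the largest label; lists are therefore read backwards.\<close>
  define D where "D k z vs = G k z (nth (rev vs))" for k z vs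
  have prod_rev: "(\<Prod>i<k. norm (rev vs ! i)) = prod_list (map norm vs)" if "length vs = k" for k and vs :: "'y list"
  proof -
    have "prod_list (map norm vs) = prod_list (map norm (rev vs))"
      by (simp flip: prod_mset_prod_list)
    also have "\<dots> = (\<Prod>i<k. norm (rev vs ! i))"
      using that by (simp add: prod.list_conv_set_nth atLeast0LessThan)
    finally show ?thesis by simp
  qed
  show ?thesis
    unfolding smooth_def
  proof (rule exI[of _ D], intro conjI allI impI)
    fix z show "D 0 z [] = a 0 (R z)" by (simp add: D_def G(2))
  next
    fix k z
    obtain K where K: "\<And>\<rho>. norm (G k z \<rho>) \<le> K * (\<Prod>i<k. norm (\<rho> i))"
      using derivative_class_bound[OF G(1)] by meson
    show "bounded_multilinear k (D k z)"
      unfolding bounded_multilinear_def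
    proof (intro conjI allI impI exI[of _ K])
      fix vs :: "'y list" and i assume vs: "length vs = k" and i: "i < k"
      have "D k z (vs[i := x]) = G k z ((nth (rev vs))(k - 1 - i := x))" for x
        unfolding D_def using vs i
        by (intro derivative_class_cong[OF G(1)]) (auto simp: rev_update nth_list_update)
      moreover have "linear (\<lambda>x. G k z ((nth (rev vs))(k - 1 - i := x)))"
        by (rule derivative_class_linear[OF G(1)]) (use i in auto)
      ultimately show "linear (\<lambda>x. D k z (vs[i := x]))" by simp
    next
      fix vs :: "'y list" assume "length vs = k"
      then show "norm (D k z vs) \<le> K * prod_list (map norm vs)"
        using K[of "nth (rev vs)"] by (simp add: D_def prod_rev)
    qed
  next
    fix k z and e :: real assume "e > 0"
    from small_familyD[OF G(3)[of k z, unfolded derivative_in_def] this]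
    obtain d where d: "d > 0" "\<And>h \<rho>. norm h < d \<Longrightarrow>
        norm (G k (z + h) \<rho> - G k z \<rho> - G (Suc k) z (\<rho>(k := h))) \<le> e * norm h * (\<Prod>i<k. norm (\<rho> i))"
      unfolding eventually_nhds_metric by auto
    have "norm (D k (z + h) vs - D k z vs - D (Suc k) z (h # vs)) \<le> e * norm h * prod_list (map norm vs)"
      if "norm h < d" "length vs = k" for h vs
    proof -
      have "D (Suc k) z (h # vs) = G (Suc k) z ((nth (rev vs))(k := h))"
        unfolding D_def using that(2)
        by (intro derivative_class_cong[OF G(1)]) (auto simp: nth_append)
      then show ?thesis
        using d(2)[OF that(1), of "nth (rev vs)"] by (simp add: D_def prod_rev[OF that(2)])
    qed
    with d(1) show "\<exists>d>0. \<forall>h. norm h < d \<longrightarrow> (\<forall>vs. length vs = k \<longrightarrow>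
        norm (D k (z + h) vs - D k z vs - D (Suc k) z (h # vs)) \<le> e * norm h * prod_list (map norm vs))"
      by blast
  qed
qed

end

section \<open>Superposition operators\<close>

text \<open>Only the state variable is ever differentiated, so the \<open>j\<close>-th Frechet
  derivative is evaluated at \<open>j\<close> copies of the direction \<open>(0, 1)\<close>.
  Periodicity passes on by uniqueness of derivatives.\<close>

lemma smooth_partial_derivatives:
  fixes f :: "real \<Rightarrow> real \<Rightarrow> real"
  assumes "smooth (\<lambda>(t, s). f t s)" and per: "periodic f"
  obtains p where "p 0 = f" "\<And>j. continuous_on UNIV (\<lambda>(t, s). p j t s)" "\<And>j. periodic (p j)"
    "\<And>j t s. (p j t has_real_derivative p (Suc j) t s) (at s)"
proof -
  obtain D :: "nat \<Rightarrow> real \<times> real \<Rightarrow> (real \<times> real) list \<Rightarrow> real"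
    where D0: "\<And>x. D 0 x [] = (case x of (t, s) \<Rightarrow> f t s)"
    and ml: "\<And>k x. bounded_multilinear k (D k x)"
    and fr: "\<And>k x e. e > 0 \<Longrightarrow> \<exists>d>0. \<forall>h. norm h < d \<longrightarrow> (\<forall>vs. length vs = k \<longrightarrow>
           norm (D k (x + h) vs - D k x vs - D (Suc k) x (h # vs))
             \<le> e * norm h * prod_list (map norm vs))"
    using assms(1) unfolding smooth_def by blast
  have lin: "linear (\<lambda>h. D (Suc k) x (h # vs))" if "length vs = k" for k x vs
  proof -
    have "linear (\<lambda>h. D (Suc k) x ((0 # vs)[0 := h]))"
      using ml[of "Suc k" x] that unfolding bounded_multilinear_def by (metis length_Cons zero_less_Suc)
    then show ?thesis by simp
  qed
  have der: "((\<lambda>x. D k x vs) has_derivative (\<lambda>h. D (Suc k) x (h # vs))) (at x)" if vs: "length vs = k" for k x vs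
    unfolding has_derivative_at_alt
  proof (intro conjI allI impI)
    show "bounded_linear (\<lambda>h. D (Suc k) x (h # vs))"
      using lin[OF vs] linear_conv_bounded_linear by blast
    define P where "P = prod_list (map norm vs)"
    have P: "P \<ge> 0" unfolding P_def by (induction vs) auto
    fix e :: real assume "e > 0"
    then have "e / (P + 1) > 0" using P by simp
    from fr[OF this, of k x] obtain d where d: "d > 0" "\<And>h. norm h < d \<Longrightarrow>
        norm (D k (x + h) vs - D k x vs - D (Suc k) x (h # vs)) \<le> e / (P + 1) * norm h * P"
      using vs unfolding P_def by blast
    have "norm (D k y vs - D k x vs - D (Suc k) x ((y - x) # vs)) \<le> e * norm (y - x)" if "norm (y - x) < d" for y
    proof -
      have "e / (P + 1) * P \<le> e" using \<open>e > 0\<close> P by (simp add: field_simps)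
      from mult_right_mono[OF this norm_ge_zero[of "y - x"]] d(2)[OF that]
      show ?thesis by (simp add: mult_ac)
    qed
    with d(1) show "\<exists>d>0. \<forall>y. norm (y - x) < d \<longrightarrow>
        norm (D k y vs - D k x vs - D (Suc k) x ((y - x) # vs)) \<le> e * norm (y - x)" by blast
  qed
  define p where "p j t s = D j (t, s) (replicate j (0, 1))" for j t s
  have p0: "p 0 = f" by (intro ext) (simp add: p_def D0)
  have cont: "continuous_on UNIV (\<lambda>(t, s). p j t s)" for j
  proof -
    have "continuous_on UNIV (\<lambda>x. D j x (replicate j (0, 1)))"
      using der[of "replicate j (0, 1)" j] has_derivative_continuous continuous_at_imp_continuous_on
      by (metis length_replicate)
    then show ?thesis by (simp add: p_def case_prod_unfold)
  qed
  have dp: "(p j t has_real_derivative p (Suc j) t s) (at s)" for j t s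
  proof -
    let ?v = "replicate j (0, 1 :: real)"
    have "((\<lambda>s. (t, s)) has_derivative (\<lambda>h. (0, h))) (at s)"
      by (auto intro!: derivative_eq_intros)
    from has_derivative_compose[OF this der[of ?v j "(t, s)"]]
    have "(p j t has_derivative (\<lambda>h. D (Suc j) (t, s) ((0, h) # ?v))) (at s)"
      by (simp add: p_def[abs_def])
    moreover have "D (Suc j) (t, s) ((0, h) # ?v) = p (Suc j) t s * h" for h
      using linear_cmul[OF lin[of ?v j "(t, s)"], of h "(0, 1)"] by (simp add: p_def)
    ultimately show ?thesis by (simp add: has_field_derivative_def)
  qed
  have "periodic (p j)" for j
  proof (induction j)
    case 0
    then show ?case using per by (simp add: p0)
  next
    case (Suc j)
    have "p (Suc j) (t + 1) s = p (Suc j) t s" for t s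
      using dp[of j "t + 1" s] dp[of j t s] Suc by (auto simp: periodic_def dest: DERIV_unique)
    then show ?case by (simp add: periodic_def fun_eq_iff)
  qed
  with that p0 cont dp show thesis by blast
qed

text \<open>The Nemytskii operator, called N in the overview. In the H case it will act on
  continuous representatives.\<close>

definition superposition :: "(real \<Rightarrow> real \<Rightarrow> real) \<Rightarrow> circle_C0 \<Rightarrow> circle_C0" where
  "superposition f u = mk_C0 (\<lambda>t. f t (eval_C0 u t))"

lemma continuous_on_superposition:
  assumes "continuous_on UNIV (\<lambda>(t, s). f t s)" "continuous_on A v"
  shows "continuous_on A (\<lambda>t. f t (v t))"
proof -
  have "continuous_on A (\<lambda>t. (t, v t))" by (intro continuous_intros assms(2))
  from continuous_on_compose2[OF assms(1) this] show ?thesis by simp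
qed

lemma eval_superposition:
  assumes "continuous_on UNIV (\<lambda>(t, s). f t s)" "periodic f"
  shows "eval_C0 (superposition f u) t = f t (eval_C0 u t)"
proof -
  have "periodic (\<lambda>t. f t (eval_C0 u t))"
    using assms(2) periodic_eval_C0 by (simp add: periodic_def)
  moreover have "continuous_on UNIV (\<lambda>t. f t (eval_C0 u t))"
    by (rule continuous_on_superposition[OF assms(1) continuous_on_eval_C0])
  ultimately show ?thesis unfolding superposition_def by (simp add: eval_mk_C0)
qed

lemma periodic_bounded_on_strip:
  fixes g :: "real \<Rightarrow> real \<Rightarrow> real"
  assumes "continuous_on UNIV (\<lambda>(t, s). g t s)" "periodic g"
  obtains B where "B \<ge> 0" "\<And>t s. \<bar>s\<bar> \<le> r \<Longrightarrow> \<bar>g t s\<bar> \<le> B"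
proof -
  have "compact ((\<lambda>(t, s). g t s) ` ({0..1} \<times> {-r..r}))"
    by (intro compact_continuous_image compact_Times compact_Icc continuous_on_subset[OF assms(1)]) simp
  then obtain B where B: "\<And>x. x \<in> (\<lambda>(t, s). g t s) ` ({0..1} \<times> {-r..r}) \<Longrightarrow> norm x \<le> B"
    by (meson compact_imp_bounded bounded_iff)
  have "\<bar>g t s\<bar> \<le> max B 0" if "\<bar>s\<bar> \<le> r" for t s
  proof -
    have "(frac t, s) \<in> {0..1} \<times> {-r..r}"
      using that frac_lt_1[of t] by (auto simp: less_imp_le)
    then have "norm (case (frac t, s) of (t, s) \<Rightarrow> g t s) \<le> B" by (intro B imageI)
    then show ?thesis using periodic_frac[OF assms(2), of t] by simp
  qed
  then show thesis by (intro that[of "max B 0"]) auto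
qed

text \<open>The two points share \<open>t\<close>, so both can be moved by the same integer into a
  compact strip. The modulus of continuity is then independent of \<open>t\<close>.\<close>

lemma periodic_uniformly_continuous_on_strip:
  fixes g :: "real \<Rightarrow> real \<Rightarrow> real"
  assumes "continuous_on UNIV (\<lambda>(t, s). g t s)" "periodic g" "e > 0"
  obtains d where "d > 0" "\<And>t s s'. \<bar>s\<bar> \<le> r \<Longrightarrow> \<bar>s'\<bar> \<le> r \<Longrightarrow> \<bar>s - s'\<bar> < d \<Longrightarrow> \<bar>g t s - g t s'\<bar> < e"
proof -
  have "uniformly_continuous_on ({0..1} \<times> {-r..r}) (\<lambda>(t, s). g t s)"
    by (intro compact_uniformly_continuous compact_Times compact_Icc continuous_on_subset[OF assms(1)]) simp
  then obtain d where d: "d > 0" "\<And>x y. x \<in> {0..1} \<times> {-r..r} \<Longrightarrow> y \<in> {0..1} \<times> {-r..r} \<Longrightarrow> dist y x < d \<Longrightarrow>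
      dist (case y of (t, s) \<Rightarrow> g t s) (case x of (t, s) \<Rightarrow> g t s) < e"
    using assms(3) unfolding uniformly_continuous_on_def by metis
  have "\<bar>g t s - g t s'\<bar> < e" if "\<bar>s\<bar> \<le> r" "\<bar>s'\<bar> \<le> r" "\<bar>s - s'\<bar> < d" for t s s'
  proof -
    have "0 \<le> frac t" "frac t \<le> 1" using frac_lt_1[of t] by (auto simp: less_imp_le)
    then have "dist (g (frac t) s) (g (frac t) s') < e"
      using d(2)[of "(frac t, s')" "(frac t, s)"] that by (simp add: dist_Pair_Pair dist_real_def abs_le_iff)
    then show ?thesis using periodic_frac[OF assms(2)] by (simp add: dist_real_def)
  qed
  with d(1) that show thesis by blast
qed

text \<open>At each \<open>t\<close> the mean value inequality is applied to
  \<open>g t s - g' t s0 * s\<close>, whose derivative is small near \<open>s0\<close> uniformly in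
  \<open>t\<close>. The strip of radius \<open>norm u + 1\<close> contains all values of any
  \<open>v\<close> within distance 1 of \<open>u\<close>.\<close>

lemma has_derivative_superposition:
  assumes cont: "continuous_on UNIV (\<lambda>(t, s). g t s)" "continuous_on UNIV (\<lambda>(t, s). g' t s)"
    and per: "periodic g" "periodic g'"
    and der: "\<And>t s. (g t has_real_derivative g' t s) (at s)"
  shows "(superposition g has_derivative mult_C0 (superposition g' u)) (at u)"
  unfolding has_derivative_at_alt
proof (intro conjI allI impI)
  show "bounded_linear (mult_C0 (superposition g' u))"
    by (rule bounded_bilinear.bounded_linear_right[OF bounded_bilinear_mult_C0])
  fix e :: real assume e: "e > 0"
  obtain d where d: "d > 0" "\<And>t s s'. \<bar>s\<bar> \<le> norm u + 1 \<Longrightarrow> \<bar>s'\<bar> \<le> norm u + 1 \<Longrightarrow> \<bar>s - s'\<bar> < d \<Longrightarrow> \<bar>g' t s - g' t s'\<bar> < e"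
    using periodic_uniformly_continuous_on_strip[OF cont(2) per(2) e, of "norm u + 1"] by blast
  have "norm (superposition g v - superposition g u - mult_C0 (superposition g' u) (v - u)) \<le> e * norm (v - u)"
    if v: "norm (v - u) < min d 1" for v
  proof (rule norm_C0_le)
    fix t
    define s0 s1 where "s0 = eval_C0 u t" and "s1 = eval_C0 v t"
    have s: "\<bar>s0\<bar> \<le> norm u" "\<bar>s1 - s0\<bar> \<le> norm (v - u)"
      using abs_eval_C0_le_norm[of u t] abs_eval_C0_le_norm[of "v - u" t] by (simp_all add: s0_def s1_def)
    have "norm ((g t s1 - g' t s0 * s1) - (g t s0 - g' t s0 * s0)) \<le> e * norm (s1 - s0)"
    proof (rule field_differentiable_bound[of "closed_segment s0 s1" _ "\<lambda>s. g' t s - g' t s0"])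
      fix s assume "s \<in> closed_segment s0 s1"
      then have "\<bar>s - s0\<bar> \<le> \<bar>s1 - s0\<bar>"
        using segment_bound(1)[of s s0 s1] by (simp add: abs_minus_commute)
      then have "\<bar>s - s0\<bar> < d" "\<bar>s\<bar> \<le> norm u + 1" "\<bar>s0\<bar> \<le> norm u + 1"
        using s v by linarith+
      then show "norm (g' t s - g' t s0) \<le> e" using d(2)[of s s0 t] by simp
      show "((\<lambda>s. g t s - g' t s0 * s) has_real_derivative g' t s - g' t s0) (at s within closed_segment s0 s1)"
        by (rule has_field_derivative_at_within) (auto intro!: derivative_eq_intros der)
    qed auto
    also have "\<dots> \<le> e * norm (v - u)" using s(2) e by simp
    finally show "\<bar>eval_C0 (superposition g v - superposition g u - mult_C0 (superposition g' u) (v - u)) t\<bar> \<le> e * norm (v - u)"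
      by (simp add: eval_superposition[OF cont(1) per(1)] eval_superposition[OF cont(2) per(2)] algebra_simps
          flip: s0_def s1_def)
  qed
  with d(1) show "\<exists>d>0. \<forall>v. norm (v - u) < d \<longrightarrow>
      norm (superposition g v - superposition g u - mult_C0 (superposition g' u) (v - u)) \<le> e * norm (v - u)"
    by (intro exI[of _ "min d 1"]) auto
qed

lemma periodic_lipschitz_on_strip:
  fixes g g' :: "real \<Rightarrow> real \<Rightarrow> real"
  assumes "continuous_on UNIV (\<lambda>(t, s). g' t s)" "periodic g'"
    and der: "\<And>t s. (g t has_real_derivative g' t s) (at s)"
  obtains L where "L \<ge> 0" "\<And>t s s'. \<bar>s\<bar> \<le> r \<Longrightarrow> \<bar>s'\<bar> \<le> r \<Longrightarrow> \<bar>g t s - g t s'\<bar> \<le> L * \<bar>s - s'\<bar>"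
proof -
  obtain L where L: "L \<ge> 0" "\<And>t s. \<bar>s\<bar> \<le> r \<Longrightarrow> \<bar>g' t s\<bar> \<le> L"
    using periodic_bounded_on_strip[OF assms(1,2), of r] by blast
  have "\<bar>g t s - g t s'\<bar> \<le> L * \<bar>s - s'\<bar>" if "\<bar>s\<bar> \<le> r" "\<bar>s'\<bar> \<le> r" for t s s'
  proof -
    have "norm (g t s - g t s') \<le> L * norm (s - s')"
      by (rule field_differentiable_bound[of "{-r..r}" _ "g' t"])
        (use that L(2) in \<open>auto intro!: has_field_derivative_at_within der\<close>)
    then show ?thesis by simp
  qed
  with L(1) that show thesis by blast
qed

section \<open>Truncation\<close>

definition clamp_to :: "real \<Rightarrow> real \<Rightarrow> real" where
  "clamp_to r s = max (- r) (min r s)"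

lemma clamp_to_eq: "\<bar>s\<bar> \<le> r \<Longrightarrow> clamp_to r s = s"
  unfolding clamp_to_def abs_le_iff by (simp add: max_absorb2 min_absorb2)

lemma abs_clamp_to_le: "r \<ge> 0 \<Longrightarrow> \<bar>clamp_to r s\<bar> \<le> r"
  unfolding clamp_to_def abs_le_iff by (simp add: max_def min_def)

lemma clamp_to_lipschitz: "\<bar>clamp_to r s - clamp_to r s'\<bar> \<le> \<bar>s - s'\<bar>"
  unfolding clamp_to_def by (simp add: max_def min_def abs_if)

lemma continuous_on_clamp_to: "continuous_on A h \<Longrightarrow> continuous_on A (\<lambda>x. clamp_to r (h x))"
  unfolding clamp_to_def by (rule continuous_on_max[OF continuous_on_const continuous_on_min[OF continuous_on_const]])

section \<open>Smooth maps and linear isomorphisms\<close>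

lemma smooth_add:
  assumes "smooth f" "smooth g"
  shows "smooth (\<lambda>x. f x + g x)"
proof -
  obtain D where D: "\<And>x. D 0 x [] = f x" "\<And>k x. bounded_multilinear k (D k x)"
    "\<And>k x e. e > 0 \<Longrightarrow> \<exists>d>0. \<forall>h. norm h < d \<longrightarrow> (\<forall>vs. length vs = k \<longrightarrow>
      norm (D k (x + h) vs - D k x vs - D (Suc k) x (h # vs)) \<le> e * norm h * prod_list (map norm vs))"
    using assms(1) unfolding smooth_def by blast
  obtain E where E: "\<And>x. E 0 x [] = g x" "\<And>k x. bounded_multilinear k (E k x)"
    "\<And>k x e. e > 0 \<Longrightarrow> \<exists>d>0. \<forall>h. norm h < d \<longrightarrow> (\<forall>vs. length vs = k \<longrightarrow>
      norm (E k (x + h) vs - E k x vs - E (Suc k) x (h # vs)) \<le> e * norm h * prod_list (map norm vs))"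
    using assms(2) unfolding smooth_def by blast
  show ?thesis
    unfolding smooth_def
  proof (rule exI[of _ "\<lambda>k x vs. D k x vs + E k x vs"], intro conjI allI impI)
    fix x show "D 0 x [] + E 0 x [] = f x + g x" by (simp add: D(1) E(1))
  next
    fix k x
    obtain K L where "\<And>vs. length vs = k \<Longrightarrow> norm (D k x vs) \<le> K * prod_list (map norm vs)"
      "\<And>vs. length vs = k \<Longrightarrow> norm (E k x vs) \<le> L * prod_list (map norm vs)"
      using D(2)[of k x] E(2)[of k x] unfolding bounded_multilinear_def by blast
    then have "norm (D k x vs + E k x vs) \<le> (K + L) * prod_list (map norm vs)" if "length vs = k" for vs
      using that by (simp add: distrib_right order_trans[OF norm_triangle_ineq add_mono])
    moreover have "linear (\<lambda>y. D k x (vs[i := y]) + E k x (vs[i := y]))" if "length vs = k" "i < k" for vs i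
      using D(2)[of k x] E(2)[of k x] that unfolding bounded_multilinear_def by (intro linear_compose_add) blast+
    ultimately show "bounded_multilinear k (\<lambda>vs. D k x vs + E k x vs)"
      unfolding bounded_multilinear_def by blast
  next
    fix k x and e :: real assume "e > 0"
    then have "e/2 > 0" by simp
    from D(3)[OF this, of k x] E(3)[OF this, of k x] obtain d d' where
      d: "d > 0" "\<And>h vs. norm h < d \<Longrightarrow> length vs = k \<Longrightarrow>
        norm (D k (x + h) vs - D k x vs - D (Suc k) x (h # vs)) \<le> e/2 * norm h * prod_list (map norm vs)" and
      d': "d' > 0" "\<And>h vs. norm h < d' \<Longrightarrow> length vs = k \<Longrightarrow>
        norm (E k (x + h) vs - E k x vs - E (Suc k) x (h # vs)) \<le> e/2 * norm h * prod_list (map norm vs)"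
      by metis
    have "norm (D k (x + h) vs + E k (x + h) vs - (D k x vs + E k x vs) - (D (Suc k) x (h # vs) + E (Suc k) x (h # vs)))
        \<le> e * norm h * prod_list (map norm vs)" if "norm h < min d d'" "length vs = k" for h vs
    proof -
      have "norm ((D k (x + h) vs - D k x vs - D (Suc k) x (h # vs)) + (E k (x + h) vs - E k x vs - E (Suc k) x (h # vs)))
          \<le> e/2 * norm h * prod_list (map norm vs) + e/2 * norm h * prod_list (map norm vs)"
        using that by (intro norm_triangle_le add_mono d(2) d'(2)) auto
      then show ?thesis by (simp add: algebra_simps)
    qed
    then show "\<exists>d>0. \<forall>h. norm h < d \<longrightarrow> (\<forall>vs. length vs = k \<longrightarrow>
        norm (D k (x + h) vs + E k (x + h) vs - (D k x vs + E k x vs) - (D (Suc k) x (h # vs) + E (Suc k) x (h # vs)))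
        \<le> e * norm h * prod_list (map norm vs))"
      using d(1) d'(1) by (intro exI[of _ "min d d'"]) auto
  qed
qed

lemma prod_list_norm_nonneg [simp]:
  "0 \<le> prod_list (map norm vs)" "0 \<le> prod_list (map (norm \<circ> g) vs)"
  by (induction vs) auto

lemma smooth_bounded_linear:
  assumes "bounded_linear A"
  shows "smooth A"
proof -
  interpret A: bounded_linear A by (rule assms)
  obtain K where K: "\<And>x. norm (A x) \<le> K * norm x" using A.bounded by (auto simp: mult.commute)
  define D where "D k x vs = (if k = 0 then A x else if k = 1 then A (vs ! 0) else 0)" for k :: nat and x and vs :: "'a list"
  have "bounded_multilinear k (D k x)" for k x
    unfolding bounded_multilinear_def
  proof (intro conjI exI[of _ "if k = 0 then norm (A x) else if k = 1 then K else 0"] allI impI)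
    fix vs :: "'a list" and i assume "length vs = k" "i < k"
    then show "linear (\<lambda>y. D k x (vs[i := y]))"
      using A.linear by (cases "k = 1") (auto simp: D_def linear_iff)
  next
    fix vs :: "'a list" assume vs: "length vs = k"
    show "norm (D k x vs) \<le> (if k = 0 then norm (A x) else if k = 1 then K else 0) * prod_list (map norm vs)"
    proof (cases "k = 1")
      case True
      with vs obtain v where "vs = [v]" by (auto simp: length_Suc_conv)
      with True K[of v] show ?thesis by (simp add: D_def)
    qed (use vs in \<open>auto simp: D_def\<close>)
  qed
  moreover have "D k (x + h) vs - D k x vs - D (Suc k) x (h # vs) = 0" for k x h vs
    by (simp add: D_def A.add)
  ultimately show ?thesis
    unfolding smooth_def by (intro exI[of _ D]) (auto simp: D_def intro!: exI[of _ "1::real"])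
qed

lemma smooth_compose_bounded_linear_left:
  assumes A: "bounded_linear A" and "smooth f"
  shows "smooth (\<lambda>x. A (f x))"
proof -
  interpret A: bounded_linear A by (rule A)
  obtain D where D: "\<And>x. D 0 x [] = f x" "\<And>k x. bounded_multilinear k (D k x)"
    "\<And>k x e. e > 0 \<Longrightarrow> \<exists>d>0. \<forall>h. norm h < d \<longrightarrow> (\<forall>vs. length vs = k \<longrightarrow>
      norm (D k (x + h) vs - D k x vs - D (Suc k) x (h # vs)) \<le> e * norm h * prod_list (map norm vs))"
    using assms(2) unfolding smooth_def by blast
  obtain K where K: "K > 0" "\<And>x. norm (A x) \<le> K * norm x" using A.pos_bounded by (auto simp: mult.commute)
  show ?thesis
    unfolding smooth_def
  proof (rule exI[of _ "\<lambda>k x vs. A (D k x vs)"], intro conjI allI impI)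
    fix x show "A (D 0 x []) = A (f x)" by (simp add: D(1))
  next
    fix k x
    obtain L where L: "\<And>vs. length vs = k \<Longrightarrow> norm (D k x vs) \<le> L * prod_list (map norm vs)"
      using D(2)[of k x] unfolding bounded_multilinear_def by blast
    have "norm (A (D k x vs)) \<le> K * L * prod_list (map norm vs)" if "length vs = k" for vs
      using order_trans[OF K(2) mult_left_mono[OF L[OF that]]] K(1) by (simp add: mult.assoc)
    moreover have "linear (\<lambda>y. A (D k x (vs[i := y])))" if "length vs = k" "i < k" for vs i
      using D(2)[of k x] that linear_compose[OF _ A.linear] unfolding bounded_multilinear_def o_def by blast
    ultimately show "bounded_multilinear k (\<lambda>vs. A (D k x vs))"
      unfolding bounded_multilinear_def by blast
  next
    fix k x and e :: real assume "e > 0"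
    then have "e/K > 0" using K by simp
    from D(3)[OF this, of k x] obtain d where
      d: "d > 0" "\<And>h vs. norm h < d \<Longrightarrow> length vs = k \<Longrightarrow>
        norm (D k (x + h) vs - D k x vs - D (Suc k) x (h # vs)) \<le> e/K * norm h * prod_list (map norm vs)"
      by metis
    have "norm (A (D k (x + h) vs) - A (D k x vs) - A (D (Suc k) x (h # vs)))
        \<le> e * norm h * prod_list (map norm vs)" if "norm h < d" "length vs = k" for h vs
      using order_trans[OF K(2) mult_left_mono[OF d(2)[OF that]]] K(1) by (simp add: A.diff)
    with d(1) show "\<exists>d>0. \<forall>h. norm h < d \<longrightarrow> (\<forall>vs. length vs = k \<longrightarrow>
        norm (A (D k (x + h) vs) - A (D k x vs) - A (D (Suc k) x (h # vs))) \<le> e * norm h * prod_list (map norm vs))"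
      by blast
  qed
qed

lemma smooth_compose_bounded_linear_right:
  assumes A: "bounded_linear A" and "smooth f"
  shows "smooth (\<lambda>x. f (A x))"
proof -
  interpret A: bounded_linear A by (rule A)
  obtain D where D: "\<And>x. D 0 x [] = f x" "\<And>k x. bounded_multilinear k (D k x)"
    "\<And>k x e. e > 0 \<Longrightarrow> \<exists>d>0. \<forall>h. norm h < d \<longrightarrow> (\<forall>vs. length vs = k \<longrightarrow>
      norm (D k (x + h) vs - D k x vs - D (Suc k) x (h # vs)) \<le> e * norm h * prod_list (map norm vs))"
    using assms(2) unfolding smooth_def by blast
  obtain K where K: "K > 0" "\<And>x. norm (A x) \<le> K * norm x" using A.pos_bounded by (auto simp: mult.commute)
  have P: "prod_list (map norm (map A vs)) \<le> K ^ length vs * prod_list (map norm vs)" for vs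
  proof (induction vs)
    case (Cons v vs)
    have "norm (A v) * prod_list (map norm (map A vs)) \<le> (K * norm v) * (K ^ length vs * prod_list (map norm vs))"
      using K Cons by (intro mult_mono) auto
    then show ?case by (simp add: mult_ac)
  qed simp
  show ?thesis
    unfolding smooth_def
  proof (rule exI[of _ "\<lambda>k x vs. D k (A x) (map A vs)"], intro conjI allI impI)
    fix x show "D 0 (A x) (map A []) = f (A x)" by (simp add: D(1))
  next
    fix k x
    obtain L where L: "\<And>vs. length vs = k \<Longrightarrow> norm (D k (A x) vs) \<le> L * prod_list (map norm vs)"
      using D(2)[of k "A x"] unfolding bounded_multilinear_def by blast
    have "norm (D k (A x) (map A vs)) \<le> \<bar>L\<bar> * K ^ k * prod_list (map norm vs)" if "length vs = k" for vs
    proof -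
      have "norm (D k (A x) (map A vs)) \<le> L * prod_list (map norm (map A vs))" using L[of "map A vs"] that by simp
      also have "\<dots> \<le> \<bar>L\<bar> * prod_list (map norm (map A vs))" by (intro mult_right_mono) auto
      also have "\<dots> \<le> \<bar>L\<bar> * (K ^ k * prod_list (map norm vs))" using P[of vs] that by (intro mult_left_mono) auto
      finally show ?thesis by (simp add: mult.assoc)
    qed
    moreover have "linear (\<lambda>y. D k (A x) (map A (vs[i := y])))" if "length vs = k" "i < k" for vs i
    proof -
      have "linear (\<lambda>y. D k (A x) ((map A vs)[i := y]))"
        using D(2)[of k "A x"] that unfolding bounded_multilinear_def by (metis length_map)
      from linear_compose[OF A.linear this] show ?thesis by (simp add: o_def map_update)
    qed
    ultimately show "bounded_multilinear k (\<lambda>vs. D k (A x) (map A vs))"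
      unfolding bounded_multilinear_def by blast
  next
    fix k x and e :: real assume e: "e > 0"
    \<comment> \<open>One factor \<open>K\<close> is spent on the increment and one on each of the
      \<open>k\<close> arguments.\<close>
    then have "e / (K * K ^ k) > 0" using K by simp
    from D(3)[OF this, of k "A x"] obtain d where
      d: "d > 0" "\<And>h vs. norm h < d \<Longrightarrow> length vs = k \<Longrightarrow>
        norm (D k (A x + h) vs - D k (A x) vs - D (Suc k) (A x) (h # vs)) \<le> e / (K * K ^ k) * norm h * prod_list (map norm vs)"
      by metis
    have "norm (D k (A (x + h)) (map A vs) - D k (A x) (map A vs) - D (Suc k) (A x) (map A (h # vs)))
        \<le> e * norm h * prod_list (map norm vs)" if "norm h < d / K" "length vs = k" for h vs
    proof -
      have "norm (A h) < d" using K(2)[of h] that(1) K(1) by (simp add: field_simps)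
      then have "norm (D k (A (x + h)) (map A vs) - D k (A x) (map A vs) - D (Suc k) (A x) (map A (h # vs)))
          \<le> e / (K * K ^ k) * norm (A h) * prod_list (map norm (map A vs))"
        using d(2)[of "A h" "map A vs"] that(2) by (simp add: A.add)
      also have "\<dots> \<le> e / (K * K ^ k) * (K * norm h) * (K ^ k * prod_list (map norm vs))"
        using K e P[of vs] that(2) by (intro mult_mono mult_left_mono) auto
      also have "\<dots> = e * norm h * prod_list (map norm vs)" using K(1) by simp
      finally show ?thesis .
    qed
    then show "\<exists>d>0. \<forall>h. norm h < d \<longrightarrow> (\<forall>vs. length vs = k \<longrightarrow>
        norm (D k (A (x + h)) (map A vs) - D k (A x) (map A vs) - D (Suc k) (A x) (map A (h # vs)))
        \<le> e * norm h * prod_list (map norm vs))"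
      using d(1) K(1) by (intro exI[of _ "d / K"]) auto
  qed
qed

lemma diffeomorphism_compose_linear:
  assumes "diffeomorphism \<Phi>" and A: "bounded_linear A" and B: "bounded_linear B"
    and AB: "\<And>y. A (B y) = y" "\<And>x. B (A x) = x"
  shows "diffeomorphism (\<lambda>x. \<Phi> (A x))"
proof -
  have \<Phi>: "bij \<Phi>" "smooth \<Phi>" "smooth (inv \<Phi>)" using assms(1) by (auto simp: diffeomorphism_def)
  have "bij A" using AB by (intro o_bij[of B]) auto
  then have "bij (\<lambda>x. \<Phi> (A x))" using bij_comp[OF _ \<Phi>(1)] by (simp add: o_def)
  moreover have "inv (\<lambda>x. \<Phi> (A x)) = (\<lambda>y. B (inv \<Phi> y))"
    using \<Phi>(1) AB by (intro inv_equality) (auto simp: bij_is_surj surj_f_inv_f bij_is_inj)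
  ultimately show ?thesis
    unfolding diffeomorphism_def
    using smooth_compose_bounded_linear_right[OF A \<Phi>(2)] smooth_compose_bounded_linear_left[OF B \<Phi>(3)] by simp
qed

text \<open>Multiplication by \<open>b\<close> is pointwise Lipschitz with constant
  \<open>norm b\<close>, so the nonlinear theory applies; comparison with the zero solution gives
  the operator bound. The resulting \<open>L\<close> becomes the \<open>Lam\<close> of the
  smoothness argument.\<close>

lemma linear_solution:
  obtains L where "\<And>w x. w + prim_C0 (mult_C0 b w) = x \<longleftrightarrow> w = L x" "\<And>x. norm (L x) \<le> sol_const (norm b) * norm x"
proof -
  have lip: "\<bar>eval_C0 (mult_C0 b u) t - eval_C0 (mult_C0 b v) t\<bar> \<le> norm b * \<bar>eval_C0 u t - eval_C0 v t\<bar>" for u v t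
    using mult_right_mono[OF abs_eval_C0_le_norm[of b t], of "\<bar>eval_C0 u t - eval_C0 v t\<bar>"]
    by (simp add: abs_mult flip: right_diff_distrib)
  have "\<exists>w. w + prim_C0 (mult_C0 b w) = x" for x
    by (rule ex_solution_lipschitz[OF lip]) simp
  then obtain L where L: "\<And>x. L x + prim_C0 (mult_C0 b (L x)) = x" by metis
  have est: "norm (w - w') \<le> sol_const (norm b) * norm (x - x')"
    if "w + prim_C0 (mult_C0 b w) = x" "w' + prim_C0 (mult_C0 b w') = x'" for w w' x x'
    by (rule solution_lipschitz[OF that lip]) simp
  have "w = L x" if "w + prim_C0 (mult_C0 b w) = x" for w x
    using est[OF that L[of x]] by simp
  moreover have "mult_C0 b 0 = 0" by (rule C0_eqI) simp
  then have "norm (L x) \<le> sol_const (norm b) * norm x" for x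
    using est[OF L[of x], of 0 0] by simp
  ultimately show thesis using that[of L] L by blast
qed

section \<open>The equation for a smooth nonlinearity\<close>

locale smooth_nonlinearity =
  fixes p :: "nat \<Rightarrow> real \<Rightarrow> real \<Rightarrow> real"
  assumes cont: "\<And>j. continuous_on UNIV (\<lambda>(t, s). p j t s)" and per: "\<And>j. periodic (p j)"
    and der: "\<And>j t s. (p j t has_real_derivative p (Suc j) t s) (at s)"
begin

definition truncated :: "real \<Rightarrow> real \<Rightarrow> real \<Rightarrow> real" where
  "truncated r t s = p 0 t (clamp_to r s)"

lemma eval_superposition_truncated: "eval_C0 (superposition (truncated r) u) t = p 0 t (clamp_to r (eval_C0 u t))"
proof -
  have "continuous_on UNIV (\<lambda>x. (\<lambda>(t, s). p 0 t s) (fst x, clamp_to r (snd x)))"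
    by (rule continuous_on_compose2[OF cont]) (auto intro!: continuous_intros continuous_on_clamp_to)
  then have "continuous_on UNIV (\<lambda>(t, s). truncated r t s)"
    by (simp add: truncated_def case_prod_unfold)
  moreover have "periodic (truncated r)"
    using per[of 0] by (simp add: periodic_def truncated_def fun_eq_iff)
  ultimately show ?thesis by (simp add: eval_superposition truncated_def)
qed

lemma superposition_truncated_eq:
  assumes "norm u \<le> r"
  shows "superposition (truncated r) u = superposition (p 0) u"
  by (rule C0_eqI) (simp add: eval_superposition_truncated eval_superposition[OF cont per]
      clamp_to_eq[OF order_trans[OF abs_eval_C0_le_norm assms]])

lemma truncated_lipschitz:
  assumes "r \<ge> 0"
  obtains L where "L \<ge> 0" "\<And>u v t. \<bar>eval_C0 (superposition (truncated r) u) t - eval_C0 (superposition (truncated r) v) t\<bar>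
    \<le> L * \<bar>eval_C0 u t - eval_C0 v t\<bar>"
proof -
  obtain L where L: "L \<ge> 0" "\<And>t s s'. \<bar>s\<bar> \<le> r \<Longrightarrow> \<bar>s'\<bar> \<le> r \<Longrightarrow> \<bar>p 0 t s - p 0 t s'\<bar> \<le> L * \<bar>s - s'\<bar>"
    using periodic_lipschitz_on_strip[OF cont per der] by blast
  have "\<bar>p 0 t (clamp_to r s) - p 0 t (clamp_to r s')\<bar> \<le> L * \<bar>s - s'\<bar>" for t s s'
    using L(2)[of "clamp_to r s" "clamp_to r s'" t] abs_clamp_to_le[OF assms] clamp_to_lipschitz[of r s s']
      mult_left_mono[OF _ L(1)] order_trans by metis
  with L(1) that show thesis by (simp add: eval_superposition_truncated)
qed

lemma truncated_solution:
  assumes "r \<ge> 0"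
  obtains u where "u + prim_C0 (superposition (truncated r) u) = x"
proof -
  obtain L where L: "L \<ge> 0" "\<And>u v t. \<bar>eval_C0 (superposition (truncated r) u) t - eval_C0 (superposition (truncated r) v) t\<bar>
    \<le> L * \<bar>eval_C0 u t - eval_C0 v t\<bar>"
    using truncated_lipschitz[OF assms] by blast
  from ex_solution_lipschitz[OF L(2,1)] that show thesis by blast
qed

text \<open>Truncating beyond the range of both solutions changes neither of them and makes the
  nonlinearity globally Lipschitz.\<close>

lemma solution_unique:
  assumes "u + prim_C0 (superposition (p 0) u) = x" "v + prim_C0 (superposition (p 0) v) = x"
  shows "u = v"
proof -
  define r where "r = max (norm u) (norm v)"
  have "r \<ge> 0" by (simp add: r_def le_max_iff_disj)
  then obtain L where L: "L \<ge> 0" "\<And>u v t. \<bar>eval_C0 (superposition (truncated r) u) t - eval_C0 (superposition (truncated r) v) t\<bar>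
    \<le> L * \<bar>eval_C0 u t - eval_C0 v t\<bar>"
    using truncated_lipschitz by blast
  have "norm (u - v) \<le> sol_const L * norm (x - x)"
  proof (rule solution_lipschitz[OF _ _ L(2,1)])
    show "u + prim_C0 (superposition (truncated r) u) = x"
      using assms(1) superposition_truncated_eq[of u r] by (simp add: r_def)
    show "v + prim_C0 (superposition (truncated r) v) = x"
      using assms(2) superposition_truncated_eq[of v r] by (simp add: r_def)
  qed
  then show ?thesis by simp
qed

text \<open>Nothing bounds \<open>R y\<close> beforehand, so \<open>R z\<close> is compared with the
  solution \<open>v\<close> of the equation truncated at \<open>norm (R z) + 1\<close>. For
  \<open>y\<close> near \<open>z\<close> the Lipschitz estimate keeps \<open>v\<close> within 1 of
  \<open>R z\<close>, hence below the truncation level; so \<open>v\<close> solves the original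
  equation and equals \<open>R y\<close> by uniqueness.\<close>

lemma solution_continuous:
  assumes T: "bounded_linear T" and R: "\<And>z. R z + prim_C0 (superposition (p 0) (R z)) = T z"
  shows "isCont R z"
  unfolding continuous_at_eps_delta
proof (intro allI impI)
  fix e :: real assume e: "e > 0"
  define r where "r = norm (R z) + 1"
  have r: "r \<ge> 0" by (simp add: r_def)
  obtain L where L: "L \<ge> 0" "\<And>u v t. \<bar>eval_C0 (superposition (truncated r) u) t - eval_C0 (superposition (truncated r) v) t\<bar>
    \<le> L * \<bar>eval_C0 u t - eval_C0 v t\<bar>"
    using truncated_lipschitz[OF r] by blast
  define C where "C = sol_const L"
  have C: "C \<ge> 1" unfolding C_def by (rule sol_const_ge_1[OF L(1)])
  obtain K where K: "K > 0" "\<And>x. norm (T x) \<le> K * norm x"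
    using bounded_linear.pos_bounded[OF T] by (auto simp: mult.commute)
  have "dist (R y) (R z) < e" if y: "dist y z < min e 1 / (C * K)" for y
  proof -
    obtain v where v: "v + prim_C0 (superposition (truncated r) v) = T y"
      using truncated_solution[OF r] by blast
    have "R z + prim_C0 (superposition (truncated r) (R z)) = T z"
      using R[of z] superposition_truncated_eq[of "R z" r] by (simp add: r_def)
    from solution_lipschitz[OF v this L(2,1)]
    have "norm (v - R z) \<le> C * norm (T (y - z))"
      by (simp add: C_def linear_diff[OF bounded_linear.linear[OF T]])
    also have "\<dots> \<le> C * (K * norm (y - z))" using C K(2) by (intro mult_left_mono) auto
    also have "\<dots> < min e 1"
      using y C K(1) by (simp add: dist_norm pos_less_divide_eq mult_ac)
    finally have v': "norm (v - R z) < min e 1" .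
    then have "norm v \<le> r"
      using norm_triangle_ineq2[of v "R z"] by (simp add: r_def)
    then have "v + prim_C0 (superposition (p 0) v) = T y"
      using v by (simp only: superposition_truncated_eq)
    then have "v = R y" by (rule solution_unique[OF _ R])
    with v' show ?thesis by (simp add: dist_norm)
  qed
  then show "\<exists>d>0. \<forall>y. dist y z < d \<longrightarrow> dist (R y) (R z) < e"
    using e C K(1) by (intro exI[of _ "min e 1 / (C * K)"]) auto
qed

lemma superposition_derivative:
  "(superposition (p j) has_derivative mult_C0 (superposition (p (Suc j)) u)) (at u)"
  by (rule has_derivative_superposition) (rule cont per der)+

text \<open>\<open>T\<close> carries the equation for \<open>y\<close> to the one in C^0, since
  \<open>T (Q u) = prim_C0 u\<close>. Conversely, \<open>y\<close> is recovered from the solution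
  \<open>u = R z\<close> as \<open>z - Q (superposition (p 0) u)\<close>, so the inverse is the
  identity plus a linear image of a map that \<open>smooth_coeff\<close> handles.\<close>

theorem diffeomorphism_perturbed_identity:
  fixes T :: "'y::real_normed_vector \<Rightarrow> circle_C0" and Q :: "circle_C0 \<Rightarrow> 'y"
  assumes T: "bounded_linear T" and Q: "bounded_linear Q" and TQ: "\<And>u. T (Q u) = prim_C0 u"
    and ex: "\<And>z. \<exists>u. u + prim_C0 (superposition (p 0) u) = T z"
  shows "diffeomorphism (\<lambda>y. y + Q (superposition (p 0) (T y)))"
proof -
  obtain R where R: "\<And>z. R z + prim_C0 (superposition (p 0) (R z)) = T z" using ex by metis
  have "\<forall>z. \<exists>L. (\<forall>w x. w + prim_C0 (mult_C0 (superposition (p 1) (R z)) w) = x \<longleftrightarrow> w = L x) \<and>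
      (\<exists>K. \<forall>x. norm (L x) \<le> K * norm x)"
    by (metis linear_solution)
  then obtain Lam where Lam: "\<And>z w x. w + prim_C0 (mult_C0 (superposition (p 1) (R z)) w) = x \<longleftrightarrow> w = Lam z x"
    "\<And>z. \<exists>K. \<forall>x. norm (Lam z x) \<le> K * norm x" by metis
  have inv: "smooth_equation T prim_C0 (\<lambda>j. superposition (p j)) R Lam"
    by (rule smooth_equation.intro)
      (rule T bounded_linear_prim_C0 superposition_derivative solution_continuous[OF T R] R Lam)+
  \<comment> \<open>With \<open>S = 0\<close> the equation reads \<open>R z = T z\<close> and its
    linearisation is the identity; this instance gives smoothness of the forward map.\<close>
  have dir: "smooth_equation T (\<lambda>_. 0) (\<lambda>j. superposition (p j)) T (\<lambda>z x. x)"
  proof (rule smooth_equation.intro)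
    show "\<exists>K. \<forall>x. norm x \<le> K * norm x" for z by (rule exI[of _ 1]) simp
  qed (simp_all add: T bounded_linear_zero superposition_derivative linear_continuous_at[OF T])
  define \<Phi> where "\<Phi> y = y + Q (superposition (p 0) (T y))" for y
  define g where "g z = z - Q (superposition (p 0) (R z))" for z
  have Tg: "T (g z) = R z" for z
    using R[of z] by (simp add: g_def linear_diff[OF bounded_linear.linear[OF T]] TQ algebra_simps)
  have "T y = R (\<Phi> y)" for y
    by (rule solution_unique[OF _ R]) (simp add: \<Phi>_def linear_add[OF bounded_linear.linear[OF T]] TQ)
  then have g\<Phi>: "g (\<Phi> y) = y" for y
    by (simp add: g_def) (simp add: \<Phi>_def)
  have \<Phi>g: "\<Phi> (g z) = z" for z
    unfolding \<Phi>_def Tg by (simp add: g_def)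
  have "bij \<Phi>" using g\<Phi> \<Phi>g by (intro o_bij[of g]) auto
  moreover have "inv \<Phi> = g" using g\<Phi> \<Phi>g by (intro inv_equality)
  moreover have "smooth \<Phi>"
    unfolding \<Phi>_def[abs_def]
    by (intro smooth_add smooth_bounded_linear bounded_linear_ident smooth_compose_bounded_linear_left[OF Q] smooth_equation.smooth_coeff[OF dir])
  moreover have "smooth (\<lambda>z. z + - Q (superposition (p 0) (R z)))"
    by (intro smooth_add smooth_bounded_linear bounded_linear_ident
        smooth_compose_bounded_linear_left[OF bounded_linear_minus[OF Q]] smooth_equation.smooth_coeff[OF inv])
  then have "smooth g" by (simp add: g_def[abs_def])
  ultimately show ?thesis by (simp add: diffeomorphism_def \<Phi>_def[abs_def])
qed

end

section \<open>A priori bounds for tame nonlinearities\<close>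

lemma continuous_on_SUP_periodic:
  fixes g :: "real \<Rightarrow> real \<Rightarrow> real"
  assumes cont: "continuous_on UNIV (\<lambda>(t, s). g t s)" and per: "periodic g"
  shows "continuous_on UNIV (\<lambda>s. SUP t. g t s)" and "g t s \<le> (SUP t. g t s)"
proof -
  have bdd: "bdd_above (range (\<lambda>t. g t s))" for s
  proof -
    obtain B where "B \<ge> 0" and B: "\<And>t s'. \<bar>s'\<bar> \<le> \<bar>s\<bar> \<Longrightarrow> \<bar>g t s'\<bar> \<le> B"
      using periodic_bounded_on_strip[where r = "\<bar>s\<bar>", OF assms] by blast
    from B have "\<bar>g t s\<bar> \<le> B" for t by simp
    then show ?thesis by (intro bdd_aboveI2[of _ _ B]) (simp add: abs_le_iff)
  qed
  show up: "g t s \<le> (SUP t. g t s)" for t s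
    by (rule cSUP_upper[OF _ bdd]) simp
  have "isCont (\<lambda>s. SUP t. g t s) s" for s
    unfolding continuous_at_eps_delta
  proof (intro allI impI)
    fix e :: real assume "e > 0"
    then have "e/2 > 0" by simp
    obtain d where d: "d > 0" "\<And>t s' s''. \<bar>s'\<bar> \<le> \<bar>s\<bar> + 1 \<Longrightarrow> \<bar>s''\<bar> \<le> \<bar>s\<bar> + 1 \<Longrightarrow> \<bar>s' - s''\<bar> < d \<Longrightarrow> \<bar>g t s' - g t s''\<bar> < e/2"
      using periodic_uniformly_continuous_on_strip[OF assms \<open>e/2 > 0\<close>, of "\<bar>s\<bar> + 1"] by blast
    have le: "(SUP t. g t s') \<le> (SUP t. g t s'') + e/2"
      if "\<bar>s'\<bar> \<le> \<bar>s\<bar> + 1" "\<bar>s''\<bar> \<le> \<bar>s\<bar> + 1" "\<bar>s' - s''\<bar> < d" for s' s''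
    proof (rule cSUP_least)
      fix t
      show "g t s' \<le> (SUP t. g t s'') + e/2"
        using d(2)[OF that, of t] up[of t s''] by linarith
    qed simp
    have "dist (SUP t. g t s') (SUP t. g t s) < e" if "dist s' s < min d 1" for s'
    proof -
      have "\<bar>s'\<bar> \<le> \<bar>s\<bar> + 1" "\<bar>s' - s\<bar> < d" "\<bar>s - s'\<bar> < d" using that by (auto simp: dist_real_def)
      then have "(SUP t. g t s') \<le> (SUP t. g t s) + e/2" "(SUP t. g t s) \<le> (SUP t. g t s') + e/2"
        by (intro le; simp)+
      then show ?thesis using \<open>e > 0\<close> by (simp add: dist_real_def abs_less_iff)
    qed
    then show "\<exists>d>0. \<forall>s'. dist s' s < d \<longrightarrow> dist (SUP t. g t s') (SUP t. g t s) < e"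
      using d(1) by (intro exI[of _ "min d 1"]) auto
  qed
  then show "continuous_on UNIV (\<lambda>s. SUP t. g t s)"
    by (simp add: continuous_at_imp_continuous_on)
qed

text \<open>A substitute for the sign of a derivative, needed because \<phi> will contain
  \<open>G (u t)\<close> and \<open>W t\<close>, neither of which has to be differentiable. Adding
  up over equal short pieces of the interval leaves an error \<open>e * (t - s)\<close> with
  \<open>e\<close> arbitrary.\<close>

lemma increment_bound:
  fixes \<phi> :: "real \<Rightarrow> real"
  assumes st: "0 \<le> s" "s \<le> t" "t \<le> 1"
    and loc: "\<And>e. e > 0 \<Longrightarrow> \<exists>d>0. \<forall>a b. 0 \<le> a \<longrightarrow> a \<le> b \<longrightarrow> b \<le> 1 \<longrightarrow> b - a < d \<longrightarrow> \<phi> b - \<phi> a \<le> e * (b - a)"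
  shows "\<phi> t \<le> \<phi> s"
proof (rule field_le_epsilon)
  fix e :: real assume e: "e > 0"
  obtain d where d: "d > 0" "\<And>a b. 0 \<le> a \<Longrightarrow> a \<le> b \<Longrightarrow> b \<le> 1 \<Longrightarrow> b - a < d \<Longrightarrow> \<phi> b - \<phi> a \<le> e * (b - a)"
    using loc[OF e] by blast
  obtain n :: nat where n: "1 / d < real n" using reals_Archimedean2 by blast
  then have n0: "n > 0" using d(1) by (metis gr0I less_asym of_nat_0 zero_less_divide_1_iff)
  define h where "h = (t - s) / real n"
  have h: "h \<ge> 0" "h < d" "real n * h = t - s"
  proof -
    have "(t - s) / real n \<le> 1 / real n" using st n0 by (intro divide_right_mono) auto
    also have "\<dots> < d" using n d(1) n0 by (simp add: field_simps)
    finally show "h < d" by (simp add: h_def)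
  qed (use st n0 in \<open>simp_all add: h_def\<close>)
  have "\<phi> (s + real k * h) - \<phi> s \<le> e * (real k * h)" if "k \<le> n" for k
    using that
  proof (induction k)
    case (Suc k)
    have "real (Suc k) * h \<le> real n * h" using Suc.prems h(1) by (intro mult_right_mono) auto
    then have "s + real (Suc k) * h \<le> 1" using h(3) st by linarith
    moreover have "(s + real (Suc k) * h) - (s + real k * h) = h" by (simp add: algebra_simps)
    ultimately have "\<phi> (s + real (Suc k) * h) - \<phi> (s + real k * h) \<le> e * h"
      using d(2)[of "s + real k * h" "s + real (Suc k) * h"] st h by auto
    moreover have "\<phi> (s + real k * h) - \<phi> s \<le> e * (real k * h)" using Suc by simp
    moreover have "e * (real (Suc k) * h) = e * (real k * h) + e * h" by (simp add: algebra_simps)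
    ultimately show ?case by linarith
  qed simp
  from this[of n] have "\<phi> t - \<phi> s \<le> e * (t - s)" using h(3) by simp
  also have "\<dots> \<le> e * 1" using e st by (intro mult_left_mono) auto
  finally show "\<phi> t \<le> \<phi> s + e" by simp
qed

text \<open>Formally, the derivative of \<open>G (u t)\<close> is (y' + x') / M(u) \<le> B / M(u) +
  1 + |x'| / M(u), which is at most B + 1 + |x'| as M \<ge> 1. The increments of \<open>W\<close>
  take the place of the integral of |x'|.\<close>

lemma antiderivative_growth:
  fixes u x y y' G M W :: "real \<Rightarrow> real"
  assumes st: "0 \<le> s" "s \<le> t" "t \<le> 1"
    and u: "\<And>t. u t = y t + x t" and y: "\<And>t. (y has_real_derivative y' t) (at t)"
    and u_cont: "continuous_on UNIV u"
    and x: "\<And>s t. 0 \<le> s \<Longrightarrow> s \<le> t \<Longrightarrow> t \<le> 1 \<Longrightarrow> \<bar>x t - x s\<bar> \<le> W t - W s"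
    and M: "continuous_on UNIV M" "\<And>s. M s \<ge> 1" and G: "\<And>s. (G has_real_derivative 1 / M s) (at s)"
    and B: "B \<ge> 0" and y': "\<And>t. y' t \<le> B + M (u t)"
  shows "G (u t) - G (u s) \<le> (W t - W s) + (B + 1) * (t - s)"
proof -
  define \<phi> where "\<phi> t = G (u t) - W t - (B + 1) * t" for t
  have "\<phi> t \<le> \<phi> s"
  proof (rule increment_bound[OF st])
    fix e :: real assume e: "e > 0"
    have "uniformly_continuous_on {0..1} (\<lambda>t. M (u t))"
      by (intro compact_uniformly_continuous compact_Icc continuous_on_compose2[OF M(1)]
          continuous_on_subset[OF u_cont]) auto
    then obtain d where d: "d > 0" "\<And>a b. a \<in> {0..1} \<Longrightarrow> b \<in> {0..1} \<Longrightarrow> dist b a < d \<Longrightarrow> dist (M (u b)) (M (u a)) < e"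
      using e unfolding uniformly_continuous_on_def by metis
    have "\<phi> b - \<phi> a \<le> e * (b - a)" if ab: "0 \<le> a" "a \<le> b" "b \<le> 1" "b - a < d" for a b
    proof -
      \<comment> \<open>\<open>u\<close> need not be differentiable, so the mean value theorem is applied to \<open>G\<close> only; the
        intermediate point is then a value of \<open>u\<close> in the interval.\<close>
      obtain q where q: "q \<in> closed_segment (u a) (u b)" "G (u b) - G (u a) = (u b - u a) / M q"
      proof (cases "u a" "u b" rule: linorder_cases)
        case less
        from MVT2[OF less G] obtain q where "u a < q" "q < u b" "G (u b) - G (u a) = (u b - u a) * (1 / M q)" by blast
        then show thesis by (intro that[of q]) (auto simp: closed_segment_eq_real_ivl)
      next
        case greater
        from MVT2[OF greater G] obtain q where "u b < q" "q < u a" "G (u a) - G (u b) = (u a - u b) * (1 / M q)" by blast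
        then show thesis by (intro that[of q]) (auto simp: closed_segment_eq_real_ivl diff_divide_distrib)
      qed (use that[of "u a"] in auto)
      have "connected (u ` {a..b})"
        by (intro connected_continuous_image continuous_on_subset[OF u_cont]) auto
      moreover have "u a \<in> u ` {a..b}" "u b \<in> u ` {a..b}" using ab by auto
      ultimately have "q \<in> u ` {a..b}"
        using q(1) connectedD_interval[of "u ` {a..b}" "u a" "u b" q] connectedD_interval[of "u ` {a..b}" "u b" "u a" q]
        by (auto simp only: closed_segment_eq_real_ivl atLeastAtMost_iff split: if_splits)
      then obtain r where r: "r \<in> {a..b}" "q = u r" by blast
      \<comment> \<open>The slope of \<open>y\<close> is taken at one intermediate point and the
        quotient uses \<open>M\<close> at another; uniform continuity of \<open>M (u t)\<close>
        makes the discrepancy at most \<open>e\<close>.\<close>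
      have y_le: "y b - y a \<le> (B + M (u r) + e) * (b - a)"
      proof (cases "a < b")
        case True
        from MVT2[OF True y] obtain z where z: "a < z" "z < b" "y b - y a = (b - a) * y' z" by blast
        have "dist (M (u z)) (M (u r)) < e"
          using r z ab by (intro d(2)) (auto simp: dist_real_def)
        then have "y' z \<le> B + M (u r) + e" using y'[of z] by (simp add: dist_real_def)
        then show ?thesis using z True by (simp add: mult.commute)
      qed (use ab in simp)
      have "u b - u a \<le> (B + M (u r) + e) * (b - a) + (W b - W a)"
        using y_le x[of a b] ab u[of a] u[of b] by linarith
      then have "(u b - u a) / M q \<le> ((B + M (u r) + e) * (b - a) + (W b - W a)) / M q"
        using M(2)[of q] by (intro divide_right_mono) linarith+
      also have "\<dots> = ((B + e) / M q + 1) * (b - a) + (W b - W a) / M q"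
        using M(2)[of q] r(2) by (simp add: field_simps)
      also have "\<dots> \<le> (B + e + 1) * (b - a) + (W b - W a)"
      proof -
        have "(B + e) / M q \<le> B + e" "(W b - W a) / M q \<le> W b - W a"
          using M(2)[of q] B e x[of a b] ab by (auto simp: divide_le_eq mult_le_cancel_left1)
        then show ?thesis using ab by (intro add_mono mult_right_mono) auto
      qed
      finally show ?thesis using q(2) by (simp add: \<phi>_def algebra_simps)
    qed
    with d(1) show "\<exists>d>0. \<forall>a b. 0 \<le> a \<longrightarrow> a \<le> b \<longrightarrow> b \<le> 1 \<longrightarrow> b - a < d \<longrightarrow> \<phi> b - \<phi> a \<le> e * (b - a)" by blast
  qed
  then show ?thesis by (simp add: \<phi>_def algebra_simps)
qed

lemma ex_antiderivative_real:
  fixes h :: "real \<Rightarrow> real"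
  assumes "continuous_on UNIV h"
  obtains F where "\<And>x. (F has_real_derivative h x) (at x)"
proof -
  have "\<exists>F. \<forall>x::real. - \<infinity> < ereal x \<longrightarrow> ereal x < \<infinity> \<longrightarrow> (F has_vector_derivative h x) (at x)"
    by (rule einterval_antiderivative) (use assms in \<open>auto simp: continuous_on_eq_continuous_at\<close>)
  then show thesis using that by (auto simp: has_real_derivative_iff_has_vector_derivative)
qed

text \<open>A bounded increasing antiderivative has a limit at infinity, and the fundamental theorem
  on the half-line would make the integral finite.\<close>

lemma antiderivative_unbounded:
  fixes G h :: "real \<Rightarrow> real"
  assumes h: "continuous_on UNIV h" "\<And>s. h s \<ge> 0" and G: "\<And>s. (G has_real_derivative h s) (at s)"
    and inf: "(\<integral>\<^sup>+s\<in>{0..}. ennreal (h s) \<partial>lborel) = \<infinity>"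
  shows "\<exists>r\<ge>0. G r > K"
proof (rule ccontr)
  assume "\<not> (\<exists>r\<ge>0. G r > K)"
  then have le: "G r \<le> K" if "r \<ge> 0" for r using that by force
  have mono: "G s \<le> G t" if "s \<le> t" for s t
    using DERIV_nonneg_imp_nondecreasing[OF that, of G] G h(2) by blast
  define l where "l = (SUP r\<in>{0..}. G r)"
  have bdd: "bdd_above (G ` {0..})" using le by (intro bdd_aboveI2[of _ _ K]) auto
  have "(G \<longlongrightarrow> l) at_top"
  proof (rule increasing_tendsto)
    show "eventually (\<lambda>r. G r \<le> l) at_top"
      using eventually_ge_at_top[of 0] by eventually_elim (auto simp: l_def intro: cSUP_upper[OF _ bdd])
  next
    fix a assume "a < l"
    then obtain r where "r \<ge> 0" "a < G r"
      unfolding l_def using less_cSUP_iff[OF _ bdd, of a] by auto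
    then show "eventually (\<lambda>r. a < G r) at_top"
      by (auto intro: eventually_mono[OF eventually_ge_at_top[of r]] less_le_trans mono)
  qed
  then have "(\<integral>\<^sup>+s\<in>{0..}. ennreal (h s) \<partial>lborel) = ennreal (l - G 0)"
    using h G by (intro nn_integral_FTC_atLeast borel_measurable_continuous_onI) auto
  with inf show False by simp
qed

text \<open>Collects what the bounds use about a solution: \<open>u - y\<close>, which will be the
  right-hand side \<open>T z\<close> or its negative, has increments dominated by those of some
  \<open>W\<close> with total growth at most \<open>K\<close>, and \<open>u\<close> is somewhere at
  most \<open>X\<close>. The truncation level does not occur, so the bounds can be uniform in it.
  The property is invariant under reversal of time.\<close>

definition admissible_drift ::
    "real \<Rightarrow> real \<Rightarrow> (real \<Rightarrow> real) \<Rightarrow> (real \<Rightarrow> real) \<Rightarrow> (real \<Rightarrow> real) \<Rightarrow> bool" where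
  "admissible_drift X K u y y' \<longleftrightarrow> (\<forall>t. (y has_real_derivative y' t) (at t)) \<and> continuous_on UNIV u \<and> u 1 = u 0 \<and>
     (\<exists>t\<in>{0..1}. u t \<le> X) \<and>
     (\<exists>W. W 1 - W 0 \<le> K \<and> (\<forall>s t. 0 \<le> s \<longrightarrow> s \<le> t \<longrightarrow> t \<le> 1 \<longrightarrow> \<bar>(u t - y t) - (u s - y s)\<bar> \<le> W t - W s))"

text \<open>The order of quantifiers is the point: \<open>r\<close> is fixed before the level
  \<open>R\<close>, although the growth condition involves \<open>R\<close>. An antiderivative
  \<open>H\<close> of the truncated 1 / M has to increase by more than \<open>K2\<close> between
  \<open>X\<close> and \<open>R\<close>, while along \<open>u\<close> it can increase by at most
  \<open>K2\<close> from a point with value at most \<open>X\<close>.\<close>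

lemma upper_bound_forward:
  assumes M: "continuous_on UNIV M" "\<And>s. M s \<ge> 1" and inf: "(\<integral>\<^sup>+s\<in>{0..}. ennreal (1 / M s) \<partial>lborel) = \<infinity>"
    and B: "B \<ge> 0" and X: "X \<ge> 0" and K: "K \<ge> 0"
  shows "\<exists>r. \<forall>R\<ge>r. \<forall>u y y'. admissible_drift X K u y y' \<longrightarrow> (\<forall>t. y' t \<le> B + M (clamp_to R (u t))) \<longrightarrow>
    (\<forall>t\<in>{0..1}. u t \<le> R)"
proof -
  have inv_cont: "continuous_on UNIV (\<lambda>s. 1 / M s)"
    using M(2) by (intro continuous_intros M(1)) (metis not_one_le_zero)
  obtain G where G: "\<And>s. (G has_real_derivative 1 / M s) (at s)"
    using ex_antiderivative_real[OF inv_cont] by blast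
  \<comment> \<open>Going from \<open>t0\<close> forward to \<open>t\<close> may pass the end of the
    period and then consists of two pieces, each contributing at most
    \<open>K + (B + 1)\<close>.\<close>
  define K2 where "K2 = 2 * K + 2 * (B + 1)"
  have pos: "1 / M s > 0" for s using M(2)[of s] by simp
  obtain r where r: "r \<ge> 0" "G r > G X + K2"
    using antiderivative_unbounded[OF inv_cont less_imp_le[OF pos] G inf] by blast
  have "u t \<le> R" if R: "R \<ge> max r X" and adm: "admissible_drift X K u y y'"
    and y': "\<And>t. y' t \<le> B + M (clamp_to R (u t))" and t: "t \<in> {0..1}" for R u y y' t
  proof (rule ccontr)
    assume "\<not> u t \<le> R"
    let ?M = "\<lambda>s. M (clamp_to R s)"
    have M': "continuous_on UNIV ?M" "\<And>s. ?M s \<ge> 1"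
      by (intro continuous_on_compose2[OF M(1)] continuous_on_clamp_to continuous_on_id) (auto simp: M(2))
    have inv_cont': "continuous_on UNIV (\<lambda>s. 1 / ?M s)"
      using M'(2) by (intro continuous_on_divide continuous_on_const M'(1)) (metis not_one_le_zero)
    obtain H where H: "\<And>s. (H has_real_derivative 1 / ?M s) (at s)"
      using ex_antiderivative_real[OF inv_cont'] by blast
    have H_mono: "H a \<le> H b" if "a \<le> b" for a b
      using DERIV_nonneg_imp_nondecreasing[OF that, of H] H pos less_imp_le by blast
    \<comment> \<open>Since \<open>X \<ge> 0\<close>, the clamp is the identity between
      \<open>X\<close> and \<open>R\<close>, so \<open>H\<close> and \<open>G\<close> have the same
      increment there for every \<open>R\<close>.\<close>
    have "H R - G R = H X - G X"
    proof (cases "X = R")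
      case False
      then have "X < R" using R by simp
      moreover have "((\<lambda>s. H s - G s) has_real_derivative 0) (at s)" if "X < s" "s < R" for s
        using DERIV_diff[OF H[of s] G[of s]] that X by (simp add: clamp_to_eq)
      moreover have "continuous_on {X..R} (\<lambda>s. H s - G s)"
        by (intro continuous_on_diff; rule continuous_at_imp_continuous_on; use H G DERIV_isCont in blast)
      ultimately show ?thesis using DERIV_isconst_end[of X R "\<lambda>s. H s - G s"] by blast
    qed simp
    moreover have "G r \<le> G R"
    proof (rule DERIV_nonneg_imp_nondecreasing[of r R G])
      show "r \<le> R" using R by simp
      show "\<exists>y. (G has_real_derivative y) (at s) \<and> 0 \<le> y" for s using G pos less_imp_le by blast
    qed
    ultimately have HR: "H R > H X + K2" using r by linarith
    obtain t0 W where t0: "t0 \<in> {0..1}" "u t0 \<le> X" and W: "W 1 - W 0 \<le> K"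
      "\<And>s t. 0 \<le> s \<Longrightarrow> s \<le> t \<Longrightarrow> t \<le> 1 \<Longrightarrow> \<bar>(u t - y t) - (u s - y s)\<bar> \<le> W t - W s"
      using adm unfolding admissible_drift_def by blast
    have growth: "H (u b) - H (u a) \<le> K + (B + 1)" if ab: "0 \<le> a" "a \<le> b" "b \<le> 1" for a b
    proof -
      have "H (u b) - H (u a) \<le> (W b - W a) + (B + 1) * (b - a)"
        by (rule antiderivative_growth[where y = y and y' = y' and x = "\<lambda>t. u t - y t", OF ab _ _ _ W(2) M' H B y'])
          (use adm in \<open>auto simp: admissible_drift_def\<close>)
      also have "W b - W a \<le> K" using W(1) W(2)[of 0 a] W(2)[of b 1] ab by linarith
      also have "(B + 1) * (b - a) \<le> (B + 1) * 1" using B ab by (intro mult_left_mono) auto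
      finally show ?thesis by simp
    qed
    have "H (u t) - H (u t0) \<le> K2"
    proof (cases "t0 \<le> t")
      case True
      then show ?thesis using growth[of t0 t] t t0 K B by (simp add: K2_def)
    next
      case False
      have "u 1 = u 0" using adm by (simp add: admissible_drift_def)
      then show ?thesis using growth[of 0 t] growth[of t0 1] t t0 by (simp add: K2_def)
    qed
    moreover have "H (u t0) \<le> H X" "H R \<le> H (u t)"
      using H_mono t0 \<open>\<not> u t \<le> R\<close> by auto
    ultimately show False using HR by linarith
  qed
  then show ?thesis by (intro exI[of _ "max r X"]) blast
qed

text \<open>For \<open>sg = -1\<close> the condition controls growth backwards in time. The
  substitution of 1 - t for t reverses the sign of the drift and reduces this to the forward bound,
  with \<open>- W (1 - t)\<close> as the new dominating function.\<close>

lemma upper_bound: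
  assumes M: "continuous_on UNIV M" "\<And>s. M s \<ge> 1" and inf: "(\<integral>\<^sup>+s\<in>{0..}. ennreal (1 / M s) \<partial>lborel) = \<infinity>"
    and B: "B \<ge> 0" and X: "X \<ge> 0" and K: "K \<ge> 0" and sg: "sg \<in> {1, -1 :: real}"
  shows "\<exists>r. \<forall>R\<ge>r. \<forall>u y y'. admissible_drift X K u y y' \<longrightarrow> (\<forall>t. sg * y' t \<le> B + M (clamp_to R (u t))) \<longrightarrow>
    (\<forall>t\<in>{0..1}. u t \<le> R)"
proof -
  obtain r where r: "\<And>R u y y' t. R \<ge> r \<Longrightarrow> admissible_drift X K u y y' \<Longrightarrow>
      (\<And>t. y' t \<le> B + M (clamp_to R (u t))) \<Longrightarrow> t \<in> {0..1} \<Longrightarrow> u t \<le> R"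
    using upper_bound_forward[OF M inf B X K] by blast
  have "u t \<le> R" if R: "R \<ge> r" and adm: "admissible_drift X K u y y'"
    and y': "\<And>t. sg * y' t \<le> B + M (clamp_to R (u t))" and t: "t \<in> {0..1}" for R u y y' t
  proof (cases "sg = 1")
    case True
    then show ?thesis using r[OF R adm _ t] y' by simp
  next
    case False
    then have sg: "sg = -1" using sg by simp
    let ?u = "\<lambda>t. u (1 - t)" and ?y = "\<lambda>t. y (1 - t)" and ?y' = "\<lambda>t. - y' (1 - t)"
    obtain t0 W where t0: "t0 \<in> {0..1}" "u t0 \<le> X" and W: "W 1 - W 0 \<le> K"
      "\<And>s t. 0 \<le> s \<Longrightarrow> s \<le> t \<Longrightarrow> t \<le> 1 \<Longrightarrow> \<bar>(u t - y t) - (u s - y s)\<bar> \<le> W t - W s"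
      using adm unfolding admissible_drift_def by blast
    have "(?y has_real_derivative ?y' t) (at t)" for t
    proof -
      have "(y has_real_derivative y' (1 - t)) (at (1 - t))" using adm by (simp add: admissible_drift_def)
      moreover have "((\<lambda>t. 1 - t) has_real_derivative -1) (at t)" by (auto intro!: derivative_eq_intros)
      ultimately have "((\<lambda>t. y (1 - t)) has_real_derivative y' (1 - t) * -1) (at t)"
        by (rule DERIV_chain2)
      then show ?thesis by simp
    qed
    moreover have "continuous_on UNIV ?u"
    proof -
      have "continuous_on UNIV u" using adm by (simp add: admissible_drift_def)
      then show ?thesis by (rule continuous_on_compose2) (auto intro!: continuous_intros)
    qed
    moreover have "?u 1 = ?u 0" using adm by (simp add: admissible_drift_def)
    moreover have "\<exists>t\<in>{0..1}. ?u t \<le> X" using t0 by (intro bexI[of _ "1 - t0"]) auto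
    moreover have "\<bar>(?u t - ?y t) - (?u s - ?y s)\<bar> \<le> - W (1 - t) - - W (1 - s)" if "0 \<le> s" "s \<le> t" "t \<le> 1" for s t
      using W(2)[of "1 - t" "1 - s"] that by (simp add: abs_minus_commute)
    then have "\<exists>W. W 1 - W 0 \<le> K \<and> (\<forall>s t. 0 \<le> s \<longrightarrow> s \<le> t \<longrightarrow> t \<le> 1 \<longrightarrow>
        \<bar>(?u t - ?y t) - (?u s - ?y s)\<bar> \<le> W t - W s)"
      using W(1) by (intro exI[of _ "\<lambda>t. - W (1 - t)"]) simp
    ultimately have "admissible_drift X K ?u ?y ?y'" by (simp add: admissible_drift_def)
    from r[OF R this, of "1 - t"] y' t show ?thesis by (simp add: sg)
  qed
  then show ?thesis by blast
qed

section \<open>Existence of solutions for tame nonlinearities\<close>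

context smooth_nonlinearity
begin

text \<open>\<open>M_max 1\<close> bounds the growth of solutions in forward time, \<open>M_max (- 1)\<close> in backward time.\<close>

definition M_max :: "real \<Rightarrow> real \<Rightarrow> real" where
  "M_max sg s = max 1 (SUP t. - sg * p 0 t s)"

lemma M_max: "continuous_on UNIV (M_max sg)" "M_max sg s \<ge> 1" "- sg * p 0 t s \<le> M_max sg s"
proof -
  have c: "continuous_on UNIV (\<lambda>(t, s). - sg * p 0 t s)"
    using cont[of 0] by (auto simp: case_prod_unfold intro!: continuous_intros)
  have pr: "periodic (\<lambda>t s. - sg * p 0 t s)" using per[of 0] by (simp add: periodic_def fun_eq_iff)
  show "continuous_on UNIV (M_max sg)"
    unfolding M_max_def[abs_def] by (intro continuous_on_max continuous_on_const continuous_on_SUP_periodic(1)[OF c pr])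
  show "- sg * p 0 t s \<le> M_max sg s"
    unfolding M_max_def using continuous_on_SUP_periodic(2)[OF c pr, of t s] by simp
qed (simp add: M_max_def)

text \<open>At each end tameness provides the divergence of at least one of two integrals; the signs
  record which one and thereby the direction of time to be used. The two ends may need different
  signs. The lower end is reflected to the half-line from 0 to infinity, so that one bound serves
  both.\<close>

lemma tame_imp_infinite:
  assumes "tame (p 0)"
  obtains sg sg' :: real where "sg \<in> {1, -1}" "(\<integral>\<^sup>+s\<in>{0..}. ennreal (1 / M_max sg s) \<partial>lborel) = \<infinity>"
    "sg' \<in> {1, -1}" "(\<integral>\<^sup>+s\<in>{0..}. ennreal (1 / M_max sg' (- s)) \<partial>lborel) = \<infinity>"
proof -
  have refl: "(\<integral>\<^sup>+s\<in>{..0}. ennreal (1 / M_max sg s) \<partial>lborel) = (\<integral>\<^sup>+s\<in>{0..}. ennreal (1 / M_max sg (- s)) \<partial>lborel)" for sg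
  proof -
    have [measurable]: "M_max sg \<in> borel_measurable borel"
      by (rule borel_measurable_continuous_onI[OF M_max(1)])
    have "(\<integral>\<^sup>+s\<in>{..0}. ennreal (1 / M_max sg s) \<partial>lborel) =
        (\<integral>\<^sup>+s. ennreal (1 / M_max sg (- s)) * indicator {..0} (- s) \<partial>lborel)"
      by (subst nn_integral_real_affine[where c = "-1" and t = 0]) auto
    also have "\<dots> = (\<integral>\<^sup>+s\<in>{0..}. ennreal (1 / M_max sg (- s)) \<partial>lborel)"
      by (intro nn_integral_cong) (simp add: indicator_def)
    finally show ?thesis .
  qed
  have "\<not> (\<integral>\<^sup>+s\<in>{0..}. ennreal (1 / M_max (-1) s) \<partial>lborel) < \<infinity> \<or> \<not> (\<integral>\<^sup>+s\<in>{0..}. ennreal (1 / M_max 1 s) \<partial>lborel) < \<infinity>"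
    using assms by (auto simp: tame_def wild_at_pos_infinity_def wild_on_def M_max_def)
  then obtain sg :: real where sg: "sg \<in> {1, -1}" "(\<integral>\<^sup>+s\<in>{0..}. ennreal (1 / M_max sg s) \<partial>lborel) = \<infinity>"
    by (auto simp flip: less_top)
  have "\<not> (\<integral>\<^sup>+s\<in>{..0}. ennreal (1 / M_max (-1) s) \<partial>lborel) < \<infinity> \<or> \<not> (\<integral>\<^sup>+s\<in>{..0}. ennreal (1 / M_max 1 s) \<partial>lborel) < \<infinity>"
    using assms by (auto simp: tame_def wild_at_neg_infinity_def wild_on_def M_max_def)
  then obtain sg' :: real where "sg' \<in> {1, -1}" "(\<integral>\<^sup>+s\<in>{0..}. ennreal (1 / M_max sg' (- s)) \<partial>lborel) = \<infinity>"
    unfolding refl by (auto simp flip: less_top)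
  with sg that show thesis by blast
qed

theorem ex_solution_tame:
  assumes tame: "tame (p 0)"
    and W: "\<And>s t. 0 \<le> s \<Longrightarrow> s \<le> t \<Longrightarrow> t \<le> 1 \<Longrightarrow> \<bar>eval_C0 x t - eval_C0 x s\<bar> \<le> W t - W s"
  shows "\<exists>u. u + prim_C0 (superposition (p 0) u) = x"
proof -
  define X where "X = norm x"
  define K where "K = W 1 - W 0"
  have X: "X \<ge> 0" and K: "K \<ge> 0" using W[of 0 1] by (auto simp: X_def K_def)
  obtain B where B: "B \<ge> 0" "\<And>t s. \<bar>s\<bar> \<le> X \<Longrightarrow> \<bar>p 0 t s\<bar> \<le> B"
    using periodic_bounded_on_strip[OF cont per] by blast
  obtain sg sg' :: real where sg: "sg \<in> {1, -1}" "(\<integral>\<^sup>+s\<in>{0..}. ennreal (1 / M_max sg s) \<partial>lborel) = \<infinity>"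
    and sg': "sg' \<in> {1, -1}" "(\<integral>\<^sup>+s\<in>{0..}. ennreal (1 / M_max sg' (- s)) \<partial>lborel) = \<infinity>"
    using tame_imp_infinite[OF tame] by blast
  obtain r1 where r1: "\<And>R u y y' t. R \<ge> r1 \<Longrightarrow> admissible_drift X K u y y' \<Longrightarrow>
      (\<And>t. sg * y' t \<le> B + M_max sg (clamp_to R (u t))) \<Longrightarrow> t \<in> {0..1} \<Longrightarrow> u t \<le> R"
    using upper_bound[OF M_max(1,2) sg(2) B(1) X K sg(1)] by blast
  have M': "continuous_on UNIV (\<lambda>s. M_max sg' (- s))"
    by (rule continuous_on_compose2[OF M_max(1)]) (auto intro!: continuous_intros)
  \<comment> \<open>The lower bound will be the upper bound for \<open>- u\<close>, whose drift is
    \<open>- y'\<close>; hence the opposite sign.\<close>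
  have sg'': "- sg' \<in> {1, -1 :: real}" using sg'(1) by auto
  obtain r2 where r2: "\<And>R u y y' t. R \<ge> r2 \<Longrightarrow> admissible_drift X K u y y' \<Longrightarrow>
      (\<And>t. - sg' * y' t \<le> B + M_max sg' (- clamp_to R (u t))) \<Longrightarrow> t \<in> {0..1} \<Longrightarrow> u t \<le> R"
    using upper_bound[OF M' M_max(2) sg'(2) B(1) X K sg''] by blast
  define R where "R = max X (max r1 r2)"
  have R: "R \<ge> X" "R \<ge> r1" "R \<ge> r2" "R \<ge> 0" using X by (auto simp: R_def)
  obtain v where v: "v + prim_C0 (superposition (truncated R) v) = x"
    using truncated_solution[OF R(4)] by blast
  define q where "q = superposition (truncated R) v"
  define c where "c = mean_C0 q"
  define w where "w = - prim_C0 q"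
  have w: "has_deriv_C0 w (- (q - const_C0 c))"
    unfolding w_def c_def by (intro has_deriv_C0_minus has_deriv_prim_C0)
  have v_eq: "v = w + x" using v by (simp add: w_def q_def algebra_simps)
  define u where "u = eval_C0 v"
  define y where "y = eval_C0 w"
  define y' where "y' t = c - p 0 t (clamp_to R (u t))" for t
  have der: "(y has_real_derivative y' t) (at t)" for t
    using w by (simp add: has_deriv_C0_def y_def y'_def u_def q_def eval_superposition_truncated)
  have uy: "u t - y t = eval_C0 x t" for t by (simp add: u_def y_def v_eq)
  have per1: "h 1 = h 0" if "periodic h" for h :: "real \<Rightarrow> real"
    using that by (simp add: periodic_def) (metis add_0)
  obtain t0 where "eval_C0 w t0 = 0" using mean_zero_has_zero[of w] by (auto simp: w_def)
  then have t0: "y (frac t0) = 0" using periodic_frac[OF periodic_eval_C0[of w]] by (simp add: y_def)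
  have frac: "frac t \<in> {0..1}" for t :: real using frac_lt_1[of t] by (simp add: less_imp_le)
  \<comment> \<open>Where \<open>y\<close> vanishes \<open>u\<close> equals \<open>x\<close>, so
    that |u| \<le> X \<le> R and the truncation is inactive. This is why \<open>B\<close>, fixed
    before \<open>R\<close>, bounds \<open>c\<close>.\<close>
  have c: "\<bar>c\<bar> \<le> B"
  proof (rule periodic_drift_bound[OF der _ t0])
    show "periodic y" unfolding y_def by (rule periodic_eval_C0)
    fix t assume "y t = 0"
    then have "\<bar>u t\<bar> \<le> X" using uy[of t] abs_eval_C0_le_norm[of x t] by (simp add: X_def)
    then show "\<bar>y' t - c\<bar> \<le> B" using B(2)[of "u t" t] R(1) by (simp add: y'_def clamp_to_eq)
  qed
  have x0: "\<bar>u (frac t0)\<bar> \<le> X"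
    using uy[of "frac t0"] t0 abs_eval_C0_le_norm[of x "frac t0"] by (simp add: X_def)
  have WK: "\<exists>W. W 1 - W 0 \<le> K \<and> (\<forall>s t. 0 \<le> s \<longrightarrow> s \<le> t \<longrightarrow> t \<le> 1 \<longrightarrow> \<bar>eval_C0 x t - eval_C0 x s\<bar> \<le> W t - W s)"
    using W by (intro exI[of _ W]) (simp add: K_def)
  have adm: "admissible_drift X K u y y'"
    unfolding admissible_drift_def uy
    using der WK x0 frac[of t0] per1[OF periodic_eval_C0] continuous_on_eval_C0[of UNIV v]
    by (auto simp: u_def intro!: bexI[of _ "frac t0"])
  have uy_neg: "- u t - - y t = - eval_C0 x t" for t using uy[of t] by simp
  have adm_neg: "admissible_drift X K (\<lambda>t. - u t) (\<lambda>t. - y t) (\<lambda>t. - y' t)"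
    unfolding admissible_drift_def uy_neg
    using der WK x0 frac[of t0] per1[OF periodic_eval_C0] continuous_on_eval_C0[of UNIV v]
    by (auto simp: u_def abs_minus_commute intro!: bexI[of _ "frac t0"] DERIV_minus continuous_on_minus)
  have drift: "s * y' t \<le> B + M_max s (clamp_to R (u t))" if "s \<in> {1, -1}" for s t
    using M_max(3)[of s t "clamp_to R (u t)"] c that by (auto simp: y'_def)
  have clamp_neg: "clamp_to R (- a) = - clamp_to R a" for a
    using R(4) by (simp add: clamp_to_def max_def min_def)
  have up: "u t \<le> R" if "t \<in> {0..1}" for t
    by (rule r1[OF R(2) adm drift[OF sg(1)] that])
  have lo: "- u t \<le> R" if "t \<in> {0..1}" for t
    by (rule r2[OF R(3) adm_neg _ that]) (use drift[OF sg'(1)] in \<open>simp add: clamp_neg\<close>)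
  have "norm v \<le> R"
  proof (rule norm_C0_le)
    fix t
    have "eval_C0 v t = u (frac t)" by (simp add: u_def periodic_frac[OF periodic_eval_C0])
    then show "\<bar>eval_C0 v t\<bar> \<le> R" using up[OF frac] lo[OF frac] by (simp add: abs_le_iff)
  qed
  then show ?thesis using v superposition_truncated_eq by auto
qed

end

section \<open>The maps in the C case and in the H case\<close>

text \<open>The operator \<open>T\<close> of the overview in the C case, followed by the inclusion
  of C^1 into C^0.\<close>

definition integrate_C0 :: "circle_C0 \<Rightarrow> circle_C0" where
  "integrate_C0 y = prim_C0 y + const_C0 (mean_C0 y)"

lemma bounded_linear_const_mean_C0: "bounded_linear (\<lambda>y. const_C0 (mean_C0 y))"
  by (rule bounded_linear_intro[of _ 1]) (simp_all add: const_C0_simps abs_mean_C0_le_norm)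

lemma bounded_linear_integrate_C0: "bounded_linear integrate_C0"
  unfolding integrate_C0_def[abs_def] by (intro bounded_linear_add bounded_linear_prim_C0 bounded_linear_const_mean_C0)

lemma has_deriv_integrate_C0: "has_deriv_C0 (integrate_C0 y) (y - const_C0 (mean_C0 y))"
  using has_deriv_C0_add[OF has_deriv_prim_C0 has_deriv_const_C0] by (simp add: integrate_C0_def)

theorem diffeomorphism_Psi_C:
  assumes f: "smooth (\<lambda>(t, s). f t s)" "periodic f" and tame: "tame f"
  shows "diffeomorphism (Psi_C f)"
proof -
  obtain p where p: "p 0 = f" "\<And>j. continuous_on UNIV (\<lambda>(t, s). p j t s)" "\<And>j. periodic (p j)"
    "\<And>j t s. (p j t has_real_derivative p (Suc j) t s) (at s)"
    using smooth_partial_derivatives[OF f] by blast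
  interpret smooth_nonlinearity p by standard (rule p)+
  \<comment> \<open>The mean is removed because \<open>integrate_C0\<close> would reproduce it as a
    constant; without it only \<open>prim_C0\<close> is left.\<close>
  define Q where "Q u = u - const_C0 (mean_C0 u)" for u
  have Q: "bounded_linear Q"
    unfolding Q_def[abs_def] by (intro bounded_linear_sub bounded_linear_ident bounded_linear_const_mean_C0)
  have TQ: "integrate_C0 (Q u) = prim_C0 u" for u
    by (simp add: integrate_C0_def Q_def prim_C0_diff const_C0_simps)
  have ex: "\<exists>u. u + prim_C0 (superposition (p 0) u) = integrate_C0 z" for z
  proof (rule ex_solution_tame[where W = "\<lambda>t. 2 * norm z * t"])
    fix s t :: real assume st: "0 \<le> s" "s \<le> t" "t \<le> 1"
    have "norm (eval_C0 (integrate_C0 z) t - eval_C0 (integrate_C0 z) s) \<le> 2 * norm z * norm (t - s)"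
    proof (rule field_differentiable_bound[of UNIV])
      show "(eval_C0 (integrate_C0 z) has_real_derivative eval_C0 (z - const_C0 (mean_C0 z)) r) (at r within UNIV)" for r
        using has_deriv_integrate_C0[of z] by (simp add: has_deriv_C0_def)
      show "norm (eval_C0 (z - const_C0 (mean_C0 z)) r) \<le> 2 * norm z" for r
        using abs_eval_C0_le_norm[of z r] abs_mean_C0_le_norm[of z] by simp
    qed auto
    then show "\<bar>eval_C0 (integrate_C0 z) t - eval_C0 (integrate_C0 z) s\<bar> \<le> 2 * norm z * t - 2 * norm z * s"
      using st by (simp add: right_diff_distrib)
  qed (simp add: p(1) tame)
  define A where "A u = deriv_C1 u + const_C0 (mean_C0 (C0_of_C1 u))" for u
  \<comment> \<open>This is the inverse of \<open>A\<close> with values in C^1, of which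
    \<open>integrate_C0\<close> keeps only the underlying continuous function.\<close>
  define E where "E y = Abs_circle_C1 (integrate_C0 y)" for y
  have C0_E: "C0_of_C1 (E y) = integrate_C0 y" for y
    unfolding E_def by (rule C0_of_C1_Abs[OF has_deriv_integrate_C0])
  have deriv_E: "deriv_C1 (E y) = y - const_C0 (mean_C0 y)" for y
    by (rule deriv_C1_eqI) (simp add: C0_E has_deriv_integrate_C0)
  have mean_deriv: "mean_C0 (deriv_C1 u) = 0" for u
    by (rule mean_C0_deriv[OF has_deriv_C0_deriv_C1])
  have TA: "integrate_C0 (A u) = C0_of_C1 u" for u
  proof -
    from has_deriv_C0_diff[OF has_deriv_C0_deriv_C1[of u] has_deriv_const_C0]
    have "prim_C0 (deriv_C1 u) = C0_of_C1 u - const_C0 (mean_C0 (C0_of_C1 u))"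
      by (intro prim_C0_eqI) (simp_all add: mean_deriv const_C0_simps)
    then show ?thesis by (simp add: integrate_C0_def A_def prim_C0_add mean_deriv)
  qed
  have AE: "A (E y) = y" for y
    by (simp add: A_def C0_E deriv_E) (simp add: integrate_C0_def)
  have EA: "E (A u) = u" for u
    using C0_E[of "A u"] by (simp add: TA C0_of_C1_inject)
  have A: "bounded_linear A"
  proof (rule bounded_linear_intro[of _ 1])
    fix u
    show "norm (A u) \<le> norm u * 1"
      using norm_triangle_ineq[of "deriv_C1 u" "const_C0 (mean_C0 (C0_of_C1 u))"] abs_mean_C0_le_norm[of "C0_of_C1 u"]
      by (simp add: A_def norm_circle_C1_def)
  qed (simp_all add: A_def deriv_C1_simps C0_of_C1_simps const_C0_simps scaleR_add_right)
  have E: "bounded_linear E"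
  proof -
    obtain K where K: "\<And>y. norm (integrate_C0 y) \<le> K * norm y"
      using bounded_linear.bounded[OF bounded_linear_integrate_C0] by (auto simp: mult.commute)
    note lin = bounded_linear.linear[OF bounded_linear_integrate_C0]
    show ?thesis
    proof (rule bounded_linear_intro[of _ "K + 2"])
      fix x y :: circle_C0 and r :: real
      show "E (x + y) = E x + E y" "E (r *\<^sub>R x) = r *\<^sub>R E x"
        by (simp_all add: C0_E C0_of_C1_simps linear_add[OF lin] linear_cmul[OF lin] flip: C0_of_C1_inject)
      show "norm (E x) \<le> norm x * (K + 2)"
        using K[of x] norm_triangle_ineq4[of x "const_C0 (mean_C0 x)"] abs_mean_C0_le_norm[of x]
        by (simp add: norm_circle_C1_def C0_E deriv_E algebra_simps)
    qed
  qed
  have "Psi_C f u = A u + Q (superposition (p 0) (integrate_C0 (A u)))" for u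
  proof -
    have "F_C f u = deriv_C1 u + superposition f (C0_of_C1 u)"
      by (rule C0_eqI) (simp add: eval_F_C[OF f] eval_superposition[OF p(2)[of 0] p(3)[of 0], unfolded p(1)])
    then show ?thesis unfolding TA by (simp add: Psi_C_def A_def Q_def p(1) mean_deriv)
  qed
  then have "Psi_C f = (\<lambda>u. A u + Q (superposition (p 0) (integrate_C0 (A u))))" by blast
  then show ?thesis
    using diffeomorphism_compose_linear[OF diffeomorphism_perturbed_identity[OF bounded_linear_integrate_C0 Q TQ ex] A E AE EA]
    by simp
qed

section \<open>The embedding of C^0 into L^2\<close>

definition L2_of_C0 :: "circle_C0 \<Rightarrow> circle_L2" where
  "L2_of_C0 p = abs_circle_L2 (eval_C0 p)"

lemma square_integrable_eval_C0: "square_integrable (eval_C0 p)"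
  by (intro periodic_continuous_square_integrable periodic_eval_C0 continuous_on_eval_C0)

lemma rep_L2_of_C0: "AE t in circle_measure. rep_circle_L2 (L2_of_C0 p) t = eval_C0 p t"
  unfolding L2_of_C0_def by (rule rep_abs_L2[OF square_integrable_eval_C0])

lemma inner_abs_L2:
  assumes "square_integrable g" "square_integrable h"
  shows "inner (abs_circle_L2 g) (abs_circle_L2 h) = (LINT t|circle_measure. g t * h t)"
  by (rule inner_circle_L2.abs_eq) (simp_all add: assms)

lemma L2_of_C0_linear: "L2_of_C0 (p + q) = L2_of_C0 p + L2_of_C0 q" "L2_of_C0 (p - q) = L2_of_C0 p - L2_of_C0 q"
  "L2_of_C0 (r *\<^sub>R p) = r *\<^sub>R L2_of_C0 p" "L2_of_C0 (const_C0 c) = const_L2 c"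
proof -
  note r = rep_L2_of_C0
  show "L2_of_C0 (p + q) = L2_of_C0 p + L2_of_C0 q"
    by (rule circle_L2_eqI) (use r[of "p + q"] r[of p] r[of q] rep_L2_add[of "L2_of_C0 p" "L2_of_C0 q"] in \<open>eventually_elim, simp\<close>)
  show "L2_of_C0 (p - q) = L2_of_C0 p - L2_of_C0 q"
    by (rule circle_L2_eqI) (use r[of "p - q"] r[of p] r[of q] rep_L2_diff[of "L2_of_C0 p" "L2_of_C0 q"] in \<open>eventually_elim, simp\<close>)
  show "L2_of_C0 (r *\<^sub>R p) = r *\<^sub>R L2_of_C0 p"
    by (rule circle_L2_eqI) (use r[of "r *\<^sub>R p"] r[of p] rep_L2_scaleR[of r "L2_of_C0 p"] in \<open>eventually_elim, simp\<close>)
  show "L2_of_C0 (const_C0 c) = const_L2 c"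
    by (rule circle_L2_eqI) (use r[of "const_C0 c"] rep_L2_const[of c] in \<open>eventually_elim, simp\<close>)
qed

lemma norm_L2_of_C0_le: "norm (L2_of_C0 p) \<le> norm p"
proof -
  have "inner (L2_of_C0 p) (L2_of_C0 p) = (LINT t|circle_measure. eval_C0 p t * eval_C0 p t)"
    unfolding L2_of_C0_def by (intro inner_abs_L2 square_integrable_eval_C0)
  also have "\<dots> \<le> (LINT t|circle_measure. (norm p)\<^sup>2)"
  proof (rule integral_mono)
    show "integrable circle_measure (\<lambda>t. eval_C0 p t * eval_C0 p t)"
      by (intro square_integrable_mult square_integrable_eval_C0)
    show "eval_C0 p t * eval_C0 p t \<le> (norm p)\<^sup>2" for t
      using abs_eval_C0_le_norm[of p t] abs_le_square_iff[of "eval_C0 p t" "norm p"] by (simp add: power2_eq_square)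
  qed simp
  finally show ?thesis by (simp add: norm_circle_L2_def real_le_lsqrt)
qed

lemma bounded_linear_L2_of_C0: "bounded_linear L2_of_C0"
  by (rule bounded_linear_intro[of _ 1]) (simp_all add: L2_of_C0_linear norm_L2_of_C0_le)

text \<open>Pairing with this step function integrates from 0 to \<open>t\<close>. Primitives of L^2
  functions thus become inner products, and Cauchy-Schwarz estimates them.\<close>

definition step_L2 :: "real \<Rightarrow> circle_L2" where
  "step_L2 t = abs_circle_L2 (indicator {..<t})"

lemma square_integrable_step: "square_integrable (indicator {..<t::real})"
  by (rule square_integrable_bounded[of _ 1]) (auto intro!: measurable_circle_borel simp: indicator_def)

lemma inner_step_L2: "inner y (step_L2 t) = (LINT s|circle_measure. rep_circle_L2 y s * indicator {..<t} s)"
  unfolding step_L2_def by (rule L2_pairing[symmetric, OF square_integrable_step])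

lemma LINT_step:
  assumes "0 \<le> t" "t \<le> 1"
  shows "(LINT s|circle_measure. indicator {..<t} s) = t"
proof -
  have "(LINT r|circle_measure. indicator {t<..} r * 1) = 1 - t"
    by (rule circle_FTC[where F = "\<lambda>r. r"]) (use assms in \<open>auto intro!: derivative_eq_intros continuous_intros\<close>)
  moreover have "(LINT r|circle_measure. indicator {..<t} r) = (LINT r|circle_measure. 1 - indicator {t<..} r :: real)"
  proof (rule integral_cong_AE)
    show "AE r in circle_measure. indicator {..<t} r = 1 - (indicator {t<..} r :: real)"
      using AE_circle_neq[of t] by eventually_elim (auto simp: indicator_def)
  qed (auto intro!: measurable_circle_borel)
  moreover have "integrable circle_measure (indicator {t<..} :: real \<Rightarrow> real)"
    by (intro square_integrable_integrable square_integrable_bounded[of _ 1] measurable_circle_borel) (auto simp: indicator_def)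
  ultimately show ?thesis by simp
qed

lemma inner_step_step:
  assumes "0 \<le> s" "s \<le> t" "t \<le> 1"
  shows "inner (step_L2 s) (step_L2 t) = s"
proof -
  have "inner (step_L2 s) (step_L2 t) = (LINT r|circle_measure. indicator {..<s} r * indicator {..<t} r)"
    unfolding step_L2_def by (intro inner_abs_L2 square_integrable_step)
  also have "\<dots> = (LINT r|circle_measure. indicator {..<s} r)"
    by (intro Bochner_Integration.integral_cong) (use assms in \<open>auto simp: indicator_def\<close>)
  also have "\<dots> = s" by (rule LINT_step) (use assms in auto)
  finally show ?thesis .
qed

lemma norm_step_diff:
  assumes "0 \<le> s" "s \<le> t" "t \<le> 1"
  shows "norm (step_L2 t - step_L2 s) = sqrt (t - s)"
  using inner_step_step[of s t] inner_step_step[of s s] inner_step_step[of t t] assms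
  by (simp add: norm_circle_L2_def inner_diff_left inner_diff_right inner_commute)

lemma norm_step_le: "0 \<le> t \<Longrightarrow> t \<le> 1 \<Longrightarrow> norm (step_L2 t) \<le> 1"
  using inner_step_step[of t t] by (simp add: norm_circle_L2_def)

lemma step_L2_1: "step_L2 1 = const_L2 1"
proof (rule circle_L2_eqI)
  show "AE t in circle_measure. rep_circle_L2 (step_L2 1) t = rep_circle_L2 (const_L2 1) t"
    using rep_abs_L2[OF square_integrable_step[of 1], folded step_L2_def] rep_L2_const[of 1] AE_space
    by eventually_elim (auto simp: indicator_def)
qed

lemma step_L2_0: "step_L2 0 = 0"
  using inner_step_step[of 0 0] by simp

lemma mean_L2_eq_inner: "mean_L2 y = inner y (step_L2 1)"
proof -
  have "inner y (step_L2 1) = (LINT t|circle_measure. rep_circle_L2 y t * 1)"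
    unfolding inner_step_L2 by (intro Bochner_Integration.integral_cong) (auto simp: indicator_def)
  then show ?thesis by (simp add: mean_L2_def)
qed

lemma mean_L2_simps:
  "mean_L2 0 = 0" "mean_L2 (u + v) = mean_L2 u + mean_L2 v"
  "mean_L2 (u - v) = mean_L2 u - mean_L2 v" "mean_L2 (r *\<^sub>R u) = r * mean_L2 u" "mean_L2 (const_L2 c) = c"
proof -
  have "mean_L2 (const_L2 c) = (LINT t|circle_measure. c)"
    unfolding mean_L2_def using square_integrable_rep_L2[of "const_L2 c"] rep_L2_const[of c]
    by (intro integral_cong_AE) (auto simp: square_integrable_def)
  then show "mean_L2 (const_L2 c) = c" by simp
qed (simp_all add: mean_L2_eq_inner inner_add_left inner_diff_left)

lemma abs_mean_L2_le_norm: "\<bar>mean_L2 y\<bar> \<le> norm y"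
proof -
  have "\<bar>mean_L2 y\<bar> \<le> norm y * norm (step_L2 1)"
    unfolding mean_L2_eq_inner by (rule Cauchy_Schwarz_ineq2)
  also have "\<dots> \<le> norm y * 1" by (intro mult_left_mono norm_step_le) auto
  finally show ?thesis by simp
qed

lemma mean_L2_of_C0: "mean_L2 (L2_of_C0 p) = mean_C0 p"
  unfolding mean_L2_def mean_C0_def
  using square_integrable_rep_L2[of "L2_of_C0 p"] square_integrable_eval_C0[of p] rep_L2_of_C0[of p]
  by (intro integral_cong_AE) (auto simp: square_integrable_def)

lemma const_L2_linear: "const_L2 (a + b) = const_L2 a + const_L2 b" "const_L2 (a - b) = const_L2 a - const_L2 b"
  "const_L2 (r * a) = r *\<^sub>R const_L2 a" "const_L2 0 = 0"
  by (simp_all add: const_C0_simps L2_of_C0_linear flip: L2_of_C0_linear(4))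
    (metis L2_of_C0_linear(3,4) const_C0_simps(1) scaleR_zero_left)

lemma norm_const_L2_le: "norm (const_L2 c) \<le> \<bar>c\<bar>"
  using norm_L2_of_C0_le[of "const_C0 c"] by (simp add: L2_of_C0_linear)

section \<open>Primitives of square integrable functions\<close>

lemma periodic_extension_continuous:
  fixes P :: "real \<Rightarrow> real"
  assumes P: "continuous_on {0..1} P" "P 0 = P 1"
  shows "continuous_on UNIV (\<lambda>t. P (frac t))"
proof -
  have on: "continuous_on {of_int n..of_int n + 1} (\<lambda>t. P (frac t))" for n :: int
  proof -
    have c: "continuous_on {of_int n..of_int n + 1} (\<lambda>t. P (t - of_int n))"
      by (rule continuous_on_compose2[OF P(1)]) (auto intro!: continuous_intros)
    have eq: "P (frac t) = P (t - of_int n)" if "t \<in> {of_int n..of_int n + 1}" for t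
    proof (cases "t = of_int n + 1")
      case True
      then have "frac t = 0" using frac_of_int[of "n + 1"] by simp
      then show ?thesis using True P(2) by simp
    next
      case False
      then have "\<lfloor>t\<rfloor> = n" using that by (intro floor_unique) auto
      then show ?thesis by (simp add: frac_def)
    qed
    show ?thesis by (rule continuous_on_eq[OF c]) (rule eq[symmetric])
  qed
  have "isCont (\<lambda>t. P (frac t)) t" for t
  proof -
    let ?n = "\<lfloor>t\<rfloor>"
    have "continuous_on ({of_int (?n - 1)..of_int (?n - 1) + 1} \<union> {of_int ?n..of_int ?n + 1}) (\<lambda>t. P (frac t))"
      by (intro continuous_on_closed_Un on closed_atLeastAtMost)
    then have "continuous_on {of_int ?n - 1<..<of_int ?n + 1} (\<lambda>t. P (frac t))"
      by (rule continuous_on_subset) auto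
    moreover have "t \<in> {of_int ?n - 1<..<of_int ?n + 1}" by (auto simp: floor_less_iff) linarith+
    ultimately show ?thesis by (simp add: continuous_on_eq_continuous_at)
  qed
  then show ?thesis by (simp add: continuous_at_imp_continuous_on)
qed

text \<open>The primitive of \<open>y\<close> minus its mean that vanishes at 0. The linear term
  makes it vanish at 1 as well, which gives a continuous periodic extension.\<close>

definition prim_L2 :: "circle_L2 \<Rightarrow> real \<Rightarrow> real" where
  "prim_L2 y t = inner y (step_L2 t) - mean_L2 y * t"

lemma prim_L2_0 [simp]: "prim_L2 y 0 = 0" and prim_L2_1 [simp]: "prim_L2 y 1 = 0"
  by (simp_all add: prim_L2_def step_L2_0 mean_L2_eq_inner)

text \<open>Cauchy-Schwarz against the indicator of an interval gives Hoelder exponent 1/2; the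
  linear term obeys the same bound because t - s \<le> sqrt (t - s) on the unit interval.\<close>

lemma prim_L2_diff_le:
  assumes "0 \<le> s" "s \<le> t" "t \<le> 1"
  shows "\<bar>prim_L2 y t - prim_L2 y s\<bar> \<le> 2 * norm y * sqrt (t - s)"
proof -
  have "\<bar>inner y (step_L2 t - step_L2 s)\<bar> \<le> norm y * sqrt (t - s)"
    using Cauchy_Schwarz_ineq2[of y "step_L2 t - step_L2 s"] norm_step_diff[OF assms] by simp
  moreover have "\<bar>mean_L2 y * (t - s)\<bar> \<le> norm y * sqrt (t - s)"
  proof -
    have "(t - s)\<^sup>2 \<le> t - s" using assms by (simp add: power2_eq_square mult_left_le)
    then have "t - s \<le> sqrt (t - s)" by (rule real_le_rsqrt)
    then show ?thesis
      using assms abs_mean_L2_le_norm[of y] unfolding abs_mult by (intro mult_mono) auto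
  qed
  ultimately show ?thesis by (simp add: prim_L2_def inner_diff_right algebra_simps)
qed

lemma continuous_on_prim_L2: "continuous_on {0..1} (prim_L2 y)"
  unfolding continuous_on_iff
proof (intro ballI allI impI)
  fix t e :: real assume t: "t \<in> {0..1}" and e: "e > 0"
  define d where "d = (e / (2 * norm y + 1))\<^sup>2"
  have n: "2 * norm y + 1 > 0" using norm_ge_zero[of y] by linarith
  have "dist (prim_L2 y s) (prim_L2 y t) < e" if s: "s \<in> {0..1}" "dist s t < d" for s
  proof -
    have "\<bar>prim_L2 y s - prim_L2 y t\<bar> \<le> 2 * norm y * sqrt \<bar>s - t\<bar>"
      using prim_L2_diff_le[of s t y] prim_L2_diff_le[of t s y] s t
      by (cases "s \<le> t") (simp_all add: abs_minus_commute)
    also have "\<dots> \<le> (2 * norm y + 1) * sqrt \<bar>s - t\<bar>" by (intro mult_right_mono) auto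
    also have "sqrt \<bar>s - t\<bar> < e / (2 * norm y + 1)"
      using s(2) e n by (intro real_less_lsqrt) (auto simp: d_def dist_real_def)
    then have "(2 * norm y + 1) * sqrt \<bar>s - t\<bar> < e" using n by (simp add: field_simps)
    finally show ?thesis by (simp add: dist_real_def)
  qed
  moreover have "d > 0" using e n by (simp add: d_def)
  ultimately show "\<exists>d>0. \<forall>s\<in>{0..1}. dist s t < d \<longrightarrow> dist (prim_L2 y s) (prim_L2 y t) < e" by blast
qed

definition prim_ext_L2 :: "circle_L2 \<Rightarrow> circle_C0" where
  "prim_ext_L2 y = mk_C0 (\<lambda>t. prim_L2 y (frac t))"

lemma eval_prim_ext_L2: "eval_C0 (prim_ext_L2 y) t = prim_L2 y (frac t)"
proof -
  have "periodic (\<lambda>t. prim_L2 y (frac t))" by (simp add: periodic_def frac_1_eq)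
  then show ?thesis
    unfolding prim_ext_L2_def
    by (subst eval_mk_C0) (simp_all add: periodic_extension_continuous continuous_on_prim_L2)
qed

lemma eval_prim_ext_L2_unit: "0 \<le> t \<Longrightarrow> t \<le> 1 \<Longrightarrow> eval_C0 (prim_ext_L2 y) t = prim_L2 y t"
  by (cases "t = 1") (simp_all add: eval_prim_ext_L2 frac_eq_id)

text \<open>The operator \<open>T\<close> of the overview in the H case. Its values lie in C^0, so
  the embedding of H^1 into C^0 is built in.\<close>

definition integrate_L2 :: "circle_L2 \<Rightarrow> circle_C0" where
  "integrate_L2 y = prim_ext_L2 y - const_C0 (mean_C0 (prim_ext_L2 y)) + const_C0 (mean_L2 y)"

lemma mean_integrate_L2 [simp]: "mean_C0 (integrate_L2 y) = mean_L2 y"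
  by (simp add: integrate_L2_def)

lemma bounded_linear_integrate_L2: "bounded_linear integrate_L2"
proof -
  have "prim_ext_L2 (x + y) = prim_ext_L2 x + prim_ext_L2 y" "prim_ext_L2 (r *\<^sub>R x) = r *\<^sub>R prim_ext_L2 x" for x y r
    by (rule C0_eqI; simp add: eval_prim_ext_L2 prim_L2_def inner_add_left mean_L2_simps algebra_simps)+
  moreover have "norm (prim_ext_L2 y) \<le> norm y * 2" for y
  proof (rule norm_C0_le)
    fix t :: real
    have f: "0 \<le> frac t" "frac t \<le> 1" using frac_lt_1[of t] by auto
    have "\<bar>prim_L2 y (frac t) - prim_L2 y 0\<bar> \<le> 2 * norm y * sqrt (frac t - 0)"
      by (rule prim_L2_diff_le) (use f in auto)
    also have "\<dots> \<le> 2 * norm y * 1" using f by (intro mult_left_mono) auto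
    finally show "\<bar>eval_C0 (prim_ext_L2 y) t\<bar> \<le> norm y * 2" by (simp add: eval_prim_ext_L2 mult.commute)
  qed
  ultimately have P: "bounded_linear prim_ext_L2" by (rule bounded_linear_intro)
  have "bounded_linear (\<lambda>y. const_C0 (mean_L2 y))"
    by (rule bounded_linear_intro[of _ 1]) (simp_all add: const_C0_simps mean_L2_simps abs_mean_L2_le_norm)
  then show ?thesis
    unfolding integrate_L2_def[abs_def]
    by (intro bounded_linear_add bounded_linear_sub P bounded_linear_compose[OF bounded_linear_const_mean_C0 P])
qed

text \<open>The Hoelder bound is not additive over adjacent intervals, as
  \<open>ex_solution_tame\<close> requires. The primitive of the absolute value of \<open>y\<close>,
  plus a linear term for the mean, is.\<close>

lemma integrate_L2_variation:
  obtains W where "\<And>s t. 0 \<le> s \<Longrightarrow> s \<le> t \<Longrightarrow> t \<le> 1 \<Longrightarrow> \<bar>eval_C0 (integrate_L2 y) t - eval_C0 (integrate_L2 y) s\<bar> \<le> W t - W s"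
proof
  let ?r = "rep_circle_L2 y"
  have sq: "square_integrable (\<lambda>r. \<bar>?r r\<bar>)"
    using square_integrable_rep_L2[of y] by (auto simp: square_integrable_def)
  let ?W = "\<lambda>t. (LINT r|circle_measure. \<bar>?r r\<bar> * indicator {..<t} r) + \<bar>mean_L2 y\<bar> * t"
  fix s t :: real assume st: "0 \<le> s" "s \<le> t" "t \<le> 1"
  have i: "integrable circle_measure (\<lambda>r. g r * indicator {..<t} r)" if "square_integrable g" for g t
    by (intro square_integrable_mult that square_integrable_step)
  note iy = i[OF square_integrable_rep_L2[of y]] and ia = i[OF sq]
  have "\<bar>inner y (step_L2 t) - inner y (step_L2 s)\<bar> =
      \<bar>LINT r|circle_measure. ?r r * indicator {..<t} r - ?r r * indicator {..<s} r\<bar>"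
    unfolding inner_step_L2 by (simp add: iy)
  also have "\<dots> \<le> (LINT r|circle_measure. \<bar>?r r * indicator {..<t} r - ?r r * indicator {..<s} r\<bar>)"
    by (rule integral_abs_bound)
  also have "\<dots> = (LINT r|circle_measure. \<bar>?r r\<bar> * indicator {..<t} r - \<bar>?r r\<bar> * indicator {..<s} r)"
    using st by (intro Bochner_Integration.integral_cong) (auto simp: indicator_def)
  also have "\<dots> = (LINT r|circle_measure. \<bar>?r r\<bar> * indicator {..<t} r) - (LINT r|circle_measure. \<bar>?r r\<bar> * indicator {..<s} r)"
    by (simp add: ia)
  finally have "\<bar>inner y (step_L2 t) - inner y (step_L2 s)\<bar> \<le> \<dots>" .
  moreover have "\<bar>mean_L2 y * t - mean_L2 y * s\<bar> = \<bar>mean_L2 y\<bar> * t - \<bar>mean_L2 y\<bar> * s"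
    using st by (simp add: abs_mult flip: right_diff_distrib)
  ultimately show "\<bar>eval_C0 (integrate_L2 y) t - eval_C0 (integrate_L2 y) s\<bar> \<le> ?W t - ?W s"
    using st by (simp add: integrate_L2_def eval_prim_ext_L2_unit prim_L2_def)
qed

text \<open>For a continuous function the L^2 primitive differs from the classical one by a
  constant, and both sides have mean zero. This is the relation between \<open>T\<close>,
  \<open>Q\<close> and \<open>S\<close> in the H case.\<close>

lemma integrate_L2_of_C0:
  "integrate_L2 (L2_of_C0 p - const_L2 (mean_C0 p)) = prim_C0 p"
proof -
  define q where "q = p - const_C0 (mean_C0 p)"
  let ?P = "eval_C0 (prim_C0 p)"
  have der: "(?P has_real_derivative eval_C0 q t) (at t)" for t
    using has_deriv_prim_C0[of p] by (simp add: has_deriv_C0_def q_def)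
  have mq: "mean_C0 q = 0" by (simp add: q_def)
  have eq: "L2_of_C0 p - const_L2 (mean_C0 p) = L2_of_C0 q"
    by (simp add: q_def L2_of_C0_linear)
  have "prim_L2 (L2_of_C0 q) t = ?P t - ?P 0" if "0 \<le> t" "t \<le> 1" for t
  proof -
    have [measurable]: "eval_C0 q \<in> borel_measurable circle_measure"
      by (intro measurable_circle_borel borel_measurable_continuous_onI continuous_on_eval_C0)
    have [measurable]: "(indicator {..<t} :: real \<Rightarrow> real) \<in> borel_measurable circle_measure"
      "(indicator {t<..} :: real \<Rightarrow> real) \<in> borel_measurable circle_measure"
      by (intro measurable_circle_borel borel_measurable_indicator; simp)+
    have "inner (L2_of_C0 q) (step_L2 t) = (LINT r|circle_measure. eval_C0 q r * indicator {..<t} r)"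
      unfolding step_L2_def L2_of_C0_def by (intro inner_abs_L2 square_integrable_step square_integrable_eval_C0)
    also have "\<dots> = (LINT r|circle_measure. eval_C0 q r - indicator {t<..} r * eval_C0 q r)"
    proof (rule integral_cong_AE)
      show "AE r in circle_measure. eval_C0 q r * indicator {..<t} r = eval_C0 q r - indicator {t<..} r * eval_C0 q r"
        using AE_circle_neq[of t] by eventually_elim (auto simp: indicator_def)
    qed measurable
    also have "\<dots> = mean_C0 q - (?P 1 - ?P t)"
    proof -
      have "integrable circle_measure (\<lambda>r. indicator {t<..} r * eval_C0 q r)"
        by (intro square_integrable_mult square_integrable_eval_C0 square_integrable_bounded[of _ 1]) auto
      moreover have "(LINT r|circle_measure. indicator {t<..} r * eval_C0 q r) = ?P 1 - ?P t"
        by (rule circle_FTC[OF der continuous_on_eval_C0 that])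
      ultimately show ?thesis by (simp add: integrable_eval_C0 mean_C0_def)
    qed
    also have "?P 1 = ?P 0" using periodic_eval_C0[of "prim_C0 p"] unfolding periodic_def by (metis add_0)
    finally show ?thesis by (simp add: prim_L2_def mean_L2_of_C0 mq)
  qed
  then have "eval_C0 (prim_ext_L2 (L2_of_C0 q)) t = ?P (frac t) - ?P 0" for t
    using frac_lt_1[of t] by (simp add: eval_prim_ext_L2)
  then have "prim_ext_L2 (L2_of_C0 q) = prim_C0 p - const_C0 (?P 0)"
    by (intro C0_eqI) (simp add: periodic_frac[OF periodic_eval_C0])
  then show ?thesis by (simp add: eq integrate_L2_def mean_L2_of_C0 mq const_C0_simps)
qed

section \<open>Weak derivatives of primitives\<close>

lemma LINT_prim_L2_deriv:
  assumes g0: "mean_L2 y = 0" and \<phi>: "test_function \<phi>"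
  shows "(LINT t|circle_measure. inner y (step_L2 t) * deriv \<phi> t) = - (LINT s|circle_measure. rep_circle_L2 y s * \<phi> s)"
proof -
  let ?g = "rep_circle_L2 y"
  let ?k = "\<lambda>s t. (if s < t then ?g s else 0) * deriv \<phi> t"
  interpret pair_sigma_finite circle_measure circle_measure
    by (simp add: pair_sigma_finite_def circle.sigma_finite_measure_axioms)
  have gi: "integrable circle_measure ?g"
    by (intro square_integrable_integrable square_integrable_rep_L2)
  note [measurable] = borel_measurable_integrable[OF gi]
  have id [measurable]: "(\<lambda>t. t) \<in> borel_measurable circle_measure"
    by (rule measurable_circle_borel) simp
  note d\<phi> = test_function_deriv[OF \<phi>]
  have [measurable]: "deriv \<phi> \<in> borel_measurable circle_measure"
    by (intro measurable_circle_borel borel_measurable_continuous_onI test_function_continuous d\<phi>)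
  have "bounded (range (deriv \<phi>))"
    using d\<phi> by (intro periodic_continuous_bounded test_function_continuous) (auto simp: test_function_def)
  then obtain C where C: "\<And>t. \<bar>deriv \<phi> t\<bar> \<le> C" by (auto simp: bounded_iff)
  have int: "integrable (circle_measure \<Otimes>\<^sub>M circle_measure) (case_prod ?k)"
  proof (rule Bochner_Integration.integrable_bound)
    show "integrable (circle_measure \<Otimes>\<^sub>M circle_measure) (\<lambda>(s, t). C * ?g s)"
      by (rule Fubini_integrable) (use gi in \<open>auto simp: abs_mult\<close>)
    show "case_prod ?k \<in> borel_measurable (circle_measure \<Otimes>\<^sub>M circle_measure)" by measurable
    have "\<bar>?k s t\<bar> \<le> \<bar>C * ?g s\<bar>" for s t
      using mult_mono[OF abs_ge_self[of "\<bar>?g s\<bar>"] order_trans[OF C[of t] abs_ge_self]] by (auto simp: abs_mult mult.commute)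
    then show "AE x in circle_measure \<Otimes>\<^sub>M circle_measure. norm (case_prod ?k x) \<le> norm (case x of (s, t) \<Rightarrow> C * ?g s)"
      by (auto simp: split_beta)
  qed
  have "(LINT t|circle_measure. inner y (step_L2 t) * deriv \<phi> t) = (LINT t|circle_measure. LINT s|circle_measure. ?k s t)"
  proof (rule Bochner_Integration.integral_cong)
    fix t
    have "inner y (step_L2 t) = (LINT s|circle_measure. (if s < t then ?g s else 0))"
      unfolding inner_step_L2 by (intro Bochner_Integration.integral_cong) auto
    then show "inner y (step_L2 t) * deriv \<phi> t = (LINT s|circle_measure. ?k s t)" by simp
  qed simp
  also have "\<dots> = (LINT s|circle_measure. LINT t|circle_measure. ?k s t)"
    by (rule Fubini_integral[OF int])
  also have "\<dots> = (LINT s|circle_measure. \<phi> 1 * ?g s - ?g s * \<phi> s)"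
  proof (rule Bochner_Integration.integral_cong)
    fix s assume "s \<in> space circle_measure"
    then have s: "0 \<le> s" "s \<le> 1" by auto
    have "(LINT t|circle_measure. ?k s t) = (LINT t|circle_measure. ?g s * (indicator {s<..} t * deriv \<phi> t))"
      by (intro Bochner_Integration.integral_cong) auto
    also have "\<dots> = ?g s * (\<phi> 1 - \<phi> s)"
      using circle_FTC[OF test_function_DERIV[OF \<phi>] test_function_continuous[OF d\<phi>] s] by simp
    finally show "(LINT t|circle_measure. ?k s t) = \<phi> 1 * ?g s - ?g s * \<phi> s" by (simp add: algebra_simps)
  qed simp
  \<comment> \<open>The boundary term at 1 left by Fubini vanishes since \<open>y\<close> has mean
    zero.\<close>
  also have "\<dots> = \<phi> 1 * mean_L2 y - (LINT s|circle_measure. ?g s * \<phi> s)"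
    using gi square_integrable_mult[OF square_integrable_rep_L2[of y] square_integrable_test_function[OF \<phi>]]
    by (simp add: mean_L2_def)
  finally show ?thesis using g0 by simp
qed

lemma LINT_deriv_test_function:
  assumes "test_function \<phi>"
  shows "(LINT t|circle_measure. deriv \<phi> t) = 0"
proof -
  note d\<phi> = test_function_deriv[OF assms]
  define w where "w = mk_C0 (deriv \<phi>)"
  have w: "eval_C0 w = deriv \<phi>"
    unfolding w_def using d\<phi> by (intro eval_mk_C0 test_function_continuous) (auto simp: test_function_def)
  have "mean_C0 w = \<phi> 1 - \<phi> 0"
    by (rule mean_C0_antideriv) (simp add: w test_function_DERIV[OF assms])
  also have "\<phi> 1 = \<phi> 0"
    using assms unfolding test_function_def periodic_def by (metis add_0)
  finally show ?thesis by (simp add: mean_C0_def w)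
qed

lemma has_weak_deriv_const: "has_weak_deriv (const_L2 c) 0"
proof -
  have "inner (const_L2 c) (abs_circle_L2 (deriv \<phi>)) = 0" if "test_function \<phi>" for \<phi>
  proof -
    have "inner (const_L2 c) (abs_circle_L2 (deriv \<phi>)) = (LINT t|circle_measure. c * deriv \<phi> t)"
      unfolding const_L2_def map_fun_def o_def id_def
      by (intro inner_abs_L2 square_integrable_const square_integrable_test_function test_function_deriv that)
    then show ?thesis using LINT_deriv_test_function[OF that] by simp
  qed
  then show ?thesis by (simp add: has_weak_deriv_iff_inner)
qed

lemma has_weak_deriv_prim:
  assumes "mean_L2 y = 0"
  shows "has_weak_deriv (L2_of_C0 (prim_ext_L2 y)) y"
  unfolding has_weak_deriv_def
proof (intro allI impI)
  fix \<phi> assume \<phi>: "test_function \<phi>"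
  note sq = square_integrable_rep_L2[of "L2_of_C0 (prim_ext_L2 y)"]
    square_integrable_test_function[OF test_function_deriv[OF \<phi>]] square_integrable_eval_C0[of "prim_ext_L2 y"]
  have "(LINT t|circle_measure. rep_circle_L2 (L2_of_C0 (prim_ext_L2 y)) t * deriv \<phi> t) =
      (LINT t|circle_measure. eval_C0 (prim_ext_L2 y) t * deriv \<phi> t)"
    using rep_L2_of_C0[of "prim_ext_L2 y"] sq by (intro integral_cong_AE) (auto simp: square_integrable_def)
  also have "\<dots> = (LINT t|circle_measure. inner y (step_L2 t) * deriv \<phi> t)"
    using assms by (intro Bochner_Integration.integral_cong) (auto simp: eval_prim_ext_L2_unit prim_L2_def)
  also have "\<dots> = - (LINT t|circle_measure. rep_circle_L2 y t * \<phi> t)"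
    by (rule LINT_prim_L2_deriv[OF assms \<phi>])
  finally show "(LINT t|circle_measure. rep_circle_L2 (L2_of_C0 (prim_ext_L2 y)) t * deriv \<phi> t) =
      - (LINT t|circle_measure. rep_circle_L2 y t * \<phi> t)" .
qed

text \<open>\<open>prim_L2\<close> subtracts the mean by itself, so \<open>y\<close> and its
  mean-free part have the same primitive, and the case of mean zero suffices.\<close>

lemma has_weak_deriv_integrate_L2: "has_weak_deriv (L2_of_C0 (integrate_L2 y)) (y - const_L2 (mean_L2 y))"
proof -
  let ?y = "y - const_L2 (mean_L2 y)"
  have m: "mean_L2 ?y = 0" by (simp add: mean_L2_simps)
  have "prim_L2 ?y t = prim_L2 y t" if "0 \<le> t" "t \<le> 1" for t
  proof -
    have "inner (const_L2 1) (step_L2 t) = t"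
      using inner_step_step[of t 1] that by (simp add: inner_commute flip: step_L2_1)
    moreover have "const_L2 (mean_L2 y) = mean_L2 y *\<^sub>R const_L2 1"
      using const_L2_linear(3)[of "mean_L2 y" 1] by simp
    ultimately show ?thesis unfolding prim_L2_def m by (simp add: inner_diff_left)
  qed
  then have "prim_ext_L2 ?y = prim_ext_L2 y"
    by (intro C0_eqI) (simp add: eval_prim_ext_L2 less_imp_le[OF frac_lt_1])
  then have "integrate_L2 y = prim_ext_L2 ?y + const_C0 (mean_L2 y - mean_C0 (prim_ext_L2 y))"
    by (simp add: integrate_L2_def const_C0_simps)
  then show ?thesis
    using has_weak_deriv_add[OF has_weak_deriv_prim[OF m] has_weak_deriv_const] by (simp add: L2_of_C0_linear)
qed

lemma mean_weak_deriv:
  assumes "has_weak_deriv u w"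
  shows "mean_L2 w = 0"
  using assms[unfolded has_weak_deriv_def, rule_format, OF test_function_const[of 1]]
  by (simp add: mean_L2_def)

text \<open>A test function minus its mean is the derivative of a test function, hence orthogonal to
  \<open>u\<close>; as \<open>u\<close> has mean zero, \<open>u\<close> is orthogonal to the test
  function itself. This gives injectivity of \<open>A\<close>.\<close>

lemma weak_deriv_zero_mean_zero:
  assumes u: "has_weak_deriv u 0" and m: "mean_L2 u = 0"
  shows "u = 0"
proof -
  have "AE t in circle_measure. rep_circle_L2 u t = 0"
  proof (rule fundamental_lemma)
    show "integrable circle_measure (rep_circle_L2 u)"
      by (intro square_integrable_integrable square_integrable_rep_L2)
    fix \<psi> assume \<psi>: "test_function \<psi>"
    obtain \<Phi> where \<Phi>: "test_function \<Phi>" "\<And>t. deriv \<Phi> t = \<psi> t - (LINT t|circle_measure. \<psi> t)"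
      using test_function_antiderivative[OF \<psi>] by blast
    let ?c = "LINT t|circle_measure. \<psi> t"
    have "(LINT t|circle_measure. rep_circle_L2 u t * deriv \<Phi> t) = 0"
      using u \<Phi>(1) by (simp add: has_weak_deriv_iff_inner L2_pairing square_integrable_test_function test_function_deriv)
    moreover have "(LINT t|circle_measure. rep_circle_L2 u t * deriv \<Phi> t) =
        (LINT t|circle_measure. rep_circle_L2 u t * \<psi> t) - (LINT t|circle_measure. rep_circle_L2 u t) * ?c"
      using square_integrable_mult[OF square_integrable_rep_L2[of u] square_integrable_test_function[OF \<psi>]]
        square_integrable_integrable[OF square_integrable_rep_L2[of u]]
      by (simp add: \<Phi>(2) right_diff_distrib)
    ultimately show "(LINT t|circle_measure. rep_circle_L2 u t * \<psi> t) = 0"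
      using m by (simp add: mean_L2_def)
  qed
  with rep_L2_zero have "AE t in circle_measure. rep_circle_L2 u t = rep_circle_L2 0 t"
    by eventually_elim simp
  then show ?thesis by (rule circle_L2_eqI)
qed

theorem diffeomorphism_Psi_H:
  assumes f: "smooth (\<lambda>(t, s). f t s)" "periodic f" and tame: "tame f"
  shows "diffeomorphism (Psi_H f)"
proof -
  obtain p where p: "p 0 = f" "\<And>j. continuous_on UNIV (\<lambda>(t, s). p j t s)" "\<And>j. periodic (p j)"
    "\<And>j t s. (p j t has_real_derivative p (Suc j) t s) (at s)"
    using smooth_partial_derivatives[OF f] by blast
  interpret smooth_nonlinearity p by standard (rule p)+
  define Q where "Q u = L2_of_C0 (u - const_C0 (mean_C0 u))" for u
  have Q: "bounded_linear Q"
    unfolding Q_def[abs_def]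
    by (intro bounded_linear_compose[OF bounded_linear_L2_of_C0] bounded_linear_sub bounded_linear_ident
        bounded_linear_const_mean_C0)
  have Q_eq: "Q u = L2_of_C0 u - const_L2 (mean_C0 u)" for u
    by (simp add: Q_def L2_of_C0_linear)
  have TQ: "integrate_L2 (Q u) = prim_C0 u" for u
    by (simp add: Q_eq integrate_L2_of_C0)
  have ex: "\<exists>u. u + prim_C0 (superposition (p 0) u) = integrate_L2 z" for z
  proof -
    obtain W where W: "\<And>s t. 0 \<le> s \<Longrightarrow> s \<le> t \<Longrightarrow> t \<le> 1 \<Longrightarrow> \<bar>eval_C0 (integrate_L2 z) t - eval_C0 (integrate_L2 z) s\<bar> \<le> W t - W s"
      using integrate_L2_variation[of z] by blast
    have "tame (p 0)" using tame by (simp add: p(1))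
    then show ?thesis by (rule ex_solution_tame[OF _ W])
  qed
  define A where "A u = weak_deriv u + const_L2 (mean_L2 (L2_of_H1 u))" for u
  define E where "E y = Abs_circle_H1 (L2_of_C0 (integrate_L2 y))" for y
  have L2_E: "L2_of_H1 (E y) = L2_of_C0 (integrate_L2 y)" for y
    unfolding E_def by (rule L2_of_H1_Abs[OF has_weak_deriv_integrate_L2])
  have deriv_E: "weak_deriv (E y) = y - const_L2 (mean_L2 y)" for y
    by (rule weak_deriv_eqI) (simp add: L2_E has_weak_deriv_integrate_L2)
  have mean_deriv: "mean_L2 (weak_deriv u) = 0" for u
    by (rule mean_weak_deriv[OF has_weak_deriv_weak_deriv])
  have A_lin: "A (u + v) = A u + A v" "A (u - v) = A u - A v" "A (r *\<^sub>R u) = r *\<^sub>R A u" for u v r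
    by (simp_all add: A_def weak_deriv_simps L2_of_H1_simps mean_L2_simps const_L2_linear scaleR_add_right)
  have AE: "A (E y) = y" for y
    by (simp add: A_def L2_E deriv_E mean_L2_of_C0)
  \<comment> \<open>Injectivity of \<open>A\<close> makes the right inverse \<open>E\<close> a left
    inverse too, and linearity of \<open>E\<close> is then inherited from \<open>A\<close>.\<close>
  have A_inj: "u = 0" if "A u = 0" for u
  proof -
    have "mean_L2 (A u) = mean_L2 (L2_of_H1 u)" by (simp add: A_def mean_L2_simps mean_deriv)
    then have m: "mean_L2 (L2_of_H1 u) = 0" using that by (simp add: mean_L2_simps)
    then have "weak_deriv u = 0" using that by (simp add: A_def const_L2_linear)
    then have "L2_of_H1 u = 0"
      using has_weak_deriv_weak_deriv[of u] by (intro weak_deriv_zero_mean_zero m) simp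
    then show ?thesis by (metis L2_of_H1_inject L2_of_H1_simps(1))
  qed
  have EA: "E (A u) = u" for u
    using A_inj[of "E (A u) - u"] by (simp add: A_lin AE)
  have norm_sq: "(norm u)\<^sup>2 = (norm (L2_of_H1 u))\<^sup>2 + (norm (weak_deriv u))\<^sup>2" for u :: circle_H1
    by (simp add: power2_norm_eq_inner inner_circle_H1_def)
  have A: "bounded_linear A"
  proof (rule bounded_linear_intro[of _ 2])
    fix u
    have "norm (L2_of_H1 u) \<le> norm u"
      by (rule power2_le_imp_le) (simp_all add: norm_sq)
    moreover have "norm (weak_deriv u) \<le> norm u"
      by (rule power2_le_imp_le) (simp_all add: norm_sq)
    ultimately show "norm (A u) \<le> norm u * 2"
      using norm_triangle_ineq[of "weak_deriv u" "const_L2 (mean_L2 (L2_of_H1 u))"]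
        norm_const_L2_le[of "mean_L2 (L2_of_H1 u)"] abs_mean_L2_le_norm[of "L2_of_H1 u"]
      by (simp add: A_def)
  qed (rule A_lin)+
  have E: "bounded_linear E"
  proof -
    obtain K where K: "\<And>y. norm (integrate_L2 y) \<le> K * norm y"
      using bounded_linear.bounded[OF bounded_linear_integrate_L2] by (auto simp: mult.commute)
    show ?thesis
    proof (rule bounded_linear_intro[of _ "K + 2"])
      fix x y :: circle_L2 and r :: real
      show "E (x + y) = E x + E y" using EA[of "E x + E y"] by (simp add: A_lin AE)
      show "E (r *\<^sub>R x) = r *\<^sub>R E x" using EA[of "r *\<^sub>R E x"] by (simp add: A_lin AE)
      have "norm (E x) = sqrt ((norm (L2_of_H1 (E x)))\<^sup>2 + (norm (weak_deriv (E x)))\<^sup>2)"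
        by (simp flip: norm_sq)
      also have "\<dots> \<le> norm (L2_of_H1 (E x)) + norm (weak_deriv (E x))"
        by (rule sqrt_sum_squares_le_sum) auto
      also have "norm (L2_of_H1 (E x)) \<le> K * norm x"
        unfolding L2_E using norm_L2_of_C0_le K order_trans by blast
      also have "norm (weak_deriv (E x)) \<le> 2 * norm x"
        using norm_triangle_ineq4[of x "const_L2 (mean_L2 x)"] norm_const_L2_le[of "mean_L2 x"] abs_mean_L2_le_norm[of x]
        by (simp add: deriv_E)
      finally show "norm (E x) \<le> norm x * (K + 2)" by (simp add: algebra_simps)
    qed
  qed
  have "Psi_H f u = A u + Q (superposition (p 0) (integrate_L2 (A u)))" for u
  proof -
    let ?N = "superposition f (integrate_L2 (A u))"
    \<comment> \<open>This provides the continuous representative of \<open>u\<close>, so that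
      almost everywhere the term with \<open>f\<close> in \<open>F_H\<close> is a superposition
      operator on C^0.\<close>
    have L2_u: "L2_of_H1 u = L2_of_C0 (integrate_L2 (A u))" using L2_E[of "A u"] by (simp add: EA)
    have "F_H f u = weak_deriv u + L2_of_C0 ?N"
    proof (rule circle_L2_eqI)
      show "AE t in circle_measure. rep_circle_L2 (F_H f u) t = rep_circle_L2 (weak_deriv u + L2_of_C0 ?N) t"
        using rep_F_H[OF f(1), of u] rep_L2_add[of "weak_deriv u" "L2_of_C0 ?N"] rep_L2_of_C0[of ?N]
          rep_L2_of_C0[of "integrate_L2 (A u)"]
      proof eventually_elim
        case (elim t)
        then show ?case
          by (simp add: L2_u eval_superposition[OF p(2)[of 0] p(3)[of 0], unfolded p(1)])
      qed
    qed
    then show ?thesis by (simp add: Psi_H_def A_def[of u] Q_eq p(1) mean_deriv mean_L2_simps mean_L2_of_C0)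
  qed
  then have "Psi_H f = (\<lambda>u. A u + Q (superposition (p 0) (integrate_L2 (A u))))" by blast
  then show ?thesis
    using diffeomorphism_compose_linear[OF diffeomorphism_perturbed_identity[OF bounded_linear_integrate_L2 Q TQ ex] A E AE EA]
    by simp
qed

theorem theorem1p2:
  fixes f :: "real \<Rightarrow> real \<Rightarrow> real"
  assumes "periodic f" and "smooth (\<lambda>(t, s). f t s)" and "tame f"
  shows "diffeomorphism (Psi_H f) \<and> diffeomorphism (Psi_C f)"
  using diffeomorphism_Psi_H[OF assms(2,1,3)] diffeomorphism_Psi_C[OF assms(2,1,3)] by blast

end
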